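(* Let $N\ge 2$ be an integer and $r\in(0,1)$. Let $E\subset\mathbb R^{d}$ and $E'\subset\mathbb R^{d'}$ be totally disconnected self-similar sets satisfying the open set condition, such that $E$ is generated by $N$ contracting similarities of $\mathbb R^d$ all of ratio $r$ and $E'$ is generated by $N$ contracting similarities of $\mathbb R^{d'}$ all of the same ratio $r$. Then $E$ and $E'$ are Lipschitz equivalent.
   Context: A contracting similarity of ratio $r$ is a map $S$ with $|S(x)-S(y)|=r|x-y|$ for all $x,y$. The self-similar set generated by $S_1,\dots,S_N$ is the unique nonempty compact set $E$ with $E=\bigcup_{i=1}^N S_i(E)$. It satisfies the open set condition if (for this generating family) there is a nonempty bounded open set $O$ such that the sets $S_i(O)$ are pairwise disjoint and contained in $O$. Two metric spaces are Lipschitz equivalent if there is a bijection $f$ between them and a constant $L\ge 1$ with $L^{-1}d_1(x,y)\le d_2(f(x),f(y))\le L\,d_1(x,y)$ for all $x,y$. *)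

theory Defs
  imports "HOL-Analysis.Analysis"
begin

definition contracting_similarity :: "real \<Rightarrow> ('a::metric_space \<Rightarrow> 'a) \<Rightarrow> bool" where
  "contracting_similarity r f \<longleftrightarrow> 0 < r \<and> r < 1 \<and> (\<forall>x y. dist (f x) (f y) = r * dist x y)"

text \<open>A family of \<open>N\<close> maps is a function on \<open>nat\<close> of which only the values at indices \<open>i < N\<close>
  matter; repetitions are allowed.\<close>

text \<open>For contracting similarities of a nonempty complete space and \<open>N \<ge> 1\<close>, Hutchinson's theorem
  says that exactly one set satisfies the following predicate.\<close>

definition self_similar_set_of ::
    "nat \<Rightarrow> (nat \<Rightarrow> 'a::metric_space \<Rightarrow> 'a) \<Rightarrow> 'a set \<Rightarrow> bool" where
  "self_similar_set_of N S E \<longleftrightarrow> E \<noteq> {} \<and> compact E \<and> E = (\<Union>i<N. S i ` E)"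

text \<open>Disjointness is required for distinct indices, even if the maps coincide.\<close>

definition open_set_condition :: "nat \<Rightarrow> (nat \<Rightarrow> 'a::metric_space \<Rightarrow> 'a) \<Rightarrow> bool" where
  "open_set_condition N S \<longleftrightarrow>
     (\<exists>U. U \<noteq> {} \<and> bounded U \<and> open U \<and>
          disjoint_family_on (\<lambda>i. S i ` U) {..<N} \<and> (\<forall>i<N. S i ` U \<subseteq> U))"

definition totally_disconnected :: "'a::topological_space set \<Rightarrow> bool" where
  "totally_disconnected E \<longleftrightarrow> (\<forall>x\<in>E. connected_component_set E x = {x})"

definition lipschitz_equivalent :: "'a::metric_space set \<Rightarrow> 'b::metric_space set \<Rightarrow> bool" where
  "lipschitz_equivalent A B \<longleftrightarrow>
     (\<exists>f L. bij_betw f A B \<and> L \<ge> 1 \<and>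
        (\<forall>x\<in>A. \<forall>y\<in>A. inverse L * dist x y \<le> dist (f x) (f y) \<and> dist (f x) (f y) \<le> L * dist x y))"

end

theory Submission
  imports Defs
begin

text \<open>Both sets are bilipschitz to the space of sequences over \<open>N\<close> letters with the metric
  \<open>r ^ (first difference)\<close>. Call two words of length \<open>n\<close> near if their pieces of \<open>E\<close> are at distance
  at most \<open>r ^ n\<close>; the classes of the generated equivalence are the clusters of level \<open>n\<close>. Total
  disconnectedness and the open set condition bound the number of words and the relative diameter of
  a cluster, and distinct clusters are separated by definition.

  Let \<open>C0\<close> be a cluster with the maximal number of words. By maximality every translate \<open>u C0\<close> is again
  a cluster, so every word has descendants in a copy of \<open>C0\<close>; such words are called good. Let \<open>g\<close> generate
  the group of differences of cardinalities of sets that are unions of clusters of good words. For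
  large \<open>l\<close> the descendants after \<open>l\<close> steps of a cluster of \<open>g * a\<close> good words can be divided into exactly
  \<open>a\<close> groups of \<open>g * N ^ l\<close> words, and a group corresponds to one cylinder of the sequence space with
  no loss of measure at any later step. A bad cluster of any size is sent to a single cylinder: less than
  \<open>N ^ l\<close> of its subclusters are bad again, and the good ones take the cylinders that are left over. The number
  of these need not fit, but a group can be matched with any bounded number \<open>b\<close> of cylinders: after one
  step all but one of the \<open>N ^ l\<close> subgroups have a single cylinder each, and the last one has \<open>b\<close> again.\<close>

subsection \<open>Matching trees\<close>

text \<open>The obstacle is arithmetic. Clusters have bounded but otherwise arbitrary numbers of
  words, so their sizes need not fit those of unions of cylinders, and an error in proportion made
  anew at every level would accumulate without bound. For good words the error is avoided
  altogether. Copies of good sets under prefixes are again unions of clusters, so sizes found at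
  different places can be added, and the differences of sizes form a group. Its generator is the
  right unit, and because it is a difference of two sizes, one set can be exchanged for another to
  correct a count by exactly one unit. For bad words a prefix may merge clusters, and no such
  counting is available. There the proportions are given up: Lipschitz equivalence only asks that
  matched sets have comparable diameters and gaps at each level. The discrepancy does not
  accumulate, since every bad subcluster starts afresh with one cylinder of its own level, while a
  group hands its discrepancy down to one subgroup without enlarging it.\<close>

text \<open>A related pair is a node of a tree, with a part of \<open>X\<close> and a part of
  \<open>Y\<close>. Each point follows one branch, and \<open>f\<close> matches the points that
  follow the same branch. If two branches part at level m, both distances lie between
  \<open>c * \<rho> ^ m\<close> and \<open>C * \<rho> ^ m\<close>, so their quotient is at most
  \<open>C / c\<close>. The distances are plain functions because \<open>seq_dist\<close> is not the
  \<open>dist\<close> of a type; \<open>lim1\<close> and \<open>lim2\<close> stand for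
  compactness.\<close>

lemma bilipschitz_of_matching_tree:
  fixes d1 :: "'a \<Rightarrow> 'a \<Rightarrow> real" and d2 :: "'b \<Rightarrow> 'b \<Rightarrow> real"
    and R :: "nat \<Rightarrow> 'a set \<times> 'b set \<Rightarrow> bool"
  assumes \<rho>: "0 < \<rho>" "\<rho> < 1" and c: "0 < c"
    and d1: "\<And>x y. d1 x y = 0 \<longleftrightarrow> x = y"
    and d2: "\<And>x y. d2 x y = 0 \<longleftrightarrow> x = y"
    and root: "R 0 (X, Y)"
    and diam1: "\<And>n p x y. R n p \<Longrightarrow> x \<in> fst p \<Longrightarrow> y \<in> fst p \<Longrightarrow> 0 \<le> d1 x y \<and> d1 x y \<le> C * \<rho> ^ n"
    and diam2: "\<And>n p x y. R n p \<Longrightarrow> x \<in> snd p \<Longrightarrow> y \<in> snd p \<Longrightarrow> 0 \<le> d2 x y \<and> d2 x y \<le> C * \<rho> ^ n"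
    and split: "\<And>n p. R n p \<Longrightarrow> \<exists>P. (\<forall>q\<in>P. R (Suc n) q) \<and> fst p = \<Union>(fst ` P) \<and> snd p = \<Union>(snd ` P) \<and>
       (\<forall>q\<in>P. \<forall>q'\<in>P. q \<noteq> q' \<longrightarrow> (\<forall>x\<in>fst q. \<forall>y\<in>fst q'. c * \<rho> ^ n \<le> d1 x y) \<and>
                                 (\<forall>x\<in>snd q. \<forall>y\<in>snd q'. c * \<rho> ^ n \<le> d2 x y))"
    and lim1: "\<And>p. (\<And>n. R n (p n)) \<Longrightarrow> (\<And>n. fst (p (Suc n)) \<subseteq> fst (p n)) \<Longrightarrow> (\<Inter>n. fst (p n)) \<noteq> {}"
    and lim2: "\<And>p. (\<And>n. R n (p n)) \<Longrightarrow> (\<And>n. snd (p (Suc n)) \<subseteq> snd (p n)) \<Longrightarrow> (\<Inter>n. snd (p n)) \<noteq> {}"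
  shows "\<exists>f L. bij_betw f X Y \<and> L \<ge> 1 \<and>
     (\<forall>x\<in>X. \<forall>y\<in>X. inverse L * d1 x y \<le> d2 (f x) (f y) \<and> d2 (f x) (f y) \<le> L * d1 x y)"
proof -
  define Q where "Q n p P \<longleftrightarrow> (\<forall>q\<in>P. R (Suc n) q) \<and> fst p = \<Union>(fst ` P) \<and> snd p = \<Union>(snd ` P) \<and>
       (\<forall>q\<in>P. \<forall>q'\<in>P. q \<noteq> q' \<longrightarrow> (\<forall>x\<in>fst q. \<forall>y\<in>fst q'. c * \<rho> ^ n \<le> d1 x y) \<and>
                                 (\<forall>x\<in>snd q. \<forall>y\<in>snd q'. c * \<rho> ^ n \<le> d2 x y))" for n p P
  define P where "P n p = (SOME P. Q n p P)" for n p
  have P: "Q n p (P n p)" if "R n p" for n p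
  proof -
    have "\<exists>P. Q n p P" using split[OF that] unfolding Q_def .
    then show ?thesis unfolding P_def by (rule someI_ex)
  qed
  have PR: "R (Suc n) q" if "R n p" "q \<in> P n p" for n p q
    using P[OF that(1)] that(2) unfolding Q_def by (elim conjE) (rule bspec)
  have P1: "fst p = \<Union>(fst ` P n p)" if "R n p" for n p
    using P[OF that] unfolding Q_def by (elim conjE)
  have P2: "snd p = \<Union>(snd ` P n p)" if "R n p" for n p
    using P[OF that] unfolding Q_def by (elim conjE)
  have sep: "\<forall>q\<in>P n p. \<forall>q'\<in>P n p. q \<noteq> q' \<longrightarrow> (\<forall>x\<in>fst q. \<forall>y\<in>fst q'. c * \<rho> ^ n \<le> d1 x y) \<and>
                                 (\<forall>x\<in>snd q. \<forall>y\<in>snd q'. c * \<rho> ^ n \<le> d2 x y)" if "R n p" for n p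
    using P[OF that] unfolding Q_def by (elim conjE)
  have S1: "c * \<rho> ^ n \<le> d1 x y" if "R n p" "q \<in> P n p" "q' \<in> P n p" "q \<noteq> q'" "x \<in> fst q" "y \<in> fst q'" for n p q q' x y
    using sep[rule_format, OF that(1-4)] that(5,6) by blast
  have S2: "c * \<rho> ^ n \<le> d2 x y" if "R n p" "q \<in> P n p" "q' \<in> P n p" "q \<noteq> q'" "x \<in> snd q" "y \<in> snd q'" for n p q q' x y
    using sep[rule_format, OF that(1-4)] that(5,6) by blast
  have pos: "0 < c * \<rho> ^ n" for n using \<rho> c by simp
  have U1: "q = q'" if "R n p" "q \<in> P n p" "q' \<in> P n p" "x \<in> fst q" "x \<in> fst q'" for n p q q' x
    using S1[OF that(1-3) _ that(4,5)] pos[of n] d1[of x x] by fastforce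
  have U2: "q = q'" if "R n p" "q \<in> P n p" "q' \<in> P n p" "x \<in> snd q" "x \<in> snd q'" for n p q q' x
    using S2[OF that(1-3) _ that(4,5)] pos[of n] d2[of x x] by fastforce
  have E1: "\<exists>q. q \<in> P n p \<and> x \<in> fst q" if "R n p" "x \<in> fst p" for n p x
  proof -
    have "x \<in> \<Union>(fst ` P n p)" using that(2) P1[OF that(1)] by (rule back_subst)
    then show ?thesis by blast
  qed
  have E2: "\<exists>q. q \<in> P n p \<and> x \<in> snd q" if "R n p" "x \<in> snd p" for n p x
  proof -
    have "x \<in> \<Union>(snd ` P n p)" using that(2) P2[OF that(1)] by (rule back_subst)
    then show ?thesis by blast
  qed
  have I1: "fst q \<subseteq> fst p" if "R n p" "q \<in> P n p" for n p q
    by (subst P1[OF that(1)]) (use that(2) in blast)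
  have I2: "snd q \<subseteq> snd p" if "R n p" "q \<in> P n p" for n p q
    by (subst P2[OF that(1)]) (use that(2) in blast)
  \<comment> \<open>The branches: the nodes of level n that contain x on the first side, or y on the
    second. Siblings are separated, so the choice is forced.\<close>
  define b1 where "b1 x = rec_nat (X, Y) (\<lambda>n p. SOME q. q \<in> P n p \<and> x \<in> fst q)" for x
  define b2 where "b2 y = rec_nat (X, Y) (\<lambda>n p. SOME q. q \<in> P n p \<and> y \<in> snd q)" for y
  have b0: "b1 x 0 = (X, Y)" "b2 y 0 = (X, Y)" for x y
    by (simp_all add: b1_def b2_def)
  have bS: "b1 x (Suc n) = (SOME q. q \<in> P n (b1 x n) \<and> x \<in> fst q)"
    "b2 y (Suc n) = (SOME q. q \<in> P n (b2 y n) \<and> y \<in> snd q)" for x y n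
    by (simp_all add: b1_def b2_def)
  have B1: "R n (b1 x n) \<and> x \<in> fst (b1 x n)" if "x \<in> X" for n x
  proof (induction n)
    case 0 then show ?case using root that b0 by simp
  next
    case (Suc n)
    have "\<exists>q. q \<in> P n (b1 x n) \<and> x \<in> fst q" using E1 Suc by blast
    from someI_ex[OF this, folded bS(1)] show ?case using PR Suc by blast
  qed
  have B2: "R n (b2 x n) \<and> x \<in> snd (b2 x n)" if "x \<in> Y" for n x
  proof (induction n)
    case 0 then show ?case using root that b0 by simp
  next
    case (Suc n)
    have "\<exists>q. q \<in> P n (b2 x n) \<and> x \<in> snd q" using E2 Suc by blast
    from someI_ex[OF this, folded bS(2)] show ?case using PR Suc by blast
  qed
  have C1: "b1 x (Suc n) \<in> P n (b1 x n)" if "x \<in> X" for n x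
  proof -
    have "\<exists>q. q \<in> P n (b1 x n) \<and> x \<in> fst q" using E1 B1[OF that, of n] by blast
    from someI_ex[OF this, folded bS(1)] show ?thesis by blast
  qed
  have C2: "b2 x (Suc n) \<in> P n (b2 x n)" if "x \<in> Y" for n x
  proof -
    have "\<exists>q. q \<in> P n (b2 x n) \<and> x \<in> snd q" using E2 B2[OF that, of n] by blast
    from someI_ex[OF this, folded bS(2)] show ?thesis by blast
  qed
  have ex12: "\<exists>y\<in>Y. \<forall>n. b2 y n = b1 x n" if x: "x \<in> X" for x
  proof -
    have "(\<Inter>n. snd (b1 x n)) \<noteq> {}"
    proof (rule lim2)
      fix n show "R n (b1 x n)" using B1[OF x] by blast
      show "snd (b1 x (Suc n)) \<subseteq> snd (b1 x n)"
        using I2 B1[OF x, of n] C1[OF x, of n] by blast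
    qed
    then obtain y where y: "\<And>n. y \<in> snd (b1 x n)" by auto
    have yY: "y \<in> Y" using y[of 0] b0 by simp
    have "b2 y n = b1 x n" for n
    proof (induction n)
      case 0 then show ?case by (simp add: b0)
    next
      case (Suc n)
      then show ?case using U2[of n "b1 x n"] B1[OF x, of n] C1[OF x, of n] C2[OF yY, of n] y[of "Suc n"] B2[OF yY, of "Suc n"]
        by metis
    qed
    then show ?thesis using yY by auto
  qed
  have ex21: "\<exists>x\<in>X. \<forall>n. b2 y n = b1 x n" if y: "y \<in> Y" for y
  proof -
    have "(\<Inter>n. fst (b2 y n)) \<noteq> {}"
    proof (rule lim1)
      fix n show "R n (b2 y n)" using B2[OF y] by blast
      show "fst (b2 y (Suc n)) \<subseteq> fst (b2 y n)"
        using I1 B2[OF y, of n] C2[OF y, of n] by blast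
    qed
    then obtain x where x: "\<And>n. x \<in> fst (b2 y n)" by auto
    have xX: "x \<in> X" using x[of 0] b0 by simp
    have "b2 y n = b1 x n" for n
    proof (induction n)
      case 0 then show ?case by (simp add: b0)
    next
      case (Suc n)
      then show ?case using U1[of n "b2 y n"] B2[OF y, of n] C2[OF y, of n] C1[OF xX, of n] x[of "Suc n"] B1[OF xX, of "Suc n"]
        by metis
    qed
    then show ?thesis using xX by auto
  qed
  obtain f where fY: "\<And>x. x \<in> X \<Longrightarrow> f x \<in> Y" and fb: "\<And>x n. x \<in> X \<Longrightarrow> b2 (f x) n = b1 x n"
    using ex12 by metis
  \<comment> \<open>Used when two branches never part: both distances are then below every
    \<open>C * \<rho> ^ n\<close> and vanish.\<close>
  have small: "d = 0" if "\<And>n. 0 \<le> d \<and> d \<le> C * \<rho> ^ n" for d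
  proof -
    have "(\<lambda>n. C * \<rho> ^ n) \<longlonglongrightarrow> C * 0" using \<rho> by (intro tendsto_intros LIMSEQ_realpow_zero) auto
    then have "d \<le> 0" using that by (intro LIMSEQ_le_const[of "\<lambda>n. C * \<rho> ^ n"]) auto
    then show ?thesis using that[of 0] by simp
  qed
  have key: "\<exists>m. c * \<rho> ^ m \<le> d1 x x' \<and> d1 x x' \<le> C * \<rho> ^ m \<and> c * \<rho> ^ m \<le> d2 y y' \<and> d2 y y' \<le> C * \<rho> ^ m"
    if x: "x \<in> X" "x' \<in> X" and y: "y \<in> Y" "y' \<in> Y" and e: "\<And>n. b2 y n = b1 x n" "\<And>n. b2 y' n = b1 x' n"
      and ne: "x \<noteq> x' \<or> y \<noteq> y'" for x x' y y'
  proof -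
    have "\<exists>n. b1 x n \<noteq> b1 x' n"
    proof (rule ccontr)
      assume "\<not> ?thesis"
      then have eq: "b1 x n = b1 x' n" for n by auto
      have "d1 x x' = 0" using diam1[of _ "b1 x _" x x'] B1 x eq by (intro small) metis
      moreover have "d2 y y' = 0" using diam2[of _ "b2 y _" y y'] B2 y eq e by (intro small) metis
      ultimately show False using ne d1 d2 by blast
    qed
    \<comment> \<open>The first level at which the branches differ. It is not 0, since all branches
      start at the root; one level higher the two nodes have a common parent.\<close>
    then obtain n where n: "b1 x n \<noteq> b1 x' n" "\<And>k. k < n \<Longrightarrow> b1 x k = b1 x' k"
      using exists_least_iff[of "\<lambda>n. b1 x n \<noteq> b1 x' n"] by auto
    then obtain m where m: "n = Suc m" using b0 by (cases n) auto
    have eq: "b1 x m = b1 x' m" and neq: "b1 x (Suc m) \<noteq> b1 x' (Suc m)" using n m by auto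
    have "c * \<rho> ^ m \<le> d1 x x'"
      using S1[of m "b1 x m" "b1 x (Suc m)" "b1 x' (Suc m)" x x'] B1 C1 x eq neq by metis
    moreover have "c * \<rho> ^ m \<le> d2 y y'"
      using S2[of m "b2 y m" "b2 y (Suc m)" "b2 y' (Suc m)" y y'] B2 C2 y eq neq e by metis
    moreover have "d1 x x' \<le> C * \<rho> ^ m" using diam1[of m "b1 x m" x x'] B1 x eq by metis
    moreover have "d2 y y' \<le> C * \<rho> ^ m" using diam2[of m "b2 y m" y y'] B2 y eq e by metis
    ultimately show ?thesis by blast
  qed
  define L where "L = max 1 (C / c)"
  have L: "L \<ge> 1" by (simp add: L_def)
  have comp: "a \<le> L * b" if "a \<le> C * \<rho> ^ m" "c * \<rho> ^ m \<le> b" for a b m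
  proof -
    have "C / c \<le> L" by (simp add: L_def)
    then have "C \<le> L * c" using c by (simp add: divide_le_eq)
    then have "C * \<rho> ^ m \<le> L * (c * \<rho> ^ m)" using \<rho> by (simp add: mult_right_mono mult.assoc[symmetric])
    also have "\<dots> \<le> L * b" using that L by (intro mult_left_mono) auto
    finally show ?thesis using that by simp
  qed
  have est: "inverse L * d1 x x' \<le> d2 (f x) (f x') \<and> d2 (f x) (f x') \<le> L * d1 x x'" if xx: "x \<in> X" "x' \<in> X" for x x'
  proof (cases "x = x'")
    case True then show ?thesis using d1[of x x] d2[of "f x" "f x"] by simp
  next
    case False
    then obtain m where m: "c * \<rho> ^ m \<le> d1 x x'" "d1 x x' \<le> C * \<rho> ^ m" "c * \<rho> ^ m \<le> d2 (f x) (f x')" "d2 (f x) (f x') \<le> C * \<rho> ^ m"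
      using key[OF xx fY[OF xx(1)] fY[OF xx(2)] fb[OF xx(1)] fb[OF xx(2)]] by blast
    have "d1 x x' \<le> L * d2 (f x) (f x')" using comp m by blast
    then have "inverse L * d1 x x' \<le> d2 (f x) (f x')" using L by (simp add: field_simps)
    then show ?thesis using comp m by blast
  qed
  have "bij_betw f X Y"
  proof (rule bij_betwI')
    fix x y assume xy: "x \<in> X" "y \<in> X"
    show "(f x = f y) = (x = y)"
    proof
      assume "f x = f y"
      then have "inverse L * d1 x y \<le> 0" using est[OF xy] d2[of "f x" "f y"] by simp
      then have "d1 x y \<le> 0" using L by (simp add: field_simps)
      moreover have "0 \<le> d1 x y" using diam1[OF root, of x y] xy by simp
      ultimately show "x = y" using d1[of x y] by simp
    qed simp
  next
    fix x assume "x \<in> X" then show "f x \<in> Y" by (rule fY)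
  next
    fix y assume y: "y \<in> Y"
    then obtain x where x: "x \<in> X" "\<And>n. b2 y n = b1 x n" using ex21 by blast
    have "f x = y"
    proof (rule ccontr)
      assume "f x \<noteq> y"
      then obtain m where "c * \<rho> ^ m \<le> d1 x x"
        using key[OF x(1) x(1) fY[OF x(1)] y fb[OF x(1)] x(2)] by blast
      then show False using pos[of m] d1[of x x] by simp
    qed
    then show "\<exists>x\<in>X. y = f x" using x by blast
  qed
  then show ?thesis using est L by blast
qed

subsection \<open>Chains with small steps\<close>

definition chain_steps :: "'a::metric_space set \<Rightarrow> real \<Rightarrow> ('a \<times> 'a) set" where
  "chain_steps A \<delta> = {(x, y). x \<in> A \<and> y \<in> A \<and> dist x y \<le> \<delta>}"

text \<open>Total disconnectedness in quantitative form. The closure is reflexive on the whole type,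
  so the predicate forces \<open>0 \<le> \<eta>\<close> even for empty \<open>A\<close>.\<close>

definition small_chains :: "'a::metric_space set \<Rightarrow> real \<Rightarrow> real \<Rightarrow> bool" where
  "small_chains A \<delta> \<eta> \<longleftrightarrow> (\<forall>x y. (x, y) \<in> (chain_steps A \<delta>)\<^sup>* \<longrightarrow> dist x y \<le> \<eta>)"

lemma small_chainsD: "small_chains A \<delta> \<eta> \<Longrightarrow> (x, y) \<in> (chain_steps A \<delta>)\<^sup>* \<Longrightarrow> dist x y \<le> \<eta>"
  by (simp add: small_chains_def)

lemma small_chains_empty: "0 \<le> \<eta> \<Longrightarrow> small_chains {} \<delta> \<eta>"
  by (simp add: small_chains_def chain_steps_def)

lemma small_chains_mono:
  assumes "small_chains A \<delta>' \<eta>" "\<delta> \<le> \<delta>'"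
  shows "small_chains A \<delta> \<eta>"
proof -
  have "chain_steps A \<delta> \<subseteq> chain_steps A \<delta>'" using assms by (auto simp: chain_steps_def)
  then have "(chain_steps A \<delta>)\<^sup>* \<subseteq> (chain_steps A \<delta>')\<^sup>*" by (rule rtrancl_mono)
  then show ?thesis using assms(1) unfolding small_chains_def by blast
qed

text \<open>By injectivity of \<open>f\<close> a chain in the image lifts to a chain in
  \<open>A\<close>. Only a trivial chain can start outside the image, whence the separate case
  \<open>u = v\<close>.\<close>

lemma small_chains_similarity_image:
  assumes "small_chains A \<delta> \<eta>" and c: "0 < c" and f: "\<And>x y. dist (f x) (f y) = c * dist x y"
  shows "small_chains (f ` A) (c * \<delta>) (c * \<eta>)"
proof -
  have "u = v \<or> (\<exists>x y. u = f x \<and> v = f y \<and> (x, y) \<in> (chain_steps A \<delta>)\<^sup>*)"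
    if "(u, v) \<in> (chain_steps (f ` A) (c * \<delta>))\<^sup>*" for u v
    using that
  proof (induction rule: rtrancl_induct)
    case (step y z)
    from step(2) obtain a b where ab: "y = f a" "z = f b" "a \<in> A" "b \<in> A" "dist a b \<le> \<delta>"
      using c by (auto simp: chain_steps_def f)
    then have s: "(a, b) \<in> chain_steps A \<delta>" by (simp add: chain_steps_def)
    from step(3) show ?case
    proof
      assume "u = y" then show ?thesis using ab s by blast
    next
      assume "\<exists>x y'. u = f x \<and> y = f y' \<and> (x, y') \<in> (chain_steps A \<delta>)\<^sup>*"
      then obtain x y' where x: "u = f x" "y = f y'" "(x, y') \<in> (chain_steps A \<delta>)\<^sup>*" by blast
      have "dist (f y') (f a) = 0" using x ab by simp
      then have "y' = a" using c by (simp add: f)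
      then have "(x, b) \<in> (chain_steps A \<delta>)\<^sup>*" using x s by (auto intro: rtrancl_into_rtrancl)
      then show ?thesis using x ab by blast
    qed
  qed simp
  moreover have "0 \<le> \<eta>" using assms(1) by (force simp: small_chains_def)
  ultimately show ?thesis using c assms(1)
    by (fastforce simp: small_chains_def f)
qed

text \<open>Maximal runs of the chain inside \<open>A\<close> are so short that dropping them leaves a chain in \<open>B\<close>
  with admissible steps.\<close>

lemma small_chains_Un:
  assumes A: "small_chains A \<delta>' (\<delta> / 4)" and B: "small_chains B \<delta> (\<eta> / 4)"
    and le: "\<delta>' \<le> \<delta> / 4" "\<delta> \<le> \<eta> / 4"
  shows "small_chains (A \<union> B) \<delta>' \<eta>"
proof -
  let ?A = "(chain_steps A \<delta>')\<^sup>*" and ?B = "(chain_steps B \<delta>)\<^sup>*"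
  have pos: "0 \<le> \<delta>" using small_chainsD[OF A, of x x for x] by force
  \<comment> \<open>Either only \<open>A\<close> has been used so far, or x is close to a point b of
    \<open>B\<close>, a chain in \<open>B\<close> leads from b to the last point b' met there, and a
    run in \<open>A\<close> from a to y follows.\<close>
  have inv: "(x, y) \<in> ?A \<or> (\<exists>b b' a. b \<in> B \<and> b' \<in> B \<and> dist x b \<le> \<delta> / 2 \<and> (b, b') \<in> ?B \<and> dist b' a \<le> \<delta>' \<and> (a, y) \<in> ?A)"
    if "(x, y) \<in> (chain_steps (A \<union> B) \<delta>')\<^sup>*" for x y
    using that
  proof (induction rule: rtrancl_induct)
    case (step y z)
    have yz: "y \<in> A \<union> B" "z \<in> A \<union> B" "dist y z \<le> \<delta>'" using step(2) by (auto simp: chain_steps_def)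
    have pos': "0 \<le> \<delta>'" using yz(3) zero_le_dist order_trans by blast
    show ?case
    proof (cases "z \<in> B")
      case True
      from step(3) show ?thesis
      proof
        assume "(x, y) \<in> ?A"
        then have "dist x z \<le> \<delta> / 2" using small_chainsD[OF A] yz dist_triangle[of x z y] le by fastforce
        then show ?thesis using True pos' by (intro disjI2 exI[of _ z]) auto
      next
        assume "\<exists>b b' a. b \<in> B \<and> b' \<in> B \<and> dist x b \<le> \<delta> / 2 \<and> (b, b') \<in> ?B \<and> dist b' a \<le> \<delta>' \<and> (a, y) \<in> ?A"
        then obtain b b' a where b: "b \<in> B" "b' \<in> B" "dist x b \<le> \<delta> / 2" "(b, b') \<in> ?B" "dist b' a \<le> \<delta>'" "(a, y) \<in> ?A"
          by blast
        \<comment> \<open>Two steps of length \<open>\<delta>'\<close> and the run between them, of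
          length at most \<open>\<delta> / 4\<close>, together make one admissible step in
          \<open>B\<close>.\<close>
        have "dist b' z \<le> \<delta>"
          using small_chainsD[OF A b(6)] b(5) yz(3) dist_triangle[of b' z y] dist_triangle[of b' y a] le pos by linarith
        then have "(b, z) \<in> ?B" using b True by (auto simp: chain_steps_def intro: rtrancl_into_rtrancl)
        then show ?thesis using b True pos' by (intro disjI2 exI[of _ b] exI[of _ z] exI[of _ z]) auto
      qed
    next
      case False
      then have zA: "z \<in> A" using yz by auto
      show ?thesis
      proof (cases "y \<in> A")
        case True
        then have "(y, z) \<in> chain_steps A \<delta>'" using zA yz by (auto simp: chain_steps_def)
        then show ?thesis using step(3) by (meson rtrancl.rtrancl_into_rtrancl)
      next
        case False
        then have yB: "y \<in> B" using yz by auto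
        have triv: "a = y" if "(a, y) \<in> ?A" for a
          using that False by (auto simp: chain_steps_def elim: rtranclE)
        from step(3) show ?thesis
        proof
          assume "(x, y) \<in> ?A"
          then have "x = y" by (rule triv)
          then show ?thesis using yB yz(3) pos by (intro disjI2 exI[of _ y] exI[of _ y] exI[of _ z]) auto
        next
          assume "\<exists>b b' a. b \<in> B \<and> b' \<in> B \<and> dist x b \<le> \<delta> / 2 \<and> (b, b') \<in> ?B \<and> dist b' a \<le> \<delta>' \<and> (a, y) \<in> ?A"
          then obtain b b' a where b: "b \<in> B" "b' \<in> B" "dist x b \<le> \<delta> / 2" "(b, b') \<in> ?B" "dist b' a \<le> \<delta>'" "(a, y) \<in> ?A"
            by blast
          have "a = y" using triv b by blast
          then have "dist b' y \<le> \<delta>" using b le pos by auto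
          then have "(b, y) \<in> ?B" using b yB by (auto simp: chain_steps_def intro: rtrancl_into_rtrancl)
          then show ?thesis using b yB yz(3) by (intro disjI2 exI[of _ b] exI[of _ y] exI[of _ z]) auto
        qed
      qed
    qed
  qed simp
  have "dist x y \<le> \<eta>" if "(x, y) \<in> (chain_steps (A \<union> B) \<delta>')\<^sup>*" for x y
    using inv[OF that]
  proof
    assume "(x, y) \<in> ?A" then show ?thesis using small_chainsD[OF A] le pos by fastforce
  next
    assume "\<exists>b b' a. b \<in> B \<and> b' \<in> B \<and> dist x b \<le> \<delta> / 2 \<and> (b, b') \<in> ?B \<and> dist b' a \<le> \<delta>' \<and> (a, y) \<in> ?A"
    then obtain b b' a where b: "dist x b \<le> \<delta> / 2" "(b, b') \<in> ?B" "dist b' a \<le> \<delta>'" "(a, y) \<in> ?A"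
      by blast
    show ?thesis
      using b(1,3) small_chainsD[OF A b(4)] small_chainsD[OF B b(2)] le pos
        dist_triangle[of x y b] dist_triangle[of b y b'] dist_triangle[of b' y a] by linarith
  qed
  then show ?thesis by (simp add: small_chains_def)
qed

text \<open>\<open>s n\<close> is the scale of the sets in \<open>\<A> n\<close>. The point is that
  \<delta> depends neither on n nor on the member of the family.\<close>

definition uniformly_disconnected :: "(nat \<Rightarrow> real) \<Rightarrow> (nat \<Rightarrow> 'a::metric_space set set) \<Rightarrow> bool" where
  "uniformly_disconnected s \<A> \<longleftrightarrow>
     (\<forall>\<eta>>0. \<exists>\<delta>>0. \<forall>n. \<forall>A\<in>\<A> n. small_chains A (\<delta> * s n) (\<eta> * s n))"

text \<open>One set is added at a time, and the order of the constants matters: \<delta>0 for the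
  union of the k others comes from \<open>\<eta> / 4\<close>, and only then \<delta>2 for the
  additional set, whose runs have to be short compared with the steps allowed in the others.\<close>

lemma uniformly_disconnected_Union:
  assumes \<A>: "uniformly_disconnected s \<A>" and s: "\<And>n. 0 < s n"
  shows "uniformly_disconnected s (\<lambda>n. {\<Union>F |F. F \<subseteq> \<A> n \<and> finite F \<and> card F \<le> k})"
proof (induction k)
  case 0
  show ?case unfolding uniformly_disconnected_def
  proof (intro allI impI exI[of _ 1] conjI ballI)
    fix \<eta> :: real and n and A assume "0 < \<eta>" "A \<in> {\<Union>F |F. F \<subseteq> \<A> n \<and> finite F \<and> card F \<le> 0}"
    then obtain F where F: "A = \<Union>F" "finite F" "card F \<le> 0" by blast
    then have "F = {}" by simp
    then have "A = {}" using F(1) by simp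
    moreover have "0 \<le> \<eta> * s n" using s[of n] \<open>0 < \<eta>\<close> by (intro mult_nonneg_nonneg) auto
    ultimately show "small_chains A (1 * s n) (\<eta> * s n)" using small_chains_empty by blast
  qed simp
next
  case (Suc k)
  show ?case unfolding uniformly_disconnected_def
  proof (intro allI impI)
    fix \<eta> :: real assume \<eta>: "\<eta> > 0"
    have "\<eta> / 4 > 0" using \<eta> by simp
    from Suc[unfolded uniformly_disconnected_def, rule_format, OF this]
    obtain \<delta>0 where \<delta>0: "\<delta>0 > 0 \<and> (\<forall>n. \<forall>A\<in>{\<Union>F |F. F \<subseteq> \<A> n \<and> finite F \<and> card F \<le> k}.
        small_chains A (\<delta>0 * s n) (\<eta> / 4 * s n))"
      by (rule exE)
    have d0: "small_chains (\<Union>F) (\<delta>0 * s n) (\<eta> / 4 * s n)" if "F \<subseteq> \<A> n" "finite F" "card F \<le> k" for n F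
      by (rule \<delta>0[THEN conjunct2, rule_format]) (use that in auto)
    define \<delta>1 where "\<delta>1 = min \<delta>0 (\<eta> / 4)"
    have d1: "\<delta>1 > 0" "\<delta>1 \<le> \<eta> / 4" "\<delta>1 \<le> \<delta>0" using \<delta>0[THEN conjunct1] \<eta> by (auto simp: \<delta>1_def)
    have "\<delta>1 / 4 > 0" using d1 by simp
    from \<A>[unfolded uniformly_disconnected_def, rule_format, OF this]
    obtain \<delta>2 where \<delta>2: "\<delta>2 > 0 \<and> (\<forall>n. \<forall>A\<in>\<A> n. small_chains A (\<delta>2 * s n) (\<delta>1 / 4 * s n))"
      by (rule exE)
    note d2 = \<delta>2[THEN conjunct1] \<delta>2[THEN conjunct2, rule_format]
    define \<delta> where "\<delta> = min \<delta>2 (\<delta>1 / 4)"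
    have d: "\<delta> > 0" "\<delta> \<le> \<delta>1 / 4" "\<delta> \<le> \<delta>2" using d2(1) d1 by (auto simp: \<delta>_def)
    have "small_chains (\<Union>F) (\<delta> * s n) (\<eta> * s n)" if F: "F \<subseteq> \<A> n" "finite F" "card F \<le> Suc k" for n F
    proof (cases "F = {}")
      case True then show ?thesis using \<eta> s[of n] by (auto intro!: small_chains_empty)
    next
      case False
      then obtain A where A: "A \<in> F" by blast
      have c: "card (F - {A}) \<le> k" using A F by simp
      have *: "small_chains (A \<union> \<Union>(F - {A})) (\<delta> * s n) (\<eta> * s n)"
      proof (rule small_chains_Un)
        have "small_chains A (\<delta>2 * s n) (\<delta>1 / 4 * s n)" using A F by (intro d2(2)) auto
        then have "small_chains A (\<delta> * s n) (\<delta>1 / 4 * s n)"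
          by (rule small_chains_mono) (use d s[of n] in \<open>simp add: mult_right_mono less_imp_le\<close>)
        then show "small_chains A (\<delta> * s n) (\<delta>1 * s n / 4)" by simp
        have "small_chains (\<Union>(F - {A})) (\<delta>0 * s n) (\<eta> / 4 * s n)" using F c by (intro d0) auto
        then have "small_chains (\<Union>(F - {A})) (\<delta>1 * s n) (\<eta> / 4 * s n)"
          by (rule small_chains_mono) (use d1 s[of n] in \<open>simp add: mult_right_mono less_imp_le\<close>)
        then show "small_chains (\<Union>(F - {A})) (\<delta>1 * s n) (\<eta> * s n / 4)" by simp
        have "\<delta> * s n \<le> \<delta>1 / 4 * s n" using d s[of n] by (intro mult_right_mono) auto
        then show "\<delta> * s n \<le> \<delta>1 * s n / 4" by simp
        have "\<delta>1 * s n \<le> \<eta> / 4 * s n" using d1 s[of n] by (intro mult_right_mono) auto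
        then show "\<delta>1 * s n \<le> \<eta> * s n / 4" by simp
      qed
      have "A \<union> \<Union>(F - {A}) = \<Union>F" using A by auto
      then show ?thesis using * by simp
    qed
    then show "\<exists>\<delta>>0. \<forall>n. \<forall>A\<in>{\<Union>F |F. F \<subseteq> \<A> n \<and> finite F \<and> card F \<le> Suc k}. small_chains A (\<delta> * s n) (\<eta> * s n)"
      using d(1) by (intro exI[of _ \<delta>]) auto
  qed
qed

text \<open>Components are points, so by Sura-Bura each point has a clopen neighbourhood inside a
  small ball. Compactness leaves a gap between it and the rest of \<open>E\<close>, and a chain with
  steps shorter than the gap cannot leave it. Finitely many neighbourhoods give one step
  length.\<close>

lemma totally_disconnected_small_chains:
  fixes E :: "'a::euclidean_space set"
  assumes E: "compact E" and td: "totally_disconnected E" and \<eta>: "\<eta> > 0"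
  shows "\<exists>\<delta>>0. small_chains E \<delta> \<eta>"
proof -
  have "\<exists>K d. openin (top_of_set E) K \<and> x \<in> K \<and> K \<subseteq> ball x (\<eta> / 2) \<and> 0 < d \<and> (\<forall>y\<in>K. \<forall>z\<in>E - K. d \<le> dist y z)"
    if x: "x \<in> E" for x
  proof -
    have "{x} \<in> components E"
      using td x unfolding totally_disconnected_def components_def by (metis image_eqI)
    then obtain K where K: "openin (top_of_set E) K" "compact K" "{x} \<subseteq> K" "K \<subseteq> ball x (\<eta> / 2)"
      using Sura_Bura_clopen_subset[of E "{x}" "ball x (\<eta> / 2)"] E \<eta>
      by (auto simp: closed_imp_locally_compact compact_imp_closed)
    have "closedin (top_of_set E) (E - K)" using K(1) by (metis closedin_def topspace_euclidean_subtopology Diff_subset double_diff openin_imp_subset subset_refl)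
    then have "closed (E - K)" using E by (meson closedin_compact compact_imp_closed)
    then obtain d where "d > 0" "\<forall>y\<in>K. \<forall>z\<in>E - K. d \<le> dist y z"
      using separate_compact_closed[OF K(2), of "E - K"] by auto
    then show ?thesis using K by blast
  qed
  then have "\<forall>x\<in>E. \<exists>Kd. openin (top_of_set E) (fst Kd) \<and> x \<in> fst Kd \<and> fst Kd \<subseteq> ball x (\<eta> / 2) \<and>
      0 < snd Kd \<and> (\<forall>y\<in>fst Kd. \<forall>z\<in>E - fst Kd. snd Kd \<le> dist y z)"
    by simp
  then obtain Kd where Kd: "\<forall>x\<in>E. openin (top_of_set E) (fst (Kd x)) \<and> x \<in> fst (Kd x) \<and> fst (Kd x) \<subseteq> ball x (\<eta> / 2) \<and>
      0 < snd (Kd x) \<and> (\<forall>y\<in>fst (Kd x). \<forall>z\<in>E - fst (Kd x). snd (Kd x) \<le> dist y z)"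
    by (rule bchoice[THEN exE])
  define K where "K x = fst (Kd x)" for x
  define d where "d x = snd (Kd x)" for x
  have KD: "openin (top_of_set E) (K x) \<and> x \<in> K x \<and> K x \<subseteq> ball x (\<eta> / 2) \<and>
      0 < d x \<and> (\<forall>y\<in>K x. \<forall>z\<in>E - K x. d x \<le> dist y z)" if "x \<in> E" for x
    unfolding K_def d_def using Kd that by (rule bspec)
  note K = KD[THEN conjunct1] KD[THEN conjunct2, THEN conjunct1] KD[THEN conjunct2, THEN conjunct2, THEN conjunct1]
  note d = KD[THEN conjunct2, THEN conjunct2, THEN conjunct2, THEN conjunct1]
  have dsep: "d x \<le> dist y z" if "x \<in> E" "y \<in> K x" "z \<in> E - K x" for x y z
    using KD[OF that(1)] that(2,3) by (elim conjE) (drule bspec, assumption, erule bspec)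
  have "\<forall>x\<in>E. \<exists>T. open T \<and> K x = E \<inter> T" using K(1) unfolding openin_open by blast
  then obtain T where "\<forall>x\<in>E. open (T x) \<and> K x = E \<inter> T x" by (rule bchoice[THEN exE])
  note T = this[THEN bspec, THEN conjunct1] this[THEN bspec, THEN conjunct2]
  have "x \<in> (\<Union>x\<in>E. T x)" if "x \<in> E" for x using K(2)[OF that] T(2)[OF that] that by auto
  then obtain D where D: "D \<subseteq> E" "finite D" "E \<subseteq> (\<Union>x\<in>D. T x)"
    by (rule_tac compactE_image[OF E, of E T]) (use T(1) in auto)
  \<comment> \<open>Half of the smallest gap, to be strictly below each of them; the additional 1
    keeps the minimum defined for empty \<open>D\<close>.\<close>
  define \<delta> where "\<delta> = Min (insert 1 (d ` D)) / 2"
  have "0 < Min (insert 1 (d ` D))" using D d by (subst Min_gr_iff) auto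
  then have \<delta>0: "\<delta> > 0" by (simp add: \<delta>_def)
  have \<delta>d: "\<delta> < d x" if "x \<in> D" for x
  proof -
    have "Min (insert 1 (d ` D)) \<le> d x" using D that by (intro Min_le) auto
    then show ?thesis using \<delta>0 by (simp add: \<delta>_def)
  qed
  have "dist x y \<le> \<eta>" if xy: "(x, y) \<in> (chain_steps E \<delta>)\<^sup>*" for x y
  proof (cases "x = y")
    case False
    then have "x \<in> E" using xy by (auto simp: chain_steps_def elim: converse_rtranclE)
    then obtain a where "a \<in> D" "x \<in> T a" using D(3) by blast
    then have a: "a \<in> D" "x \<in> K a" using T(2)[of a] D(1) \<open>x \<in> E\<close> by auto
    have "y \<in> K a" using xy
    proof (induction rule: rtrancl_induct)
      case base then show ?case by (rule a)
    next
      case (step y z)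
      then show ?case using dsep[of a y z] \<delta>d[OF a(1)] a D by (force simp: chain_steps_def)
    qed
    then have "dist a x < \<eta> / 2" "dist a y < \<eta> / 2" using K(3)[of a] a D \<open>y \<in> K a\<close> by (auto simp: subset_eq)
    then show ?thesis using dist_triangle3[of x y a] by linarith
  qed (use \<eta> in simp)
  then show ?thesis using \<delta>0 by (auto simp: small_chains_def)
qed

subsection \<open>Words and cylinders\<close>

definition words :: "nat \<Rightarrow> nat \<Rightarrow> nat list set" where
  "words N n = {w. set w \<subseteq> {..<N} \<and> length w = n}"

lemma finite_words [simp]: "finite (words N n)"
  by (simp add: words_def finite_lists_length_eq)

lemma card_words: "card (words N n) = N ^ n"
  by (simp add: words_def card_lists_length_eq)

lemma words_0 [simp]: "words N 0 = {[]}"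
  by (auto simp: words_def)

lemma length_words: "w \<in> words N n \<Longrightarrow> length w = n"
  by (simp add: words_def)

lemma append_in_words: "w \<in> words N n \<Longrightarrow> v \<in> words N m \<Longrightarrow> w @ v \<in> words N (n + m)"
  by (auto simp: words_def)

lemma append_words_iff: "length w = n \<Longrightarrow> w @ v \<in> words N (n + m) \<longleftrightarrow> w \<in> words N n \<and> v \<in> words N m"
  by (auto simp: words_def)

lemma take_in_words: "w \<in> words N (n + m) \<Longrightarrow> take n w \<in> words N n"
  by (auto simp: words_def dest: in_set_takeD)

lemma drop_in_words: "w \<in> words N (n + m) \<Longrightarrow> drop n w \<in> words N m"
  by (auto simp: words_def dest: in_set_dropD)

lemma words_Suc_cases:
  assumes "w \<in> words N (Suc n)"
  obtains i v where "w = i # v" "i < N" "v \<in> words N n"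
  using assms by (cases w) (auto simp: words_def)

primrec act :: "(nat \<Rightarrow> 'a \<Rightarrow> 'a) \<Rightarrow> nat list \<Rightarrow> 'a \<Rightarrow> 'a" where
  "act S [] x = x"
| "act S (i # w) x = S i (act S w x)"

lemma act_append: "act S (w @ v) x = act S w (act S v x)"
  by (induction w) auto

text \<open>Division by s reduces to a fixed ball, covered by finitely many balls of radius
  \<open>\<epsilon> / 2\<close>; each of these holds at most one of the points. Hence the bound is
  the same at all scales.\<close>

lemma packing_bound:
  fixes \<rho> \<epsilon> :: real
  assumes \<epsilon>: "\<epsilon> > 0"
  shows "\<exists>M. \<forall>(I::'i set) (p::'i \<Rightarrow> 'a::euclidean_space) x s. s > 0 \<longrightarrow>
    (\<forall>i\<in>I. dist x (p i) \<le> \<rho> * s) \<longrightarrow> (\<forall>i\<in>I. \<forall>j\<in>I. i \<noteq> j \<longrightarrow> \<epsilon> * s \<le> dist (p i) (p j)) \<longrightarrow> card I \<le> M"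
proof -
  have "\<exists>K. finite K \<and> cball (0::'a) \<rho> \<subseteq> (\<Union>y\<in>K. ball y (\<epsilon> / 2))"
    using compact_cball[of "0::'a" \<rho>] \<epsilon> by (simp add: compact_eq_totally_bounded)
  then obtain K where K: "finite K" "cball (0::'a) \<rho> \<subseteq> (\<Union>y\<in>K. ball y (\<epsilon> / 2))"
    by (elim exE conjE)
  have "card I \<le> card K"
    if s: "s > 0" and near: "\<forall>i\<in>I. dist x (p i) \<le> \<rho> * s"
      and sep: "\<forall>i\<in>I. \<forall>j\<in>I. i \<noteq> j \<longrightarrow> \<epsilon> * s \<le> dist (p i) (p j)"
    for I :: "'i set" and p :: "'i \<Rightarrow> 'a" and x s
  proof -
    define q where "q i = (p i - x) /\<^sub>R s" for i
    have q: "dist (q i) (q j) = dist (p i) (p j) / s" for i j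
    proof -
      have "q i - q j = (p i - p j) /\<^sub>R s" by (simp add: q_def scaleR_diff_right)
      then show ?thesis using s by (simp add: dist_norm divide_inverse mult.commute)
    qed
    have "\<exists>y\<in>K. q i \<in> ball y (\<epsilon> / 2)" if "i \<in> I" for i
    proof -
      have "norm (q i) = dist x (p i) / s"
        using s by (simp add: q_def dist_norm divide_inverse mult.commute norm_minus_commute)
      also have "\<dots> \<le> \<rho>" using near that s by (simp add: divide_le_eq)
      finally show ?thesis using K(2) by (auto simp: subset_eq)
    qed
    then have "\<forall>i\<in>I. \<exists>y. y \<in> K \<and> q i \<in> ball y (\<epsilon> / 2)" by blast
    then obtain h where h: "\<forall>i\<in>I. h i \<in> K \<and> q i \<in> ball (h i) (\<epsilon> / 2)"
      by (rule bchoice[THEN exE])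
    have "inj_on h I"
    proof (rule inj_onI, rule ccontr)
      fix i j assume ij: "i \<in> I" "j \<in> I" "h i = h j" "i \<noteq> j"
      have "dist (h i) (q i) < \<epsilon> / 2" "dist (h i) (q j) < \<epsilon> / 2"
        using h[rule_format, OF ij(1)] h[rule_format, OF ij(2)] ij(3) by auto
      then have "dist (q i) (q j) < \<epsilon>" using dist_triangle3[of "q i" "q j" "h i"] by linarith
      moreover have "\<epsilon> \<le> dist (q i) (q j)"
        using sep[rule_format, OF ij(1,2,4)] s by (simp add: q le_divide_eq)
      ultimately show False by simp
    qed
    moreover have "h ` I \<subseteq> K" using h by auto
    ultimately show ?thesis using K(1) by (rule card_inj_on_le)
  qed
  then show ?thesis by (intro exI[of _ "card K"]) auto
qed

text \<open>Subtracting \<open>f 0\<close> and dividing by r leaves an isometry that fixes the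
  origin, hence an orthogonal map. Surjectivity serves to write any point as an image under a given
  \<open>act S w\<close>.\<close>

lemma contracting_similarity_surj:
  fixes f :: "'a::euclidean_space \<Rightarrow> 'a"
  assumes "contracting_similarity r f"
  shows "surj f"
proof -
  have r: "0 < r" and f: "\<And>x y. dist (f x) (f y) = r * dist x y"
    using assms by (auto simp: contracting_similarity_def)
  define g where "g x = (f x - f 0) /\<^sub>R r" for x
  have "dist (g x) (g y) = dist x y" for x y
  proof -
    have "g x - g y = (f x - f y) /\<^sub>R r" by (simp add: g_def scaleR_diff_right)
    then have "dist (g x) (g y) = dist (f x) (f y) / r"
      using r by (simp add: dist_norm divide_inverse mult.commute)
    then show ?thesis using r f by simp
  qed
  then have "orthogonal_transformation g"
    by (simp add: orthogonal_transformation_isometry g_def)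
  then have sg: "surj g" by (rule orthogonal_transformation_surj)
  show ?thesis
  proof (rule surjI)
    fix y
    have "g (inv g ((y - f 0) /\<^sub>R r)) = (y - f 0) /\<^sub>R r" using sg by (rule surj_f_inv_f)
    then show "f (inv g ((y - f 0) /\<^sub>R r)) = y" using r by (simp add: g_def)
  qed
qed

locale osc_system =
  fixes N :: nat and r :: real and S :: "nat \<Rightarrow> 'a::euclidean_space \<Rightarrow> 'a" and E :: "'a set"
  assumes N2: "2 \<le> N" and r0: "0 < r" and r1: "r < 1"
    and sim: "\<And>i. i < N \<Longrightarrow> contracting_similarity r (S i)"
    and ss: "self_similar_set_of N S E"
    and osc: "open_set_condition N S"
    and td: "totally_disconnected E"
begin

definition piece :: "nat list \<Rightarrow> 'a set" where
  "piece w = act S w ` E"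

lemma rpow_pos [simp]: "0 < r ^ n"
  using r0 by simp

lemma rpow_nonneg [simp]: "0 \<le> r ^ n"
  using r0 by simp

lemma dist_sim: "i < N \<Longrightarrow> dist (S i x) (S i y) = r * dist x y"
  using sim by (simp add: contracting_similarity_def)

lemma dist_act: "set w \<subseteq> {..<N} \<Longrightarrow> dist (act S w x) (act S w y) = r ^ length w * dist x y"
  by (induction w) (auto simp: dist_sim)

lemma dist_act_words: "w \<in> words N n \<Longrightarrow> dist (act S w x) (act S w y) = r ^ n * dist x y"
  using dist_act by (auto simp: words_def)

lemma surj_act: "set w \<subseteq> {..<N} \<Longrightarrow> surj (act S w)"
proof (induction w)
  case (Cons i w)
  have eq: "act S (i # w) = S i \<circ> act S w" by (auto simp: fun_eq_iff)
  have "surj (S i)" using Cons.prems contracting_similarity_surj[OF sim] by simp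
  moreover have "surj (act S w)" using Cons by simp
  ultimately show ?case unfolding eq by (rule comp_surj[rotated])
qed (simp add: surj_def)

lemmas E_nonempty = ss[unfolded self_similar_set_of_def, THEN conjunct1]
lemmas compact_E = ss[unfolded self_similar_set_of_def, THEN conjunct2, THEN conjunct1]
lemmas E_eq = ss[unfolded self_similar_set_of_def, THEN conjunct2, THEN conjunct2]

lemma piece_nonempty: "piece w \<noteq> {}"
  using E_nonempty by (simp add: piece_def)

lemma compact_piece: "w \<in> words N n \<Longrightarrow> compact (piece w)"
proof -
  assume w: "w \<in> words N n"
  have "continuous_on E (act S w)"
  proof (rule continuous_onI)
    fix x e assume "(0::real) < e"
    then show "\<exists>d>0. \<forall>x'\<in>E. dist x' x < d \<longrightarrow> dist (act S w x') (act S w x) \<le> e"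
      using r0 dist_act_words[OF w]
      by (intro exI[of _ "e / r ^ n"]) (auto simp: field_simps)
  qed
  then show ?thesis unfolding piece_def using compact_E by (rule compact_continuous_image)
qed

lemma E_words: "E = (\<Union>w\<in>words N m. piece w)"
proof (induction m)
  case 0 then show ?case by (simp add: piece_def)
next
  case (Suc m)
  show ?case
  proof (intro set_eqI iffI)
    fix x assume "x \<in> E"
    then have "x \<in> (\<Union>i<N. S i ` E)" by (subst (asm) E_eq)
    then obtain i y where i: "i < N" "y \<in> E" "x = S i y" by auto
    have "y \<in> (\<Union>w\<in>words N m. piece w)" using i(2) Suc by simp
    then obtain w z where w: "w \<in> words N m" "z \<in> E" "y = act S w z" by (auto simp: piece_def)
    have "i # w \<in> words N (Suc m)" using w i by (auto simp: words_def)
    moreover have "x \<in> piece (i # w)" using i w by (auto simp: piece_def)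
    ultimately show "x \<in> (\<Union>w\<in>words N (Suc m). piece w)" by (rule UN_I)
  next
    fix x assume "x \<in> (\<Union>w\<in>words N (Suc m). piece w)"
    then obtain w where w: "w \<in> words N (Suc m)" "x \<in> piece w" by (elim UN_E)
    from w(1) obtain i v where v: "w = i # v" "i < N" "v \<in> words N m" by (rule words_Suc_cases)
    obtain z where z: "z \<in> E" "x = S i (act S v z)" using w(2) v(1) by (auto simp: piece_def)
    have "act S v z \<in> (\<Union>w\<in>words N m. piece w)" using v(3) z(1) by (auto simp: piece_def)
    then have "act S v z \<in> E" using Suc by simp
    then have "x \<in> (\<Union>i<N. S i ` E)" using z(2) v(2) by auto
    then show "x \<in> E" by (subst E_eq)
  qed
qed

lemma piece_append: "piece (w @ v) = act S w ` piece v"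
  by (simp add: piece_def act_append image_image)

lemma piece_words: "piece w = (\<Union>v\<in>words N m. piece (w @ v))"
proof -
  have "piece w = act S w ` (\<Union>v\<in>words N m. piece v)"
    unfolding piece_def[of w] using E_words by simp
  then show ?thesis by (simp add: image_UN piece_append)
qed

lemma piece_subset_E: "w \<in> words N n \<Longrightarrow> piece w \<subseteq> E"
  using E_words[of n] by auto

lemma piece_append_subset: "v \<in> words N m \<Longrightarrow> piece (w @ v) \<subseteq> piece w"
  using piece_words[of w m] by auto

definition diamE :: real where "diamE = diameter E"

lemma diamE_nonneg: "0 \<le> diamE"
  unfolding diamE_def using compact_E by (intro diameter_ge_0 compact_imp_bounded)

lemma dist_E: "x \<in> E \<Longrightarrow> y \<in> E \<Longrightarrow> dist x y \<le> diamE"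
  unfolding diamE_def using compact_E by (intro diameter_bounded_bound compact_imp_bounded)

lemma dist_piece: "w \<in> words N n \<Longrightarrow> x \<in> piece w \<Longrightarrow> y \<in> piece w \<Longrightarrow> dist x y \<le> diamE * r ^ n"
  using dist_E by (auto simp: piece_def dist_act_words mult.commute)

text \<open>The open set condition enters here. Images of U under different words of equal length
  are disjoint, and a ball of radius \<open>\<epsilon>\<close> around z inside U gives each image of
  z room proportional to \<open>r ^ n\<close>. The point z is taken from U and may lie off
  \<open>E\<close>.\<close>

lemma act_separated: "\<exists>z \<epsilon>. 0 < \<epsilon> \<and> (\<forall>n. \<forall>w\<in>words N n. \<forall>v\<in>words N n. w \<noteq> v \<longrightarrow> \<epsilon> * r ^ n \<le> dist (act S w z) (act S v z))"
proof -
  obtain U where U: "U \<noteq> {}" "open U" "disjoint_family_on (\<lambda>i. S i ` U) {..<N}" "\<And>i. i < N \<Longrightarrow> S i ` U \<subseteq> U"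
    using osc by (auto simp: open_set_condition_def)
  obtain z where z: "z \<in> U" using U(1) by auto
  obtain \<epsilon> where \<epsilon>: "\<epsilon> > 0" "ball z \<epsilon> \<subseteq> U" using U(2) z by (auto simp: open_contains_ball)
  have sub: "act S w x \<in> U" if "set w \<subseteq> {..<N}" "x \<in> U" for w x
    using that
  proof (induction w)
    case (Cons i w)
    then have "act S w x \<in> U" "i < N" by auto
    then show ?case using U(4)[of i] by auto
  qed simp
  have inj: "x = y" if "i < N" "S i x = S i y" for i x y
    using dist_sim[OF that(1), of x y] that r0 by simp
  have disj: "w = v" if "w \<in> words N n" "v \<in> words N n" "x \<in> U" "y \<in> U" "act S w x = act S v y" for n w v x y
    using that
  proof (induction n arbitrary: w v)
    case 0 then show ?case by simp
  next
    case (Suc n)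
    obtain i w' where w: "w = i # w'" "i < N" "w' \<in> words N n" using Suc.prems(1) by (rule words_Suc_cases)
    obtain j v' where v: "v = j # v'" "j < N" "v' \<in> words N n" using Suc.prems(2) by (rule words_Suc_cases)
    have eq: "S i (act S w' x) = S j (act S v' y)" using Suc.prems(5) w(1) v(1) by simp
    have inU: "act S w' x \<in> U" "act S v' y \<in> U" using sub w(3) v(3) Suc.prems by (auto simp: words_def)
    have ij: "i = j"
    proof (rule ccontr)
      assume "i \<noteq> j"
      then have "S i ` U \<inter> S j ` U = {}" using U(3) w(2) v(2) by (auto simp: disjoint_family_on_def)
      moreover have "S i (act S w' x) \<in> S i ` U" "S i (act S w' x) \<in> S j ` U"
        using inU(1) eq inU(2) by (simp_all only: eq[symmetric] imageI) (simp add: eq)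
      ultimately show False by blast
    qed
    have "act S w' x = act S v' y" using eq ij inj w(2) by simp
    then have "w' = v'" using Suc.IH w(3) v(3) Suc.prems by simp
    then show ?case using w(1) v(1) ij by simp
  qed
  have "\<epsilon> * r ^ n \<le> dist (act S w z) (act S v z)" if "w \<in> words N n" "v \<in> words N n" "w \<noteq> v" for n w v
  proof (rule ccontr)
    assume neg: "\<not> ?thesis"
    have "act S v z \<in> range (act S w)" using surj_act[of w] that(1) by (auto simp: words_def)
    then obtain u where u: "act S v z = act S w u" by auto
    have "r ^ n * dist z u < r ^ n * \<epsilon>"
      using neg u dist_act_words[OF that(1), of z u] by (simp add: mult.commute)
    then have "dist z u < \<epsilon>" by simp
    then have "u \<in> U" using \<epsilon>(2) by auto
    then show False using disj[OF that(1,2) _ z, of u] u that(3) by simp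
  qed
  then show ?thesis using \<epsilon>(1) by (intro exI[of _ z] exI[of _ \<epsilon>]) auto
qed

lemma card_pieces_near: "\<exists>M. \<forall>n x. card {w \<in> words N n. piece w \<inter> cball x (\<rho> * r ^ n) \<noteq> {}} \<le> M"
proof -
  obtain z \<epsilon> where \<epsilon>: "0 < \<epsilon>"
    and sep: "\<And>n w v. w \<in> words N n \<Longrightarrow> v \<in> words N n \<Longrightarrow> w \<noteq> v \<Longrightarrow> \<epsilon> * r ^ n \<le> dist (act S w z) (act S v z)"
    using act_separated by metis
  obtain e where e: "e \<in> E" using E_nonempty by auto
  \<comment> \<open>Pieces are represented by the images of z; \<open>diamE + dist e z\<close>
    bounds the distance from z to any point of \<open>E\<close>.\<close>
  define \<rho>' where "\<rho>' = \<rho> + (diamE + dist e z)"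
  obtain M where M: "\<forall>(I::nat list set) (p::nat list \<Rightarrow> 'a) x s. s > 0 \<longrightarrow>
    (\<forall>i\<in>I. dist x (p i) \<le> \<rho>' * s) \<longrightarrow> (\<forall>i\<in>I. \<forall>j\<in>I. i \<noteq> j \<longrightarrow> \<epsilon> * s \<le> dist (p i) (p j)) \<longrightarrow> card I \<le> M"
    using packing_bound[OF \<epsilon>, of \<rho>'] by (rule exE)
  have "card {w \<in> words N n. piece w \<inter> cball x (\<rho> * r ^ n) \<noteq> {}} \<le> M" (is "card ?I \<le> M") for n x
  proof (rule M[THEN spec, THEN spec, THEN spec, THEN spec, THEN mp, THEN mp, THEN mp, of "r ^ n" _ x "\<lambda>w. act S w z"])
    show "\<forall>w\<in>?I. dist x (act S w z) \<le> \<rho>' * r ^ n"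
    proof
      fix w assume "w \<in> ?I"
      then obtain y where w: "w \<in> words N n" and y: "y \<in> E" "dist x (act S w y) \<le> \<rho> * r ^ n"
        by (auto simp: piece_def)
      have "dist (act S w y) (act S w z) = r ^ n * dist y z" by (rule dist_act_words[OF w])
      also have "\<dots> \<le> r ^ n * (diamE + dist e z)"
        using dist_E[OF y(1) e] dist_triangle[of y z e] by (intro mult_left_mono) auto
      finally show "dist x (act S w z) \<le> \<rho>' * r ^ n"
        using y(2) dist_triangle[of x "act S w z" "act S w y"] by (simp add: \<rho>'_def algebra_simps)
    qed
  qed (use sep in auto)
  then show ?thesis by blast
qed

subsection \<open>Clusters\<close>

text \<open>The threshold shrinks at the same rate as the pieces, so the relation is unaffected by a
  common prefix.\<close>

definition near :: "nat \<Rightarrow> (nat list \<times> nat list) set" where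
  "near n = {(w, v). w \<in> words N n \<and> v \<in> words N n \<and> (\<exists>x\<in>piece w. \<exists>y\<in>piece v. dist x y \<le> r ^ n)}"

definition cluster :: "nat \<Rightarrow> nat list \<Rightarrow> nat list set" where
  "cluster n w = {v. (w, v) \<in> (near n)\<^sup>*}"

lemma cluster_refl: "w \<in> cluster n w"
  by (simp add: cluster_def)

lemma cluster_words: "w \<in> words N n \<Longrightarrow> cluster n w \<subseteq> words N n"
  by (auto simp: cluster_def near_def elim: rtranclE)

text \<open>All pieces are scaled copies of \<open>E\<close>, so the \<delta> found for
  \<open>E\<close> serves at every scale.\<close>

lemma uniformly_disconnected_pieces: "uniformly_disconnected (\<lambda>n. r ^ n) (\<lambda>n. piece ` words N n)"
  unfolding uniformly_disconnected_def
proof (intro allI impI)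
  fix \<eta> :: real assume "\<eta> > 0"
  then obtain \<delta> where \<delta>: "\<delta> > 0" "small_chains E \<delta> \<eta>"
    using totally_disconnected_small_chains[OF compact_E td] by auto
  have "small_chains (piece w) (\<delta> * r ^ n) (\<eta> * r ^ n)" if "w \<in> words N n" for n w
    using small_chains_similarity_image[OF \<delta>(2), of "r ^ n" "act S w"] dist_act_words[OF that]
    by (simp add: piece_def mult.commute)
  then show "\<exists>\<delta>>0. \<forall>n. \<forall>A\<in>piece ` words N n. small_chains A (\<delta> * r ^ n) (\<eta> * r ^ n)"
    using \<delta>(1) by (intro exI[of _ \<delta>]) auto
qed

text \<open>Seen from level n - k, a cluster of level n is a chain with tiny steps. Boundedly many
  pieces of level n - k come close to its start, and chains in their union move at most
  \<open>r ^ (n - k)\<close>. So the chain never leaves these pieces, and \<open>r ^ (n - k)\<close>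
  is a constant multiple of \<open>r ^ n\<close>.\<close>

lemma cluster_dist_bound:
  "\<exists>C. \<forall>n w v x y. w \<in> words N n \<longrightarrow> v \<in> cluster n w \<longrightarrow> x \<in> piece w \<longrightarrow> y \<in> piece v \<longrightarrow> dist x y \<le> C * r ^ n"
proof -
  \<comment> \<open>The factor 2 leaves room for one more step: a chain moves at most
    \<open>r ^ m\<close>, and a step adds at most \<open>r ^ m\<close>.\<close>
  obtain M where M: "\<And>n x. card {w \<in> words N n. piece w \<inter> cball x (2 * r ^ n) \<noteq> {}} \<le> M"
    using card_pieces_near[of 2] by auto
  obtain \<delta>' where \<delta>': "\<delta>' > 0" "\<And>n F. F \<subseteq> piece ` words N n \<Longrightarrow> card F \<le> M \<Longrightarrow> small_chains (\<Union>F) (\<delta>' * r ^ n) (1 * r ^ n)"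
  proof -
    have "uniformly_disconnected (\<lambda>n. r ^ n) (\<lambda>n. {\<Union>F |F. F \<subseteq> piece ` words N n \<and> finite F \<and> card F \<le> M})"
      using uniformly_disconnected_Union[OF uniformly_disconnected_pieces, of M] by simp
    from this[unfolded uniformly_disconnected_def, rule_format, OF zero_less_one]
    obtain \<delta> where \<delta>: "0 < \<delta> \<and> (\<forall>n. \<forall>A\<in>{\<Union>F |F. F \<subseteq> piece ` words N n \<and> finite F \<and> card F \<le> M}. small_chains A (\<delta> * r ^ n) (1 * r ^ n))"
      by (rule exE)
    show thesis
    proof (rule that)
      show "0 < \<delta>" using \<delta> by (rule conjunct1)
      fix n F assume F: "F \<subseteq> piece ` words N n" "card F \<le> M"
      have "finite F" using F(1) by (rule finite_subset) simp
      then show "small_chains (\<Union>F) (\<delta> * r ^ n) (1 * r ^ n)"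
        using F by (intro \<delta>[THEN conjunct2, rule_format]) auto
    qed
  qed
  define \<delta> where "\<delta> = min 1 \<delta>'"
  have \<delta>: "0 < \<delta>" "\<delta> \<le> 1" "\<delta> \<le> \<delta>'" using \<delta>'(1) by (auto simp: \<delta>_def)
  \<comment> \<open>With this k, a jump of length \<open>r ^ n\<close> followed by a move inside a
    piece of level n is at most the step \<open>\<delta> * r ^ m\<close> allowed at level m = n -
    k.\<close>
  obtain k where k: "r ^ k < \<delta> / (diamE + 1)"
    using real_arch_pow_inv[of "\<delta> / (diamE + 1)" r] \<delta>(1) r1 diamE_nonneg by auto
  then have k: "(diamE + 1) * r ^ k \<le> \<delta>" using diamE_nonneg by (simp add: field_simps)
  \<comment> \<open>For n < k the diameter of \<open>E\<close> is a sufficient bound; for larger n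
    the bound is \<open>r ^ (n - k)\<close>.\<close>
  define C where "C = max diamE 1 / r ^ k"
  have bound: "dist x y \<le> C * r ^ n"
    if w: "w \<in> words N n" and v: "v \<in> cluster n w" and x: "x \<in> piece w" and y: "y \<in> piece v" for n w v x y
  proof (cases "n < k")
    case True
    have "x \<in> E" "y \<in> E" using piece_subset_E w cluster_words[OF w] v x y by blast+
    then have "dist x y \<le> max diamE 1" using dist_E by fastforce
    also have "\<dots> \<le> max diamE 1 * (r ^ n / r ^ k)"
    proof -
      have "r ^ k \<le> r ^ n" using True r0 r1 by (intro power_decreasing) auto
      then have "1 \<le> r ^ n / r ^ k" by simp
      then have "max diamE 1 * 1 \<le> max diamE 1 * (r ^ n / r ^ k)" by (intro mult_left_mono) auto
      then show ?thesis by simp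
    qed
    finally show ?thesis by (simp add: C_def)
  next
    case False
    define m where "m = n - k"
    have n: "n = m + k" using False by (simp add: m_def)
    define Q where "Q = {u \<in> words N m. piece u \<inter> cball x (2 * r ^ m) \<noteq> {}}"
    define G where "G = \<Union>(piece ` Q)"
    have "card (piece ` Q) \<le> card Q" by (rule card_image_le) (simp add: Q_def)
    also have "\<dots> \<le> M" unfolding Q_def by (rule M)
    finally have "small_chains G (\<delta>' * r ^ m) (1 * r ^ m)"
      unfolding G_def by (intro \<delta>'(2)) (auto simp: Q_def)
    then have small: "small_chains G (\<delta> * r ^ m) (1 * r ^ m)"
      by (rule small_chains_mono) (use \<delta> in simp)
    have inG: "z \<in> G" if z: "z \<in> E" "dist x z \<le> 2 * r ^ m" for z
    proof -
      obtain u where u: "u \<in> words N m" "z \<in> piece u" using z(1) E_words[of m] by auto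
      then have "u \<in> Q" using z(2) by (auto simp: Q_def)
      then show ?thesis using u by (auto simp: G_def)
    qed
    have xE: "x \<in> E" using piece_subset_E[OF w] x by auto
    then have xG: "x \<in> G" using r0 by (intro inG) (auto simp: less_imp_le)
    have rn: "(diamE + 1) * r ^ n \<le> \<delta> * r ^ m"
      using mult_right_mono[OF k, of "r ^ m"] r0 by (simp add: n power_add algebra_simps less_imp_le)
    have Dn: "diamE * r ^ n \<le> \<delta> * r ^ m" using rn by (simp add: algebra_simps) (smt (verit) rpow_pos)
    have dm: "\<delta> * r ^ m \<le> r ^ m" using \<delta> by simp
    \<comment> \<open>The induction runs over words but reaches every point of the piece, since the
      next jump may start anywhere in it.\<close>
    have "v \<in> words N n \<and> (\<forall>y\<in>piece v. (x, y) \<in> (chain_steps G (\<delta> * r ^ m))\<^sup>*)"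
      using v unfolding cluster_def mem_Collect_eq
    proof (induction rule: rtrancl_induct)
      case base
      have "(x, y) \<in> (chain_steps G (\<delta> * r ^ m))\<^sup>*" if "y \<in> piece w" for y
      proof -
        have d: "dist x y \<le> \<delta> * r ^ m" using dist_piece[OF w x that] Dn by linarith
        then have "y \<in> G" using dm piece_subset_E[OF w] that by (intro inG) (auto intro: order_trans)
        then show ?thesis using d xG by (auto simp: chain_steps_def)
      qed
      then show ?case using w by blast
    next
      case (step v v')
      obtain a b where ab: "v \<in> words N n" "v' \<in> words N n" "a \<in> piece v" "b \<in> piece v'" "dist a b \<le> r ^ n"
        using step(2) by (auto simp: near_def)
      have xa: "(x, a) \<in> (chain_steps G (\<delta> * r ^ m))\<^sup>*" using step(3) ab by blast
      then have dxa: "dist x a \<le> r ^ m" using small_chainsD[OF small] by fastforce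
      have aG: "a \<in> G" using dxa piece_subset_E[OF ab(1)] ab(3) by (intro inG) (auto intro: order_trans)
      have "(x, y) \<in> (chain_steps G (\<delta> * r ^ m))\<^sup>*" if y: "y \<in> piece v'" for y
      proof -
        have "dist b y \<le> diamE * r ^ n" by (rule dist_piece[OF ab(2,4) y])
        then have ay: "dist a y \<le> \<delta> * r ^ m"
          using ab(5) dist_triangle[of a y b] rn by (simp add: algebra_simps)
        have "dist x y \<le> 2 * r ^ m" using dxa ay dm dist_triangle[of x y a] by linarith
        then have "y \<in> G" using piece_subset_E[OF ab(2)] y by (intro inG) auto
        then have "(a, y) \<in> chain_steps G (\<delta> * r ^ m)" using aG ay by (auto simp: chain_steps_def)
        then show ?thesis using xa by (rule rtrancl_into_rtrancl[rotated])
      qed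
      then show ?case using ab(2) by blast
    qed
    then have "dist x y \<le> 1 * r ^ m" using y small_chainsD[OF small] by blast
    also have "\<dots> = 1 / r ^ k * r ^ n" using r0 by (simp add: n power_add)
    also have "\<dots> \<le> C * r ^ n" unfolding C_def by (intro mult_right_mono divide_right_mono) (use r0 in auto)
    finally show ?thesis .
  qed
  then show ?thesis by blast
qed

text \<open>The diameter bound puts all pieces of a cluster within reach of one ball of radius
  \<open>C * r ^ n\<close>, and packing bounds their number.\<close>

lemma cluster_bounds:
  obtains M C where "\<And>n w. w \<in> words N n \<Longrightarrow> card (cluster n w) \<le> M"
    and "\<And>n w v x y. w \<in> words N n \<Longrightarrow> v \<in> cluster n w \<Longrightarrow> x \<in> piece w \<Longrightarrow> y \<in> piece v \<Longrightarrow> dist x y \<le> C * r ^ n"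
proof -
  obtain C where C: "\<And>n w v x y. w \<in> words N n \<Longrightarrow> v \<in> cluster n w \<Longrightarrow> x \<in> piece w \<Longrightarrow> y \<in> piece v \<Longrightarrow> dist x y \<le> C * r ^ n"
    using cluster_dist_bound by metis
  obtain M where M: "\<And>n x. card {w \<in> words N n. piece w \<inter> cball x (C * r ^ n) \<noteq> {}} \<le> M"
    using card_pieces_near[of C] by auto
  have "card (cluster n w) \<le> M" if w: "w \<in> words N n" for n w
  proof -
    obtain x where x: "x \<in> piece w" using piece_nonempty by auto
    have "cluster n w \<subseteq> {v \<in> words N n. piece v \<inter> cball x (C * r ^ n) \<noteq> {}}"
    proof
      fix v assume v: "v \<in> cluster n w"
      obtain y where y: "y \<in> piece v" using piece_nonempty by auto
      have "y \<in> piece v \<inter> cball x (C * r ^ n)" using C[OF w v x y] y by simp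
      then show "v \<in> {v \<in> words N n. piece v \<inter> cball x (C * r ^ n) \<noteq> {}}" using cluster_words[OF w] v by auto
    qed
    then have "card (cluster n w) \<le> card {v \<in> words N n. piece v \<inter> cball x (C * r ^ n) \<noteq> {}}"
      by (intro card_mono) auto
    then show ?thesis using M[of n x] by linarith
  qed
  then show thesis using C that by blast
qed

end

section \<open>Descendants of sets of words, and saturated sets\<close>

definition extend :: "nat \<Rightarrow> nat \<Rightarrow> nat list set \<Rightarrow> nat list set" where
  "extend N k U = (\<lambda>(w, v). w @ v) ` (U \<times> words N k)"

lemma extend_iff:
  "U \<subseteq> words N n \<Longrightarrow> w \<in> extend N k U \<longleftrightarrow> w \<in> words N (n + k) \<and> take n w \<in> U"
proof
  assume U: "U \<subseteq> words N n" and "w \<in> extend N k U"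
  then obtain u v where uv: "w = u @ v" "u \<in> U" "v \<in> words N k" by (auto simp: extend_def)
  then have "u \<in> words N n" using U by auto
  then show "w \<in> words N (n + k) \<and> take n w \<in> U" using uv append_in_words by (auto simp: length_words)
next
  assume U: "U \<subseteq> words N n" and w: "w \<in> words N (n + k) \<and> take n w \<in> U"
  then have "(take n w, drop n w) \<in> U \<times> words N k" using drop_in_words by auto
  then have "(\<lambda>(w, v). w @ v) (take n w, drop n w) \<in> extend N k U" unfolding extend_def by (rule imageI)
  then show "w \<in> extend N k U" by simp
qed

lemma extend_words: "U \<subseteq> words N n \<Longrightarrow> extend N k U \<subseteq> words N (n + k)"
  using extend_iff by auto

lemma extend_memI: "w \<in> U \<Longrightarrow> v \<in> words N k \<Longrightarrow> w @ v \<in> extend N k U"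
  by (auto simp: extend_def)

lemma extend_Un: "extend N k (U \<union> V) = extend N k U \<union> extend N k V"
  by (auto simp: extend_def)

lemma extend_Union: "extend N k (\<Union>\<U>) = (\<Union>U\<in>\<U>. extend N k U)"
  by (auto simp: extend_def)

lemma extend_disjoint:
  assumes "U \<subseteq> words N n" "V \<subseteq> words N n" "U \<inter> V = {}"
  shows "extend N k U \<inter> extend N k V = {}"
  using assms(3) by (auto simp: extend_iff[OF assms(1)] extend_iff[OF assms(2)])

lemma card_extend:
  assumes "U \<subseteq> words N n"
  shows "card (extend N k U) = card U * N ^ k"
proof -
  have "inj_on (\<lambda>(w, v). w @ v) (U \<times> words N k)"
  proof (rule inj_onI, clarify)
    fix w v w' v' assume "w \<in> U" "w' \<in> U" "w @ v = w' @ v'"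
    moreover from this have "length w = length w'" using assms length_words by (metis subsetD)
    ultimately show "w = w' \<and> v = v'" by simp
  qed
  then show ?thesis by (simp add: extend_def card_image card_cartesian_product card_words)
qed

context osc_system
begin

text \<open>Saturated sets, that is, the unions of clusters of level n, phrased through
  \<open>near\<close> so that Boolean operations are immediate.\<close>

definition sat :: "nat \<Rightarrow> nat list set \<Rightarrow> bool" where
  "sat n U \<longleftrightarrow> U \<subseteq> words N n \<and> (\<forall>w\<in>U. \<forall>v. (w, v) \<in> near n \<longrightarrow> v \<in> U)"

lemma satD: "sat n U \<Longrightarrow> w \<in> U \<Longrightarrow> (w, v) \<in> near n \<Longrightarrow> v \<in> U"
  by (auto simp: sat_def)

lemma sat_words: "sat n U \<Longrightarrow> U \<subseteq> words N n"
  by (simp add: sat_def)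

lemma sat_finite: "sat n U \<Longrightarrow> finite U"
  using sat_words finite_subset finite_words by metis

lemma near_sym: "(w, v) \<in> near n \<Longrightarrow> (v, w) \<in> near n"
  by (fastforce simp: near_def dist_commute)

lemma near_words: "(w, v) \<in> near n \<Longrightarrow> w \<in> words N n \<and> v \<in> words N n"
  by (auto simp: near_def)

lemma sat_empty: "sat n {}" by (simp add: sat_def)

lemma sat_Un: "sat n U \<Longrightarrow> sat n V \<Longrightarrow> sat n (U \<union> V)"
  by (auto simp: sat_def)

lemma sat_Diff: "sat n U \<Longrightarrow> sat n V \<Longrightarrow> sat n (U - V)"
  using near_sym by (auto simp: sat_def)

lemma sat_Int: "sat n U \<Longrightarrow> sat n V \<Longrightarrow> sat n (U \<inter> V)"
  by (auto simp: sat_def)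

lemma sat_UN:
  assumes "\<And>i. i \<in> I \<Longrightarrow> sat n (U i)"
  shows "sat n (\<Union>i\<in>I. U i)"
  unfolding sat_def
proof (intro conjI ballI allI impI UN_least)
  fix i assume "i \<in> I" then show "U i \<subseteq> words N n" by (intro sat_words assms)
next
  fix w v assume "w \<in> (\<Union>i\<in>I. U i)" and wv: "(w, v) \<in> near n"
  then obtain i where i: "i \<in> I" "w \<in> U i" by (elim UN_E)
  show "v \<in> (\<Union>i\<in>I. U i)" using i(1) satD[OF assms[OF i(1)] i(2) wv] by (rule UN_I)
qed

lemma cluster_subset: "sat n U \<Longrightarrow> w \<in> U \<Longrightarrow> cluster n w \<subseteq> U"
proof
  fix v assume U: "sat n U" "w \<in> U" and "v \<in> cluster n w"
  then have "(w, v) \<in> (near n)\<^sup>*" by (simp add: cluster_def)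
  then show "v \<in> U" by (induction rule: rtrancl_induct) (use U satD in auto)
qed

lemma sat_cluster: "w \<in> words N n \<Longrightarrow> sat n (cluster n w)"
  using cluster_words by (auto simp: sat_def cluster_def intro: rtrancl_into_rtrancl)

lemma cluster_sym: "v \<in> cluster n w \<Longrightarrow> w \<in> cluster n v"
proof -
  have "sym (near n)" using near_sym by (auto intro: symI)
  then have "sym ((near n)\<^sup>*)" by (rule sym_rtrancl)
  then show "v \<in> cluster n w \<Longrightarrow> w \<in> cluster n v" by (auto simp: cluster_def dest: symD)
qed

lemma cluster_eq: "v \<in> cluster n w \<Longrightarrow> cluster n v = cluster n w"
proof -
  have "v \<in> cluster n w \<Longrightarrow> cluster n v \<subseteq> cluster n w" for v w
    by (auto simp: cluster_def intro: rtrancl_trans)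
  then show "v \<in> cluster n w \<Longrightarrow> cluster n v = cluster n w" using cluster_sym by (simp add: subset_antisym)
qed

lemma cluster_disjoint: "cluster n v \<noteq> cluster n w \<Longrightarrow> cluster n v \<inter> cluster n w = {}"
  using cluster_eq by (metis disjoint_iff)

lemma sat_separated:
  assumes "sat n U" "sat n V" "U \<inter> V = {}" "w \<in> U" "v \<in> V" "x \<in> piece w" "y \<in> piece v"
  shows "r ^ n < dist x y"
proof (rule ccontr)
  assume "\<not> ?thesis"
  then have "(w, v) \<in> near n" using assms sat_words by (auto simp: near_def not_less)
  then show False using satD[OF assms(1,4)] assms(3,5) by auto
qed

text \<open>Passing to prefixes enlarges the pieces and raises the threshold. Therefore the
  descendants of a saturated set are saturated.\<close>

lemma near_take:
  assumes "(w, v) \<in> near (n + k)"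
  shows "(take n w, take n v) \<in> near n"
proof -
  have wv: "w \<in> words N (n + k)" "v \<in> words N (n + k)" using near_words[OF assms] by auto
  obtain x y where xy: "x \<in> piece w" "y \<in> piece v" "dist x y \<le> r ^ (n + k)" using assms by (auto simp: near_def)
  have "piece w \<subseteq> piece (take n w)" "piece v \<subseteq> piece (take n v)"
    using piece_append_subset[OF drop_in_words[OF wv(1)], of "take n w"]
      piece_append_subset[OF drop_in_words[OF wv(2)], of "take n v"] by simp_all
  moreover have "r ^ (n + k) \<le> r ^ n" using r0 r1 by (intro power_decreasing) auto
  ultimately show ?thesis using xy take_in_words wv by (auto simp: near_def intro: order_trans)
qed

text \<open>\<open>act S u\<close> multiplies distances and the threshold by the same factor.
  Clusters may nevertheless grow under a prefix, since a chain can pass through words that do not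
  begin with u.\<close>

lemma near_prefix:
  assumes "u \<in> words N m" "w \<in> words N n" "v \<in> words N n"
  shows "(u @ w, u @ v) \<in> near (m + n) \<longleftrightarrow> (w, v) \<in> near n"
proof -
  have "(\<exists>x\<in>piece (u @ w). \<exists>y\<in>piece (u @ v). dist x y \<le> r ^ (m + n)) \<longleftrightarrow>
      (\<exists>x\<in>piece w. \<exists>y\<in>piece v. r ^ m * dist x y \<le> r ^ m * r ^ n)"
    by (simp add: piece_append dist_act_words[OF assms(1)] power_add)
  then show ?thesis using assms append_in_words by (simp add: near_def)
qed

lemma sat_extend:
  assumes "sat n U"
  shows "sat (n + k) (extend N k U)"
  unfolding sat_def
proof (intro conjI ballI allI impI)
  show "extend N k U \<subseteq> words N (n + k)" using sat_words[OF assms] by (rule extend_words)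
  fix w v assume w: "w \<in> extend N k U" and wv: "(w, v) \<in> near (n + k)"
  have "take n w \<in> U" using w extend_iff[OF sat_words[OF assms]] by simp
  then have "take n v \<in> U" using satD[OF assms] near_take[OF wv] by simp
  then show "v \<in> extend N k U" using near_words[OF wv] extend_iff[OF sat_words[OF assms]] by simp
qed

definition Piece :: "nat list set \<Rightarrow> 'a set" where
  "Piece U = (\<Union>w\<in>U. piece w)"

lemma Piece_extend: "Piece (extend N k U) = Piece U"
proof -
  have "Piece (extend N k U) = (\<Union>w\<in>U. \<Union>v\<in>words N k. piece (w @ v))" by (auto simp: Piece_def extend_def)
  also have "\<dots> = Piece U" unfolding Piece_def by (rule SUP_cong[OF refl]) (rule piece_words[symmetric])
  finally show ?thesis .
qed

end

subsection \<open>Copies of a cluster of maximal size\<close>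

text \<open>The condition \<open>1 \<le> n0\<close> makes the empty word bad, so that the matching
  can start from the bad pair of \<open>E\<close> and the whole sequence space.\<close>

locale osc_maximal = osc_system +
  fixes n0 :: nat and w0 :: "nat list" and C :: real
  assumes n0: "1 \<le> n0" and w0: "w0 \<in> words N n0"
    and maximal: "\<And>n w. w \<in> words N n \<Longrightarrow> card (cluster n w) \<le> card (cluster n0 w0)"
    and cluster_diam: "\<And>n w v x y. w \<in> words N n \<Longrightarrow> v \<in> cluster n w \<Longrightarrow> x \<in> piece w \<Longrightarrow> y \<in> piece v \<Longrightarrow> dist x y \<le> C * r ^ n"
begin

definition C0 :: "nat list set" where "C0 = cluster n0 w0"
definition M :: nat where "M = card C0"

lemma C0_words: "C0 \<subseteq> words N n0"
  unfolding C0_def using w0 by (rule cluster_words)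

lemma card_cluster_le: "w \<in> words N n \<Longrightarrow> card (cluster n w) \<le> M"
  unfolding M_def C0_def by (rule maximal)

lemma w0_C0: "w0 \<in> C0"
  by (simp add: C0_def cluster_refl)

lemma M_pos: "1 \<le> M"
proof -
  have "finite C0" using C0_words finite_words by (rule finite_subset)
  then show ?thesis using w0_C0 by (simp add: M_def Suc_le_eq card_gt_0_iff) auto
qed

text \<open>By maximality the copy of \<open>C0\<close> cannot be joined to anything else at its level.\<close>

lemma prefix_C0_cluster:
  assumes u: "u \<in> words N m"
  shows "(@) u ` C0 = cluster (m + n0) (u @ w0)"
proof (rule card_subset_eq)
  have uw: "u @ w0 \<in> words N (m + n0)" using u w0 by (rule append_in_words)
  show "finite (cluster (m + n0) (u @ w0))" using cluster_words[OF uw] by (rule finite_subset) simp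
  show sub: "(@) u ` C0 \<subseteq> cluster (m + n0) (u @ w0)"
  proof (rule image_subsetI)
    fix v assume "v \<in> C0"
    then have "(w0, v) \<in> (near n0)\<^sup>*" by (simp add: C0_def cluster_def)
    then have "(u @ w0, u @ v) \<in> (near (m + n0))\<^sup>*"
    proof (induction rule: rtrancl_induct)
      case (step y z)
      then have "(u @ y, u @ z) \<in> near (m + n0)" using near_prefix[OF u] near_words[OF step(2)] by simp
      then show ?case using step(3) by (rule rtrancl_into_rtrancl[rotated])
    qed simp
    then show "u @ v \<in> cluster (m + n0) (u @ w0)" by (simp add: cluster_def)
  qed
  have "card (cluster (m + n0) (u @ w0)) \<le> card C0" using maximal[OF uw] by (simp add: C0_def)
  moreover have "card ((@) u ` C0) = card C0" by (rule card_image) (simp add: inj_on_def)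
  moreover have "card ((@) u ` C0) \<le> card (cluster (m + n0) (u @ w0))"
    using sub by (rule card_mono[rotated]) (use cluster_words[OF uw] in \<open>auto intro: finite_subset\<close>)
  ultimately show "card ((@) u ` C0) = card (cluster (m + n0) (u @ w0))" by simp
qed

lemma sat_prefix_C0: "u \<in> words N m \<Longrightarrow> sat (m + n0) ((@) u ` C0)"
  using prefix_C0_cluster append_in_words[OF _ w0] sat_cluster by simp

text \<open>A word of \<open>C0\<close> may occur at any position, which makes goodness stable under
  both prefixes and suffixes.\<close>

definition good :: "nat \<Rightarrow> nat list set" where
  "good n = {w \<in> words N n. \<exists>u c v. w = u @ c @ v \<and> c \<in> C0}"

text \<open>The copy of \<open>C0\<close> behind u is a whole cluster, so its descendants form a
  saturated set. A neighbour stays in this set and thereby keeps the prefix u.\<close>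

lemma good_near:
  assumes "u @ c @ v \<in> words N n" "c \<in> C0" "(u @ c @ v, x) \<in> near n"
  shows "\<exists>c'\<in>C0. \<exists>v'. x = u @ c' @ v'"
proof -
  define m k where "m = length u" and "k = length v"
  have lc: "length c = n0" using assms(2) C0_words length_words by auto
  have n: "n = (m + n0) + k" using assms(1) lc by (simp add: m_def k_def words_def)
  have uv: "u \<in> words N m" "v \<in> words N k" using assms(1) by (auto simp: m_def k_def words_def)
  have sat: "sat n (extend N k ((@) u ` C0))" unfolding n using sat_prefix_C0[OF uv(1)] by (rule sat_extend)
  have "(u @ c) @ v \<in> extend N k ((@) u ` C0)" using assms(2) uv by (intro extend_memI) auto
  then have "x \<in> extend N k ((@) u ` C0)" using satD[OF sat] assms(3) by simp
  then obtain c' v' where "c' \<in> C0" "x = (u @ c') @ v'" by (auto simp: extend_def)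
  then show ?thesis by auto
qed

lemma good_sat: "sat n (good n)"
  unfolding sat_def
proof (intro conjI ballI allI impI)
  show "good n \<subseteq> words N n" by (auto simp: good_def)
  fix w v assume w: "w \<in> good n" and wv: "(w, v) \<in> near n"
  obtain a c b where w': "w = a @ c @ b" "c \<in> C0" using w by (auto simp: good_def)
  have "w \<in> words N n" using w by (simp add: good_def)
  then obtain c' v' where "c' \<in> C0" "v = a @ c' @ v'" using good_near[of a c b n v] w' wv by auto
  then show "v \<in> good n" using near_words[OF wv] by (auto simp: good_def)
qed

lemma good_append: "w \<in> good n \<Longrightarrow> v \<in> words N k \<Longrightarrow> w @ v \<in> good (n + k)"
  using append_in_words by (fastforce simp: good_def)

lemma good_prepend: "u \<in> words N m \<Longrightarrow> w \<in> good n \<Longrightarrow> u @ w \<in> good (m + n)"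
proof -
  assume u: "u \<in> words N m" and w: "w \<in> good n"
  obtain a c b where w': "w = a @ c @ b" "c \<in> C0" "w \<in> words N n" using w by (auto simp: good_def)
  have "u @ w = (u @ a) @ c @ b" using w' by simp
  then show ?thesis using append_in_words[OF u w'(3)] w'(2) unfolding good_def by blast
qed

definition gsat :: "nat \<Rightarrow> nat list set \<Rightarrow> bool" where
  "gsat n U \<longleftrightarrow> sat n U \<and> U \<subseteq> good n"

lemma gsat_sat: "gsat n U \<Longrightarrow> sat n U" by (simp add: gsat_def)

lemma gsat_finite: "gsat n U \<Longrightarrow> finite U" using gsat_sat sat_finite by metis

lemma gsat_words: "gsat n U \<Longrightarrow> U \<subseteq> words N n" using gsat_sat sat_words by metis

lemma gsat_empty: "gsat n {}" by (simp add: gsat_def sat_empty)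

lemma gsat_Un: "gsat n U \<Longrightarrow> gsat n V \<Longrightarrow> gsat n (U \<union> V)"
  by (auto simp: gsat_def intro: sat_Un)

lemma gsat_Diff: "gsat n U \<Longrightarrow> gsat n V \<Longrightarrow> gsat n (U - V)"
  by (auto simp: gsat_def intro: sat_Diff)

lemma gsat_UN: "(\<And>i. i \<in> I \<Longrightarrow> gsat n (U i)) \<Longrightarrow> gsat n (\<Union>i\<in>I. U i)"
  unfolding gsat_def by (auto intro!: sat_UN)

lemma gsat_cluster: "w \<in> good n \<Longrightarrow> gsat n (cluster n w)"
  using cluster_subset[OF good_sat] sat_cluster by (auto simp: gsat_def good_def)

lemma gsat_extend: "gsat n U \<Longrightarrow> gsat (n + k) (extend N k U)"
  unfolding gsat_def using sat_extend good_append by (auto simp: extend_def)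

text \<open>Goodness is what keeps the copy saturated: a neighbour of \<open>u @ w\<close> retains
  everything before the factor from \<open>C0\<close>, in particular u, and u can then be cancelled
  by \<open>near_prefix\<close>.\<close>

lemma gsat_prefix:
  assumes u: "u \<in> words N m" and U: "gsat n U"
  shows "gsat (m + n) ((@) u ` U)"
  unfolding gsat_def sat_def
proof (intro conjI ballI allI impI)
  show "(@) u ` U \<subseteq> words N (m + n)" using append_in_words[OF u] gsat_words[OF U] by auto
  show "(@) u ` U \<subseteq> good (m + n)" using good_prepend[OF u] U by (auto simp: gsat_def)
  fix x y assume x: "x \<in> (@) u ` U" and xy: "(x, y) \<in> near (m + n)"
  obtain w where w: "w \<in> U" "x = u @ w" using x by auto
  then have "w \<in> good n" using U by (auto simp: gsat_def)
  then obtain a c b where w': "w = a @ c @ b" "c \<in> C0" "w \<in> words N n" by (auto simp: good_def)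
  have "((u @ a) @ c @ b, y) \<in> near (m + n)" "(u @ a) @ c @ b \<in> words N (m + n)"
    using xy w w' near_words[OF xy] by auto
  then obtain c' v' where "y = (u @ a) @ c' @ v'" using good_near[of "u @ a" c b "m + n" y] w'(2) by auto
  then obtain y' where y': "y = u @ y'" by auto
  then have "y' \<in> words N n" using near_words[OF xy] append_words_iff[of u m y' N n] length_words[OF u] by simp
  then have "(w, y') \<in> near n" using near_prefix[OF u] xy y' w w'(3) by simp
  then show "y \<in> (@) u ` U" using satD[OF gsat_sat[OF U] w(1)] y' by simp
qed

lemma gsat_C0: "gsat n0 C0"
  unfolding gsat_def
proof
  show "sat n0 C0" unfolding C0_def using w0 by (rule sat_cluster)
  have "c \<in> good n0" if "c \<in> C0" for c
  proof -
    have "c \<in> words N n0" using that C0_words by auto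
    moreover have "c = [] @ c @ []" by simp
    ultimately show ?thesis using that unfolding good_def by blast
  qed
  then show "C0 \<subseteq> good n0" by blast
qed

section \<open>The group of differences of cardinalities\<close>

definition diffs :: "int set" where
  "diffs = {int (card U) - int (card V) |n U V. gsat n U \<and> gsat n V}"

lemma diffsI: "gsat n U \<Longrightarrow> gsat n V \<Longrightarrow> int (card U) - int (card V) \<in> diffs"
  unfolding diffs_def by blast

lemma diffsE:
  assumes "d \<in> diffs"
  obtains n U V where "gsat n U" "gsat n V" "d = int (card U) - int (card V)"
  using assms unfolding diffs_def by blast

lemma diffs_uminus: "d \<in> diffs \<Longrightarrow> - d \<in> diffs"
proof (erule diffsE)
  fix n U V assume "gsat n U" "gsat n V" "d = int (card U) - int (card V)"
  then show "- d \<in> diffs" using diffsI[of n V U] by simp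
qed

text \<open>Pairs from two levels m and n are placed side by side. A prefix of length m + 1
  beginning with 0 and one of length n + 1 beginning with 1 bring both to level m + n + 1 and keep
  them disjoint.\<close>

lemma diffs_add:
  assumes "d \<in> diffs" "e \<in> diffs"
  shows "d + e \<in> diffs"
proof -
  obtain n U V where d: "gsat n U" "gsat n V" "d = int (card U) - int (card V)" using assms(1) by (rule diffsE)
  obtain m X Y where e: "gsat m X" "gsat m Y" "e = int (card X) - int (card Y)" using assms(2) by (rule diffsE)
  define u v where "u = replicate (Suc m) (0::nat)" and "v = (1::nat) # replicate n 0"
  have u: "u \<in> words N (Suc m)" and v: "v \<in> words N (Suc n)" using N2 by (auto simp: u_def v_def words_def)
  have lev: "Suc m + n = Suc n + m" by simp
  have g: "gsat (Suc m + n) ((@) u ` A \<union> (@) v ` B)" if "gsat n A" "gsat m B" for A B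
    using gsat_prefix[OF u that(1)] gsat_prefix[OF v that(2)] unfolding lev by (rule gsat_Un)
  have c: "card ((@) u ` A \<union> (@) v ` B) = card A + card B" if "gsat n A" "gsat m B" for A B
  proof -
    have "(@) u ` A \<inter> (@) v ` B = {}" by (auto simp: u_def v_def)
    then show ?thesis using gsat_finite[OF that(1)] gsat_finite[OF that(2)]
      by (simp add: card_Un_disjoint card_image inj_on_def)
  qed
  have "d + e = int (card ((@) u ` U \<union> (@) v ` X)) - int (card ((@) u ` V \<union> (@) v ` Y))"
    unfolding c[OF d(1) e(1)] c[OF d(2) e(2)] d(3) e(3) by simp
  then show ?thesis using diffsI[OF g[OF d(1) e(1)] g[OF d(2) e(2)]] by simp
qed

text \<open>The positive generator of the subgroup \<open>diffs\<close>. It divides all sizes of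
  good saturated sets, and the two sets that realise it as a difference are the ones exchanged in
  \<open>split_cluster\<close>.\<close>

definition g :: nat where
  "g = (LEAST k. 0 < k \<and> int k \<in> diffs)"

lemma g_pos: "0 < g" and g_diffs: "int g \<in> diffs"
proof -
  have "0 < M \<and> int M \<in> diffs" using M_pos diffsI[OF gsat_C0 gsat_empty] by (simp add: M_def)
  then have "0 < g \<and> int g \<in> diffs" unfolding g_def by (rule LeastI)
  then show "0 < g" "int g \<in> diffs" by auto
qed

text \<open>The remainder of d modulo \<open>g\<close> is again a difference, and a positive one
  would contradict minimality.\<close>

lemma g_dvd_diffs:
  assumes "d \<in> diffs"
  shows "int g dvd d"
proof -
  have mult: "int k * int g \<in> diffs" for k
  proof (induction k)
    case 0 then show ?case using diffsI[OF gsat_empty gsat_empty] by simp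
  next
    case (Suc k) then show ?case using diffs_add[OF Suc g_diffs] by (simp add: algebra_simps)
  qed
  have "z * int g \<in> diffs" for z
    using mult[of "nat z"] diffs_uminus[OF mult[of "nat (- z)"]] by (cases "0 \<le> z") auto
  then have "d + (- (d div int g)) * int g \<in> diffs" using assms by (intro diffs_add)
  then have "d mod int g \<in> diffs" by (simp add: minus_div_mult_eq_mod[symmetric])
  moreover have "0 \<le> d mod int g" "d mod int g < int g" using g_pos by auto
  ultimately have "int (nat (d mod int g)) \<in> diffs" "nat (d mod int g) < g" by auto
  then have "nat (d mod int g) = 0" using not_less_Least[of "nat (d mod int g)" "\<lambda>k. 0 < k \<and> int k \<in> diffs"] g_def by auto
  then have "d mod int g = 0" using \<open>0 \<le> d mod int g\<close> by linarith
  then show ?thesis by (simp add: dvd_eq_mod_eq_0)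
qed

lemma g_dvd_card: "gsat n U \<Longrightarrow> g dvd card U"
  using g_dvd_diffs[OF diffsI[OF _ gsat_empty], of n U] by simp

subsection \<open>Dividing clusters into groups\<close>

text \<open>Take X as large as possible. If room for \<open>M\<close> words were left, one more
  cluster of \<open>Z\<close> would fit, as clusters have at most \<open>M\<close> words.\<close>

lemma gsat_greedy:
  assumes Z: "gsat n Z" and t: "t \<le> card Z"
  shows "\<exists>X\<subseteq>Z. gsat n X \<and> card X \<le> t \<and> t < card X + M"
proof -
  define k where "k = Max (card ` {X. X \<subseteq> Z \<and> gsat n X \<and> card X \<le> t})"
  have fin: "finite (card ` {X. X \<subseteq> Z \<and> gsat n X \<and> card X \<le> t})"
    by (rule finite_imageI, rule finite_subset[of _ "Pow Z"]) (use gsat_finite[OF Z] in auto)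
  have "card ({} :: nat list set) \<in> card ` {X. X \<subseteq> Z \<and> gsat n X \<and> card X \<le> t}"
    by (rule imageI) (simp add: gsat_empty)
  then have "k \<in> card ` {X. X \<subseteq> Z \<and> gsat n X \<and> card X \<le> t}"
    unfolding k_def using fin by (intro Max_in) auto
  then obtain X where X: "X \<subseteq> Z" "gsat n X" "card X \<le> t" "k = card X" by auto
  have "t < card X + M"
  proof (rule ccontr)
    assume neg: "\<not> ?thesis"
    then have "card X < card Z" using t M_pos by linarith
    then have "X \<noteq> Z" by auto
    then obtain w where w: "w \<in> Z" "w \<notin> X" using X(1) by auto
    have wg: "w \<in> good n" using w Z by (auto simp: gsat_def)
    define c where "c = cluster n w"
    have c: "gsat n c" "c \<subseteq> Z" "w \<in> c" "card c \<le> M"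
      using gsat_cluster[OF wg] cluster_subset[OF gsat_sat[OF Z] w(1)] cluster_refl card_cluster_le wg
      by (auto simp: c_def good_def)
    have "card (X \<union> c) \<le> card X + card c" by (rule card_Un_le)
    then have "card (X \<union> c) \<le> t" using neg c(4) by linarith
    then have "card (X \<union> c) \<in> card ` {X. X \<subseteq> Z \<and> gsat n X \<and> card X \<le> t}"
      using c X gsat_Un by (intro imageI) auto
    then have "card (X \<union> c) \<le> k" unfolding k_def using fin by (intro Max_ge)
    moreover have "card (insert w X) \<le> card (X \<union> c)"
      using c(3) gsat_finite[OF c(1)] gsat_finite[OF X(2)] by (intro card_mono) auto
    ultimately show False using w(2) gsat_finite[OF X(2)] X(4) by simp
  qed
  then show ?thesis using X by blast
qed

text \<open>The free part \<open>F\<close> fills a block up to a small gap, which is a multiple of \<open>g\<close>; exchanging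
  sets \<open>B j\<close> for sets \<open>A j\<close> closes the gap exactly.\<close>

lemma partition_by_exchange:
  fixes A B :: "nat list \<Rightarrow> nat list set"
  assumes gT: "g dvd T" and gc: "g dvd c"
  shows "finite J \<Longrightarrow> gsat m F \<Longrightarrow>
    (\<And>j. j \<in> J \<Longrightarrow> gsat m (A j) \<and> card (A j) = c + g \<and> gsat m (B j) \<and> card (B j) = c \<and>
        A j \<inter> B j = {} \<and> F \<inter> (A j \<union> B j) = {}) \<Longrightarrow>
    disjoint_family_on (\<lambda>j. A j \<union> B j) J \<Longrightarrow>
    i * M \<le> card J \<Longrightarrow> card J * (2 * c + g) \<le> T \<Longrightarrow>
    V = F \<union> (\<Union>j\<in>J. A j \<union> B j) \<Longrightarrow> card V = Suc i * T \<Longrightarrow>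
    \<exists>P. \<Union>P = V \<and> disjoint P \<and> (\<forall>X\<in>P. gsat m X \<and> card X = T)"
proof (induction i arbitrary: J F V)
  case 0
  have "gsat m V" unfolding 0(7) using 0(2,3) by (intro gsat_Un gsat_UN) auto
  then show ?case using 0(8) by (intro exI[of _ "{V}"]) auto
next
  case (Suc i)
  note finJ = Suc.prems(1) and F = Suc.prems(2) and tok = Suc.prems(3) and dis = Suc.prems(4)
  have MJ: "M \<le> card J" using Suc.prems(5) by simp
  then obtain J' where J': "J' \<subseteq> J" "card J' = M" by (metis obtain_subset_with_card_n)
  have finJ': "finite J'" using J'(1) finJ by (rule finite_subset)
  have dj: "(A j \<union> B j) \<inter> (A l \<union> B l) = {}" if "j \<in> J" "l \<in> J" "j \<noteq> l" for j l
    using dis that unfolding disjoint_family_on_def by simp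
  have cUN: "card (\<Union>j\<in>K. f j) = card K * k"
    if "K \<subseteq> J" and f: "\<And>j. j \<in> J \<Longrightarrow> f j \<subseteq> A j \<union> B j" "\<And>j. j \<in> J \<Longrightarrow> card (f j) = k" for K f k
  proof -
    have "finite (f j)" if "j \<in> J" for j
      using f(1)[OF that] tok[OF that] gsat_finite by (meson finite_UnI finite_subset)
    moreover have "f j \<inter> f l = {}" if "j \<in> J" "l \<in> J" "j \<noteq> l" for j l
      using f(1)[OF that(1)] f(1)[OF that(2)] dj[OF that] by auto
    moreover have "finite K" using \<open>K \<subseteq> J\<close> finJ by (rule finite_subset)
    ultimately have "card (\<Union>j\<in>K. f j) = (\<Sum>j\<in>K. card (f j))"
      using \<open>K \<subseteq> J\<close> by (intro card_UN_disjoint) (simp_all add: subset_eq)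
    also have "\<dots> = (\<Sum>j\<in>K. k)"
      by (rule sum.cong[OF refl]) (use \<open>K \<subseteq> J\<close> f(2) in auto)
    finally show ?thesis by simp
  qed
  have cAB: "card (A j \<union> B j) = 2 * c + g" if "j \<in> J" for j
    using tok[OF that] by (subst card_Un_disjoint) (auto intro: gsat_finite)
  have cU: "card (\<Union>j\<in>K. A j \<union> B j) = card K * (2 * c + g)" if "K \<subseteq> J" for K
    using that cAB by (intro cUN) simp_all
  have cA: "card (\<Union>j\<in>K. A j) = card K * (c + g)" if "K \<subseteq> J" for K
    using that tok by (intro cUN) simp_all
  have cB: "card (\<Union>j\<in>K. B j) = card K * c" if "K \<subseteq> J" for K
    using that tok by (intro cUN) simp_all
  have finA: "finite (\<Union>j\<in>K. A j)" "finite (\<Union>j\<in>K. B j)" if "K \<subseteq> J" for K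
  proof -
    have "finite K" using that finJ by (rule finite_subset)
    moreover have "finite (A j)" "finite (B j)" if "j \<in> J" for j
      using tok[OF that] by (auto intro: gsat_finite)
    ultimately show "finite (\<Union>j\<in>K. A j)" "finite (\<Union>j\<in>K. B j)"
      using that by (simp_all add: subset_eq)
  qed
  have ABdis: "(\<Union>j\<in>K. A j) \<inter> (\<Union>j\<in>L. B j) = {}" if "K \<subseteq> J" "L \<subseteq> J" for K L
  proof -
    have "A j \<inter> B l = {}" if "j \<in> K" "l \<in> L" for j l
    proof (cases "j = l")
      case True then show ?thesis using tok[of j] that \<open>K \<subseteq> J\<close> by auto
    next
      case False
      have "j \<in> J" "l \<in> J" using that \<open>K \<subseteq> J\<close> \<open>L \<subseteq> J\<close> by auto
      then have "(A j \<union> B j) \<inter> (A l \<union> B l) = {}" using dis False unfolding disjoint_family_on_def by simp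
      then show ?thesis by auto
    qed
    then show ?thesis by auto
  qed
  have Fdis: "F \<inter> (\<Union>j\<in>J. A j \<union> B j) = {}" using tok by auto
  have cV: "card V = card F + card J * (2 * c + g)"
    unfolding Suc.prems(7) using Fdis gsat_finite[OF F] finA[of J] cU[of J]
    by (subst card_Un_disjoint) (auto simp: UN_Un_distrib)
  \<comment> \<open>At least two blocks remain while all exchange pairs together hold at most
    \<open>T\<close> words, so the free part alone could fill a block.\<close>
  have cF: "T \<le> card F" using cV Suc.prems(6,8) by simp
  have Mc: "M * c \<le> T"
  proof -
    have "M * c \<le> card J * (2 * c + g)" using MJ by (intro mult_le_mono) auto
    then show ?thesis using Suc.prems(6) by linarith
  qed
  \<comment> \<open>\<open>M\<close> pairs are reserved for this block. Each contributes at least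
    \<open>c\<close> words, and the free part supplies the rest up to a gap.\<close>
  define t where "t = T - M * c"
  have "t \<le> card F" using cF by (simp add: t_def)
  from gsat_greedy[OF F this] obtain X where X: "X \<subseteq> F" "gsat m X" "card X \<le> t" "t < card X + M" by blast
  have "g dvd t - card X"
    using gT gc g_dvd_card[OF X(2)] by (simp add: t_def dvd_diff_nat)
  \<comment> \<open>The gap is less than \<open>M\<close>, so a is at most \<open>M\<close> and the
    reserved pairs suffice: a of them contribute \<open>c + g\<close> words, the others
    \<open>c\<close>.\<close>
  then obtain a where a: "t - card X = g * a" by (rule dvdE)
  have "g * a < M" using a X(3,4) by linarith
  moreover have "a \<le> g * a" using g_pos by simp
  ultimately have aM: "a \<le> M" by linarith
  then obtain K where K: "K \<subseteq> J'" "card K = a" using J'(2) by (metis obtain_subset_with_card_n)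
  define L where "L = J' - K"
  have KJ: "K \<subseteq> J" and LJ: "L \<subseteq> J" using K(1) J'(1) by (auto simp: L_def)
  have cL: "card L = M - a" unfolding L_def using K J'(2) finJ' by (simp add: card_Diff_subset finite_subset)
  define G where "G = X \<union> ((\<Union>j\<in>K. A j) \<union> (\<Union>j\<in>L. B j))"
  define F' where "F' = (F - X) \<union> ((\<Union>j\<in>L. A j) \<union> (\<Union>j\<in>K. B j))"
  define V' where "V' = F' \<union> (\<Union>j\<in>J - J'. A j \<union> B j)"
  have gA: "gsat m (\<Union>j\<in>K. A j)" "gsat m (\<Union>j\<in>K. B j)" if "K \<subseteq> J" for K
    using that tok by (auto intro!: gsat_UN)
  have gG: "gsat m G" unfolding G_def using X(2) gA[OF KJ] gA[OF LJ] by (intro gsat_Un)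
  have gF': "gsat m F'" unfolding F'_def using X(2) F gA[OF KJ] gA[OF LJ] by (intro gsat_Un gsat_Diff)
  have cG: "card G = T"
  proof -
    have 1: "card ((\<Union>j\<in>K. A j) \<union> (\<Union>j\<in>L. B j)) = a * (c + g) + (M - a) * c"
      using ABdis[OF KJ LJ] finA[OF KJ] finA[OF LJ] cA[OF KJ] cB[OF LJ] K(2) cL
      by (simp add: card_Un_disjoint)
    have "(\<Union>j\<in>K. A j) \<union> (\<Union>j\<in>L. B j) \<subseteq> (\<Union>j\<in>J. A j \<union> B j)" using KJ LJ by blast
    then have "X \<inter> ((\<Union>j\<in>K. A j) \<union> (\<Union>j\<in>L. B j)) = {}" using X(1) Fdis by blast
    then have "card G = card X + (a * (c + g) + (M - a) * c)"
      unfolding G_def 1[symmetric] using gsat_finite[OF X(2)] finA[OF KJ] finA[OF LJ] by (intro card_Un_disjoint) auto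
    also have "a * (c + g) + (M - a) * c = g * a + M * c"
    proof -
      have "a * c + (M - a) * c = M * c" using aM by (metis add_mult_distrib le_add_diff_inverse)
      then show ?thesis by (simp add: algebra_simps)
    qed
    finally show ?thesis using a X(3) Mc by (simp add: t_def)
  qed
  have VG: "V = G \<union> V'"
    unfolding Suc.prems(7) G_def V'_def F'_def L_def using X(1) K(1) J'(1) by auto
  have GV': "G \<inter> V' = {}"
  proof -
    have d: "z \<notin> A l \<union> B l" if "z \<in> A j \<union> B j" "j \<in> J" "l \<in> J" "j \<noteq> l" for z j l
    proof -
      have "(A j \<union> B j) \<inter> (A l \<union> B l) = {}" using dis that(2-) unfolding disjoint_family_on_def by simp
      then show ?thesis using that(1) by auto
    qed
    have e: "z \<notin> B j" if "z \<in> A j" "j \<in> J" for z j using tok[OF that(2)] that(1) by auto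
    have f: "z \<notin> A j \<union> B j" if "z \<in> F" "j \<in> J" for z j using tok[OF that(2)] that(1) by auto
    have "z \<notin> V'" if zG: "z \<in> G" for z
    proof -
      consider "z \<in> X" | j where "j \<in> K" "z \<in> A j" | j where "j \<in> L" "z \<in> B j"
        using zG by (auto simp: G_def)
      then show ?thesis
      proof cases
        case 1
        then have "z \<in> F" using X(1) by auto
        then show ?thesis using 1 f KJ LJ by (auto simp: V'_def F'_def)
      next
        case 2
        have "z \<notin> F" using f[of z j] 2 KJ by auto
        moreover have "z \<notin> A l \<union> B l" if "l \<in> J" "l \<noteq> j" for l using d[of z j l] 2 KJ that by auto
        moreover have "z \<notin> B j" using e 2 KJ by auto
        moreover have "j \<notin> L" "j \<notin> J - J'" using 2(1) K(1) by (auto simp: L_def)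
        ultimately show ?thesis using KJ LJ unfolding V'_def F'_def by blast
      next
        case 3
        have "z \<notin> F" using f[of z j] 3 LJ by auto
        moreover have "z \<notin> A l \<union> B l" if "l \<in> J" "l \<noteq> j" for l using d[of z j l] 3 LJ that by auto
        moreover have "z \<notin> A j" using e 3 LJ by auto
        moreover have "j \<notin> K" "j \<notin> J - J'" using 3(1) by (auto simp: L_def)
        ultimately show ?thesis using KJ LJ unfolding V'_def F'_def by blast
      qed
    qed
    then show ?thesis by auto
  qed
  have gV': "gsat m V'" unfolding V'_def using gF' tok by (intro gsat_Un gsat_UN) auto
  have "card V = card G + card V'" unfolding VG using GV' gsat_finite[OF gG] gsat_finite[OF gV']
    by (intro card_Un_disjoint)
  then have cV': "card V' = Suc i * T" using cG Suc.prems(8) by simp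
  have cJ: "card (J - J') = card J - M" using J' finJ' by (simp add: card_Diff_subset)
  have "\<exists>P. \<Union>P = V' \<and> disjoint P \<and> (\<forall>X\<in>P. gsat m X \<and> card X = T)"
  proof (rule Suc.IH[of "J - J'" F' V'])
    show "finite (J - J')" using finJ by simp
    show "gsat m F'" by (rule gF')
    show "gsat m (A j) \<and> card (A j) = c + g \<and> gsat m (B j) \<and> card (B j) = c \<and>
        A j \<inter> B j = {} \<and> F' \<inter> (A j \<union> B j) = {}" if j: "j \<in> J - J'" for j
    proof -
      have jJ: "j \<in> J" using j by simp
      have "(A l \<union> B l) \<inter> (A j \<union> B j) = {}" if "l \<in> J'" for l
        using dis that j J'(1) unfolding disjoint_family_on_def by (metis DiffD1 DiffD2 subsetD)
      then have "F' \<inter> (A j \<union> B j) = {}"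
        using tok[OF jJ] K(1) unfolding F'_def L_def by blast
      then show ?thesis using tok[OF jJ] by simp
    qed
    show "disjoint_family_on (\<lambda>j. A j \<union> B j) (J - J')"
      using dis by (rule disjoint_family_on_mono[rotated]) simp
    show "i * M \<le> card (J - J')" using Suc.prems(5) cJ by simp
    have "card (J - J') * (2 * c + g) \<le> card J * (2 * c + g)" unfolding cJ by (intro mult_le_mono1) simp
    then show "card (J - J') * (2 * c + g) \<le> T" using Suc.prems(6) by linarith
    show "V' = F' \<union> (\<Union>j\<in>J - J'. A j \<union> B j)" by (rule V'_def)
    show "card V' = Suc i * T" by (rule cV')
  qed
  then obtain P where P: "\<Union>P = V'" "disjoint P" "\<forall>X\<in>P. gsat m X \<and> card X = T" by (elim exE conjE)
  have "\<Union>(insert G P) = V" using P(1) VG by simp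
  moreover have "disjoint (insert G P)"
  proof -
    have "G \<inter> X = {}" if "X \<in> P" for X
    proof -
      have "X \<subseteq> V'" using that P(1) by (metis Union_upper)
      then show ?thesis using GV' by auto
    qed
    then show ?thesis using P(2) by (auto simp: pairwise_insert disjnt_def)
  qed
  moreover have "\<forall>X\<in>insert G P. gsat m X \<and> card X = T" using P(3) gG cG by simp
  ultimately show ?case by blast
qed

text \<open>Copies of two good sets whose sizes differ by \<open>g\<close> are planted below
  descendants of the cluster and serve as exchange pairs. A cluster of \<open>g * a\<close> words
  needs \<open>(a - 1) * M\<close> of them; since a is at most \<open>M\<close>, their total size is
  bounded independently of the cluster, whereas the block size \<open>g * N ^ l\<close> grows with
  l.\<close>

lemma split_cluster:
  "\<exists>l1. \<forall>l\<ge>l1. \<forall>n. \<forall>w\<in>good n. \<exists>P. \<Union>P = extend N l (cluster n w) \<and> disjoint P \<and>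
     (\<forall>X\<in>P. gsat (n + l) X \<and> card X = g * N ^ l)"
proof -
  obtain q T1 T2 where T: "gsat q T1" "gsat q T2" and "int g = int (card T1) - int (card T2)"
    using g_diffs by (rule diffsE)
  then have cT: "card T1 = card T2 + g" by linarith
  define c where "c = card T2"
  \<comment> \<open>Bounds the number of words in all pairs: at most \<open>M * M\<close> pairs with
    \<open>2 * c + g\<close> words each.\<close>
  define b where "b = M * M * (2 * c + g)"
  have "\<exists>P. \<Union>P = extend N l (cluster n w) \<and> disjoint P \<and>
     (\<forall>X\<in>P. gsat (n + l) X \<and> card X = g * N ^ l)" if l: "l \<ge> q + 1 + b" and w: "w \<in> good n" for l n w
  proof -
    \<comment> \<open>Of the l letters, k provide enough words j to carry the pairs, one letter
      tells \<open>A j\<close> from \<open>B j\<close>, and q letters belong to the planted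
      sets.\<close>
    define k where "k = l - (q + 1)"
    have lk: "l = k + Suc q" using l by (simp add: k_def)
    have bk: "b \<le> k" using l by (simp add: k_def)
    have kN: "k \<le> N ^ k" for k using N2 less_exp[of k] power_mono[of 2 N k] by simp
    define U where "U = cluster n w"
    have gU: "gsat n U" unfolding U_def using w by (rule gsat_cluster)
    have Uw: "U \<subseteq> words N n" using gU by (rule gsat_words)
    obtain a where a: "card U = g * a" using g_dvd_card[OF gU] by (rule dvdE)
    have cU: "0 < card U" using gsat_finite[OF gU] cluster_refl[of w n] by (auto simp: U_def card_gt_0_iff)
    have "card U \<le> M" using card_cluster_le w by (simp add: U_def good_def)
    moreover have "a \<le> g * a" using g_pos by simp
    ultimately have aM: "a \<le> M" using a by linarith
    have "0 < a" using a cU by (cases a) auto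
    then obtain i where i: "a = Suc i" by (cases a) auto
    define W where "W = extend N k U"
    have WW: "W \<subseteq> words N (n + k)" unfolding W_def by (rule extend_words[OF Uw])
    have cW: "card W = g * a * N ^ k" unfolding W_def by (simp add: card_extend[OF Uw] a)
    have "M * M \<le> b" unfolding b_def using g_pos by simp
    then have "M * M \<le> N ^ k" using bk kN[of k] by linarith
    moreover have "N ^ k \<le> card W" unfolding cW using g_pos \<open>0 < a\<close> by simp
    moreover have iM: "i * M \<le> M * M" using aM i by (intro mult_le_mono1) simp
    ultimately have "i * M \<le> card W" by linarith
    then obtain J where J: "J \<subseteq> W" "card J = i * M" by (metis obtain_subset_with_card_n)
    have finJ: "finite J" using J(1) WW by (meson finite_subset finite_words)
    have jw: "j \<in> words N (n + k)" if "j \<in> J" for j using that J(1) WW by auto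
    have lev: "n + l = (n + k + 1) + q" using lk by simp
    have jx: "j @ [x] \<in> words N (n + k + 1)" if "j \<in> J" "x < 2" for j x
      using jw[OF that(1)] that(2) N2 by (auto simp: words_def)
    define A where "A j = (@) (j @ [0]) ` T1" for j
    define B where "B j = (@) (j @ [1]) ` T2" for j
    have gA: "gsat (n + l) (A j)" and gB: "gsat (n + l) (B j)" if "j \<in> J" for j
      unfolding A_def B_def lev using gsat_prefix[OF jx[OF that, of 0] T(1)] gsat_prefix[OF jx[OF that, of 1] T(2)]
      by simp_all
    have cA: "card (A j) = c + g" for j
      unfolding A_def c_def cT[symmetric] by (rule card_image) (simp add: inj_on_def)
    have cB: "card (B j) = c" for j
      unfolding B_def c_def by (rule card_image) (simp add: inj_on_def)
    have tk: "take (n + k) z = j" if "z \<in> A j \<union> B j" "j \<in> J" for z j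
      using that length_words[OF jw[OF that(2)]] by (auto simp: A_def B_def)
    define V where "V = extend N l U"
    have gV: "gsat (n + l) V" unfolding V_def using gU by (rule gsat_extend)
    have ABV: "A j \<union> B j \<subseteq> V" if "j \<in> J" for j
    proof
      fix z assume z: "z \<in> A j \<union> B j"
      then have "z \<in> words N (n + l)" using gA[OF that] gB[OF that] gsat_words by blast
      moreover have "take n z \<in> U"
      proof -
        have "take n z = take n (take (n + k) z)" by simp
        also have "\<dots> = take n j" using tk[OF z that] by simp
        also have "\<dots> \<in> U" using that J(1) extend_iff[OF Uw, of j k] by (auto simp: W_def)
        finally show ?thesis .
      qed
      ultimately show "z \<in> V" unfolding V_def using extend_iff[OF Uw] by simp
    qed
    define F where "F = V - (\<Union>j\<in>J. A j \<union> B j)"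
    have "\<exists>P. \<Union>P = V \<and> disjoint P \<and> (\<forall>X\<in>P. gsat (n + l) X \<and> card X = g * N ^ l)"
    proof (rule partition_by_exchange[of "g * N ^ l" c J "n + l" F A B i V])
      show "g dvd g * N ^ l" by simp
      show "g dvd c" unfolding c_def using T(2) by (rule g_dvd_card)
      show "finite J" by (rule finJ)
      show "gsat (n + l) F" unfolding F_def using gV gA gB by (intro gsat_Diff gsat_UN gsat_Un)
      show "gsat (n + l) (A j) \<and> card (A j) = c + g \<and> gsat (n + l) (B j) \<and> card (B j) = c \<and>
          A j \<inter> B j = {} \<and> F \<inter> (A j \<union> B j) = {}" if "j \<in> J" for j
      proof -
        have "A j \<inter> B j = {}" by (auto simp: A_def B_def)
        moreover have "F \<inter> (A j \<union> B j) = {}" using that by (auto simp: F_def)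
        ultimately show ?thesis using gA[OF that] gB[OF that] cA cB by simp
      qed
      show "disjoint_family_on (\<lambda>j. A j \<union> B j) J"
        unfolding disjoint_family_on_def
      proof (intro ballI impI)
        fix j j' assume jj: "j \<in> J" "j' \<in> J" "j \<noteq> j'"
        show "(A j \<union> B j) \<inter> (A j' \<union> B j') = {}"
          using tk[of _ j] tk[of _ j'] jj by (metis disjoint_iff)
      qed
      show "i * M \<le> card J" using J(2) by simp
      have "card J * (2 * c + g) \<le> b" unfolding b_def J(2) using iM by (rule mult_le_mono1)
      also have "b \<le> N ^ l" using bk lk kN[of l] by linarith
      also have "\<dots> \<le> g * N ^ l" using g_pos by simp
      finally show "card J * (2 * c + g) \<le> g * N ^ l" .
      have "(\<Union>j\<in>J. A j \<union> B j) \<subseteq> V" using ABV by (rule UN_least)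
      then show "V = F \<union> (\<Union>j\<in>J. A j \<union> B j)" unfolding F_def by auto
      show "card V = Suc i * (g * N ^ l)" unfolding V_def by (simp add: card_extend[OF Uw] a i algebra_simps)
    qed
    then show ?thesis by (simp add: V_def U_def)
  qed
  then show ?thesis by (intro exI[of _ "q + 1 + b"]) blast
qed

text \<open>n is the level of the cluster that contains the group and controls its diameter. The
  words have length \<open>n + l\<close> because the division takes place l letters further
  down.\<close>

definition group :: "nat \<Rightarrow> nat \<Rightarrow> nat list set \<Rightarrow> bool" where
  "group l n X \<longleftrightarrow> gsat (n + l) X \<and> card X = g * N ^ l \<and> (\<exists>w\<in>words N n. X \<subseteq> extend N l (cluster n w))"

lemma group_gsat: "group l n X \<Longrightarrow> gsat (n + l) X"
  by (simp add: group_def)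

text \<open>Each cluster of the set is divided on its own, so every group stays below a single
  cluster.\<close>

lemma split_gsat:
  "\<exists>l1. \<forall>l\<ge>l1. \<forall>n V. gsat n V \<longrightarrow> (\<exists>P. \<Union>P = extend N l V \<and> disjoint P \<and> (\<forall>X\<in>P. group l n X))"
proof -
  obtain l1 where l1: "\<forall>l\<ge>l1. \<forall>n. \<forall>w\<in>good n. \<exists>P. \<Union>P = extend N l (cluster n w) \<and> disjoint P \<and>
     (\<forall>X\<in>P. gsat (n + l) X \<and> card X = g * N ^ l)"
    using split_cluster by (rule exE)
  have "\<exists>P. \<Union>P = extend N l V \<and> disjoint P \<and> (\<forall>X\<in>P. group l n X)" if l: "l \<ge> l1" and V: "gsat n V" for l n V
  proof -
    define \<C> where "\<C> = cluster n ` V"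
    have Vw: "V \<subseteq> words N n" using V by (rule gsat_words)
    have "\<forall>c\<in>\<C>. \<exists>P. \<Union>P = extend N l c \<and> disjoint P \<and> (\<forall>X\<in>P. gsat (n + l) X \<and> card X = g * N ^ l)"
    proof
      fix c assume "c \<in> \<C>"
      then obtain w where w: "w \<in> V" "c = cluster n w" by (auto simp: \<C>_def)
      then have "w \<in> good n" using V by (auto simp: gsat_def)
      then show "\<exists>P. \<Union>P = extend N l c \<and> disjoint P \<and> (\<forall>X\<in>P. gsat (n + l) X \<and> card X = g * N ^ l)"
        unfolding w(2) using l1[rule_format, OF l] by simp
    qed
    from bchoice[OF this] obtain p where p: "\<forall>c\<in>\<C>. \<Union>(p c) = extend N l c \<and> disjoint (p c) \<and> (\<forall>X\<in>p c. gsat (n + l) X \<and> card X = g * N ^ l)"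
      by (rule exE)
    have p1: "\<Union>(p c) = extend N l c" and p2: "disjoint (p c)" and p3: "\<And>X. X \<in> p c \<Longrightarrow> gsat (n + l) X \<and> card X = g * N ^ l"
      if "c \<in> \<C>" for c using p that by simp_all
    have UC: "\<Union>\<C> = V"
    proof
      show "\<Union>\<C> \<subseteq> V" using cluster_subset[OF gsat_sat[OF V]] by (auto simp: \<C>_def)
      show "V \<subseteq> \<Union>\<C>" using cluster_refl by (auto simp: \<C>_def)
    qed
    have sub: "X \<subseteq> extend N l c" if "c \<in> \<C>" "X \<in> p c" for c X
      using p1[OF that(1)] that(2) by (metis Union_upper)
    have Cw: "c \<subseteq> words N n" if "c \<in> \<C>" for c using that UC Vw by auto
    have Cd: "c \<inter> c' = {}" if "c \<in> \<C>" "c' \<in> \<C>" "c \<noteq> c'" for c c'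
      using that cluster_disjoint by (auto simp: \<C>_def)
    define P where "P = (\<Union>c\<in>\<C>. p c)"
    have "\<Union>P = (\<Union>c\<in>\<C>. \<Union>(p c))" unfolding P_def by auto
    also have "\<dots> = (\<Union>c\<in>\<C>. extend N l c)" by (rule SUP_cong[OF refl p1])
    also have "\<dots> = extend N l V" unfolding extend_Union[symmetric] UC ..
    finally have "\<Union>P = extend N l V" .
    moreover have "disjoint P"
    proof (rule pairwiseI)
      fix X Y assume "X \<in> P" "Y \<in> P" and ne: "X \<noteq> Y"
      then obtain c d where c: "c \<in> \<C>" "X \<in> p c" "d \<in> \<C>" "Y \<in> p d" unfolding P_def by blast
      show "disjnt X Y"
      proof (cases "c = d")
        case True then show ?thesis using p2[OF c(1)] c ne by (auto simp: pairwise_def)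
      next
        case False
        have "extend N l c \<inter> extend N l d = {}"
          using Cd[OF c(1,3) False] by (rule extend_disjoint[OF Cw[OF c(1)] Cw[OF c(3)]])
        then show ?thesis using sub[OF c(1,2)] sub[OF c(3,4)] unfolding disjnt_def by blast
      qed
    qed
    moreover have "group l n X" if XP: "X \<in> P" for X
    proof -
      obtain c where c: "c \<in> \<C>" "X \<in> p c" using XP unfolding P_def by blast
      then obtain w where w: "w \<in> V" "c = cluster n w" by (auto simp: \<C>_def)
      show ?thesis using p3[OF c] sub[OF c] w Vw by (auto simp: group_def)
    qed
    ultimately show ?thesis by (intro exI[of _ P]) auto
  qed
  then show ?thesis by (intro exI[of _ l1]) blast
qed

text \<open>A bad descendant avoids \<open>w0\<close> in each of the j added blocks of
  \<open>n0\<close> letters, which leaves \<open>N ^ n0 - 1\<close> choices per block.\<close>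

lemma bad_count:
  assumes U: "U \<subseteq> words N n"
  shows "card (extend N (j * n0) U - good (n + j * n0)) \<le> card U * (N ^ n0 - 1) ^ j"
proof (induction j)
  case 0
  have "finite U" using U by (rule finite_subset) simp
  moreover have "extend N 0 U = U" by (force simp: extend_def)
  ultimately show ?case by (simp add: card_mono Diff_subset)
next
  case (Suc j)
  let ?B = "extend N (j * n0) U - good (n + j * n0)"
  have Bw: "?B \<subseteq> words N (n + j * n0)" using extend_words[OF U] by auto
  have fB: "finite ?B" using Bw by (rule finite_subset) simp
  have "extend N (Suc j * n0) U - good (n + Suc j * n0) \<subseteq> (\<lambda>(w, v). w @ v) ` (?B \<times> (words N n0 - {w0}))"
  proof
    fix z assume z: "z \<in> extend N (Suc j * n0) U - good (n + Suc j * n0)"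
    define w v where "w = take (n + j * n0) z" and "v = drop (n + j * n0) z"
    have lev: "n + Suc j * n0 = (n + j * n0) + n0" by simp
    have zw: "z \<in> words N ((n + j * n0) + n0)" "take n z \<in> U"
      using z extend_iff[OF U, of z "Suc j * n0"] unfolding lev by blast+
    have znot: "z \<notin> good ((n + j * n0) + n0)" using z unfolding lev by blast
    have w: "w \<in> words N (n + j * n0)" and v: "v \<in> words N n0"
      using take_in_words[OF zw(1)] drop_in_words[OF zw(1)] by (simp_all add: w_def v_def)
    have zz: "z = w @ v" by (simp add: w_def v_def)
    have "take n w = take n z" by (simp add: w_def min_def)
    then have "w \<in> extend N (j * n0) U" using w zw(2) extend_iff[OF U] by simp
    moreover have "w \<notin> good (n + j * n0)"
    proof
      assume "w \<in> good (n + j * n0)"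
      then have "z \<in> good ((n + j * n0) + n0)" unfolding zz using v by (rule good_append)
      then show False using znot by simp
    qed
    moreover have "v \<noteq> w0"
    proof
      assume "v = w0"
      then have "z = w @ w0 @ []" using zz by simp
      then have "z \<in> good ((n + j * n0) + n0)" using zw(1) w0_C0 unfolding good_def by blast
      then show False using znot by simp
    qed
    ultimately have "(w, v) \<in> ?B \<times> (words N n0 - {w0})" using v by simp
    then have "(\<lambda>(w, v). w @ v) (w, v) \<in> (\<lambda>(w, v). w @ v) ` (?B \<times> (words N n0 - {w0}))" by (rule imageI)
    then show "z \<in> (\<lambda>(w, v). w @ v) ` (?B \<times> (words N n0 - {w0}))" by (simp add: zz)
  qed
  then have "card (extend N (Suc j * n0) U - good (n + Suc j * n0)) \<le> card ((\<lambda>(w, v). w @ v) ` (?B \<times> (words N n0 - {w0})))"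
    by (rule card_mono[rotated]) (use fB in simp)
  also have "\<dots> \<le> card (?B \<times> (words N n0 - {w0}))" by (rule card_image_le) (use fB in simp)
  also have "\<dots> = card ?B * (N ^ n0 - 1)" using w0 by (simp add: card_cartesian_product card_words)
  also have "\<dots> \<le> card U * (N ^ n0 - 1) ^ j * (N ^ n0 - 1)" using Suc by (rule mult_le_mono1)
  finally show ?case by (simp add: ac_simps)
qed

text \<open>The proportion of bad descendants decays geometrically in j, and clusters have at most
  \<open>M\<close> words. Hence for large j fewer than \<open>N ^ l\<close> descendants are bad; the
  requirement j > l1 makes l long enough for the divisions as well.\<close>

lemma good_step_exists:
  obtains l where "l \<ge> 1" "M \<le> N ^ l"
    "\<And>n V. gsat n V \<Longrightarrow> \<exists>P. \<Union>P = extend N l V \<and> disjoint P \<and> (\<forall>X\<in>P. group l n X)"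
    "\<And>n w. w \<in> words N n \<Longrightarrow> card (extend N l (cluster n w) - good (n + l)) < N ^ l"
proof -
  obtain l1 where l1: "\<forall>l\<ge>l1. \<forall>n V. gsat n V \<longrightarrow> (\<exists>P. \<Union>P = extend N l V \<and> disjoint P \<and> (\<forall>X\<in>P. group l n X))"
    using split_gsat by (rule exE)
  define R where "R = N ^ n0"
  have R: "2 \<le> R"
  proof -
    have "N ^ 1 \<le> N ^ n0" using n0 N2 by (intro power_increasing) auto
    then show ?thesis using N2 by (simp add: R_def)
  qed
  define x where "x = real (R - 1) / real R"
  have x: "0 < x" "x < 1" using R by (auto simp: x_def)
  obtain j0 where j0: "x ^ j0 < 1 / real M" using real_arch_pow_inv[of "1 / real M" x] x M_pos by auto
  define j where "j = max j0 (l1 + 1)"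
  have "x ^ j \<le> x ^ j0" using x by (intro power_decreasing) (auto simp: j_def)
  then have "x ^ j < 1 / real M" using j0 by linarith
  then have "real M * (real (R - 1) ^ j / real R ^ j) < 1"
    using M_pos by (simp add: x_def power_divide field_simps)
  then have "real M * real (R - 1) ^ j < real R ^ j" using R by (simp add: field_simps)
  then have "real (M * (R - 1) ^ j) < real (R ^ j)" by simp
  then have lt: "M * (R - 1) ^ j < R ^ j" by (simp only: of_nat_less_iff)
  define l where "l = j * n0"
  have Rl: "R ^ j = N ^ l" by (simp add: R_def l_def power_mult[symmetric] mult.commute)
  have "j * 1 \<le> j * n0" using n0 by (intro mult_le_mono2)
  then have jl: "j \<le> l" by (simp add: l_def)
  show thesis
  proof (rule that[of l])
    show "l \<ge> 1" using jl by (simp add: j_def)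
    have "M * 1 \<le> M * (R - 1) ^ j" using R by (intro mult_le_mono2) (simp add: Suc_le_eq)
    then show "M \<le> N ^ l" using lt unfolding Rl by linarith
    show "\<exists>P. \<Union>P = extend N l V \<and> disjoint P \<and> (\<forall>X\<in>P. group l n X)" if "gsat n V" for n V
      using jl that by (intro l1[rule_format]) (auto simp: j_def)
    show "card (extend N l (cluster n w) - good (n + l)) < N ^ l" if "w \<in> words N n" for n w
    proof -
      have "card (extend N l (cluster n w) - good (n + l)) \<le> card (cluster n w) * (R - 1) ^ j"
        using bad_count[OF cluster_words[OF that], of j] by (simp add: l_def R_def)
      also have "\<dots> \<le> M * (R - 1) ^ j" using card_cluster_le[OF that] by (rule mult_le_mono1)
      finally show ?thesis using lt Rl by simp
    qed
  qed
qed

end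

subsection \<open>The symbolic space\<close>

definition seqs :: "nat \<Rightarrow> (nat \<Rightarrow> nat) set" where
  "seqs N = {x. \<forall>i. x i < N}"

definition seq_dist :: "real \<Rightarrow> (nat \<Rightarrow> nat) \<Rightarrow> (nat \<Rightarrow> nat) \<Rightarrow> real" where
  "seq_dist r x y = (if x = y then 0 else r ^ (LEAST i. x i \<noteq> y i))"

definition pre :: "nat \<Rightarrow> (nat \<Rightarrow> nat) \<Rightarrow> nat list" where
  "pre n x = map x [0..<n]"

text \<open>The length is quantified away so that no level has to be carried along;
  \<open>cyl_iff\<close> recovers it for words of equal length.\<close>

definition cyl :: "nat \<Rightarrow> nat list set \<Rightarrow> (nat \<Rightarrow> nat) set" where
  "cyl N W = {x \<in> seqs N. \<exists>n. pre n x \<in> W}"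

definition determined :: "nat \<Rightarrow> nat \<Rightarrow> (nat \<Rightarrow> nat) set \<Rightarrow> bool" where
  "determined N L B \<longleftrightarrow> B \<subseteq> seqs N \<and> (\<forall>x\<in>B. \<forall>y\<in>seqs N. (\<forall>i<L. x i = y i) \<longrightarrow> y \<in> B)"

lemma seq_dist_eq_0: "0 < r \<Longrightarrow> seq_dist r x y = 0 \<longleftrightarrow> x = y"
  by (simp add: seq_dist_def)

lemma seq_dist_nonneg: "0 < r \<Longrightarrow> 0 \<le> seq_dist r x y"
  by (simp add: seq_dist_def)

lemma seq_dist_le:
  assumes "0 < r" "r < 1" "\<And>i. i < n \<Longrightarrow> x i = y i"
  shows "seq_dist r x y \<le> r ^ n"
proof (cases "x = y")
  case False
  then have "\<exists>i. x i \<noteq> y i" by (simp add: fun_eq_iff)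
  then have "x (LEAST i. x i \<noteq> y i) \<noteq> y (LEAST i. x i \<noteq> y i)" by (rule LeastI_ex)
  then have "n \<le> (LEAST i. x i \<noteq> y i)" using assms(3) not_less by blast
  then show ?thesis using assms(1,2) False by (simp add: seq_dist_def power_decreasing)
qed (use assms in \<open>simp add: seq_dist_def\<close>)

lemma seq_dist_ge:
  assumes "0 < r" "r < 1" "x i \<noteq> y i" "i < n"
  shows "r ^ n \<le> seq_dist r x y"
proof -
  have "(LEAST i. x i \<noteq> y i) \<le> i" using assms(3) by (rule Least_le)
  then have "r ^ n \<le> r ^ (LEAST i. x i \<noteq> y i)" using assms by (intro power_decreasing) auto
  moreover have "x \<noteq> y" using assms(3) by auto
  ultimately show ?thesis by (simp add: seq_dist_def)
qed

lemma determined_separated: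
  assumes "0 < r" "r < 1" "determined N L B" "determined N L B'" "B \<inter> B' = {}" "x \<in> B" "y \<in> B'"
  shows "r ^ L \<le> seq_dist r x y"
proof -
  have "\<exists>i<L. x i \<noteq> y i"
  proof (rule ccontr)
    assume "\<not> ?thesis"
    then have "y \<in> B" using assms unfolding determined_def by blast
    then show False using assms by auto
  qed
  then show ?thesis using seq_dist_ge assms by blast
qed

lemma determined_mono: "determined N L B \<Longrightarrow> L \<le> L' \<Longrightarrow> determined N L' B"
  unfolding determined_def by (meson less_le_trans)

lemma length_pre [simp]: "length (pre n x) = n"
  by (simp add: pre_def)

lemma pre_words: "x \<in> seqs N \<Longrightarrow> pre n x \<in> words N n"
  by (auto simp: pre_def words_def seqs_def)

lemma take_pre: "m \<le> n \<Longrightarrow> take m (pre n x) = pre m x"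
  by (simp add: pre_def take_map)

lemma pre_eq_iff: "pre n x = pre n y \<longleftrightarrow> (\<forall>i<n. x i = y i)"
  by (auto simp: pre_def)

lemma cyl_iff: "W \<subseteq> words N n \<Longrightarrow> x \<in> cyl N W \<longleftrightarrow> x \<in> seqs N \<and> pre n x \<in> W"
proof -
  assume W: "W \<subseteq> words N n"
  have "m = n" if "pre m x \<in> W" for m using that W length_words length_pre by (metis subsetD)
  then show ?thesis by (auto simp: cyl_def)
qed

lemma cyl_determined: "W \<subseteq> words N n \<Longrightarrow> determined N n (cyl N W)"
  unfolding determined_def by (auto simp: cyl_iff) (metis pre_eq_iff)

lemma cyl_extend: "W \<subseteq> words N n \<Longrightarrow> cyl N (extend N k W) = cyl N W"
  using extend_iff[of W N n _ k] cyl_iff[of W N n] cyl_iff[OF extend_words[of W N n k]] pre_words[of _ N "n + k"]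
    take_pre[of n "n + k"] by auto

lemma cyl_disjoint: "W \<subseteq> words N n \<Longrightarrow> W' \<subseteq> words N n \<Longrightarrow> W \<inter> W' = {} \<Longrightarrow> cyl N W \<inter> cyl N W' = {}"
  using cyl_iff[of W N n] cyl_iff[of W' N n] by auto

lemma cyl_Un: "cyl N (W \<union> W') = cyl N W \<union> cyl N W'"
  by (auto simp: cyl_def)

lemma cyl_UN: "cyl N (\<Union>i\<in>I. W i) = (\<Union>i\<in>I. cyl N (W i))"
  by (auto simp: cyl_def)

lemma cyl_mono: "W \<subseteq> W' \<Longrightarrow> cyl N W \<subseteq> cyl N W'"
  by (auto simp: cyl_def)

lemma cyl_nonempty: "0 < N \<Longrightarrow> W \<subseteq> words N n \<Longrightarrow> W \<noteq> {} \<Longrightarrow> cyl N W \<noteq> {}"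
proof -
  assume N: "0 < N" and W: "W \<subseteq> words N n" "W \<noteq> {}"
  then obtain w where w: "w \<in> W" by auto
  then have ww: "set w \<subseteq> {..<N}" "length w = n" using W by (auto simp: words_def)
  define x where "x i = (if i < n then w ! i else 0)" for i
  have "x \<in> seqs N" using N ww by (auto simp: seqs_def x_def subset_eq)
  moreover have "pre n x = w" using ww by (auto simp: pre_def x_def intro: nth_equalityI)
  ultimately show ?thesis using w by (auto simp: cyl_def)
qed

text \<open>A substitute for compactness: coordinate i is constant on \<open>B m\<close> as soon as
  m > i + 1. The sequence of these constants agrees with some point of \<open>B m\<close> on all
  coordinates that decide membership in \<open>B m\<close>.\<close>

lemma nested_determined:
  assumes det: "\<And>m. determined N (L m) (B m)" and ne: "\<And>m. B m \<noteq> {}" and sub: "\<And>m. B (Suc m) \<subseteq> B m"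
    and agree: "\<And>m x y i. x \<in> B m \<Longrightarrow> y \<in> B m \<Longrightarrow> i + 1 < m \<Longrightarrow> x i = y i"
  shows "(\<Inter>m. B m) \<noteq> {}"
proof -
  have "\<forall>m. \<exists>x. x \<in> B m" using ne by blast
  then obtain y where y: "\<And>m. y m \<in> B m" by metis
  have anti: "B k \<subseteq> B m" if "m \<le> k" for m k
    using sub that by (rule lift_Suc_antimono_le)
  \<comment> \<open>i + 2 is the first index m with \<open>i + 1 < m\<close>.\<close>
  define x where "x i = y (i + 2) i" for i
  have xs: "x \<in> seqs N" using y det by (auto simp: x_def seqs_def determined_def subset_eq)
  have "x \<in> B m" for m
  proof -
    define k where "k = max m (L m + 2)"
    have ykm: "y k \<in> B m" using y[of k] anti[of m k] by (auto simp: k_def)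
    have "y k i = x i" if "i < L m" for i
    proof -
      have "i + 2 \<le> k" using that by (simp add: k_def le_max_iff_disj)
      then have "y k \<in> B (i + 2)" using y[of k] anti by blast
      then show ?thesis unfolding x_def using y[of "i + 2"] by (intro agree[of _ "i + 2"]) auto
    qed
    then show ?thesis using det[of m] ykm xs unfolding determined_def by blast
  qed
  then show ?thesis by auto
qed

lemma distribute:
  assumes "finite P" "finite W" "card P \<le> card W" "card W \<le> card P * R" "1 \<le> R"
  shows "\<exists>f. (\<Union>p\<in>P. f p) = W \<and> disjoint_family_on f P \<and> (\<forall>p\<in>P. 1 \<le> card (f p) \<and> card (f p) \<le> R)"
  using assms
proof (induction P arbitrary: W rule: finite_induct)
  case empty then show ?case by (auto simp: disjoint_family_on_def)
next
  case (insert p P)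
  \<comment> \<open>The least number, but not zero, that leaves the remaining members of
    \<open>P\<close> no more than \<open>R\<close> elements each.\<close>
  define e where "e = max 1 (card W - card P * R)"
  have c: "card (insert p P) = Suc (card P)" using insert.hyps by simp
  have eR: "1 \<le> e" "e \<le> R" using insert.prems c by (auto simp: e_def)
  have eW: "e \<le> card W" using insert.prems c by (auto simp: e_def)
  then obtain Y where Y: "Y \<subseteq> W" "card Y = e" by (metis obtain_subset_with_card_n)
  have fY: "finite Y" using Y(1) insert.prems(1) by (rule finite_subset)
  have cWY: "card (W - Y) = card W - e" using Y fY by (simp add: card_Diff_subset)
  have "card P \<le> card P * R" using insert.prems(4) by simp
  moreover have "Suc (card P) \<le> card W" "card W \<le> R + card P * R" using insert.prems(2,3) c by auto
  ultimately have "card P \<le> card W - e" "card W - e \<le> card P * R"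
    unfolding e_def by linarith+
  then have "card P \<le> card (W - Y)" "card (W - Y) \<le> card P * R" unfolding cWY .
  then obtain f where f: "(\<Union>q\<in>P. f q) = W - Y" "disjoint_family_on f P" "\<forall>q\<in>P. 1 \<le> card (f q) \<and> card (f q) \<le> R"
    using insert.IH[of "W - Y"] insert.prems by auto
  define h where "h = f(p := Y)"
  have hq: "h q = f q" if "q \<in> P" for q using that insert.hyps by (auto simp: h_def)
  have hp: "h p = Y" by (simp add: h_def)
  have U: "(\<Union>q\<in>P. h q) = W - Y" using f(1) hq by simp
  then have "(\<Union>q\<in>insert p P. h q) = W" using Y(1) hp by auto
  moreover have "disjoint_family_on h (insert p P)"
  proof -
    have "disjoint_family_on h P" using f(2) hq by (simp add: disjoint_family_on_def)
    moreover have "h p \<inter> (\<Union>q\<in>P. h q) = {}" using U hp by auto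
    ultimately show ?thesis using insert.hyps by (simp add: disjoint_family_on_insert)
  qed
  moreover have "\<forall>q\<in>insert p P. 1 \<le> card (h q) \<and> card (h q) \<le> R" using f(3) hq hp Y(2) eR by simp
  ultimately show ?case by blast
qed

subsection \<open>Matching pieces with cylinders\<close>

locale osc_step = osc_maximal +
  fixes l :: nat
  assumes l_pos: "1 \<le> l" and M_le: "M \<le> N ^ l"
    and split: "\<And>n V. gsat n V \<Longrightarrow> \<exists>P. \<Union>P = extend N l V \<and> disjoint P \<and> (\<forall>X\<in>P. group l n X)"
    and bad: "\<And>n w. w \<in> words N n \<Longrightarrow> card (extend N l (cluster n w) - good (n + l)) < N ^ l"
begin

lemma Npow_pos: "0 < N ^ k"
  using N2 by simp

text \<open>Possible partners of a group of step \<open>m\<close>. The levels are allowed to differ by a bounded amount,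
  since the mismatch in number at a bad cluster is paid for once by a shift of levels. A single cylinder
  may lag one step behind because it can be split off from a family of several.\<close>

definition target :: "nat \<Rightarrow> nat list set \<Rightarrow> bool" where
  "target m W \<longleftrightarrow> (\<exists>t. W \<subseteq> words N (l * t) \<and> 1 \<le> card W \<and> card W \<le> N ^ l \<and> (card W = 1 \<or> m \<le> t) \<and>
     m \<le> t + 1 \<and> t \<le> m + 2 \<and> (\<exists>z. \<forall>w\<in>W. take (l * (m - 1)) w = z))"

text \<open>A bad cluster is always paired with one cylinder of exactly its own level; families of
  cylinders and shifts of level occur for groups alone.\<close>

definition matched :: "nat \<Rightarrow> 'a set \<times> (nat \<Rightarrow> nat) set \<Rightarrow> bool" where
  "matched m p \<longleftrightarrow>
     (\<exists>w\<in>words N (l * m) - good (l * m). \<exists>z\<in>words N (l * m). p = (Piece (cluster (l * m) w), cyl N {z})) \<or>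
     (\<exists>X W. group l (l * m) X \<and> target m W \<and> p = (Piece X, cyl N W))"

lemma matchedE:
  assumes "matched m p"
  obtains (bad) w z where "w \<in> words N (l * m)" "w \<notin> good (l * m)" "z \<in> words N (l * m)"
      "p = (Piece (cluster (l * m) w), cyl N {z})"
    | (good) X W where "group l (l * m) X" "target m W" "p = (Piece X, cyl N W)"
  using assms unfolding matched_def by blast

lemma matched_bad:
  "w \<in> words N (l * m) \<Longrightarrow> w \<notin> good (l * m) \<Longrightarrow> z \<in> words N (l * m) \<Longrightarrow>
    matched m (Piece (cluster (l * m) w), cyl N {z})"
  unfolding matched_def by blast

lemma matched_good: "group l (l * m) X \<Longrightarrow> target m W \<Longrightarrow> matched m (Piece X, cyl N W)"
  unfolding matched_def by blast

lemma Piece_mono: "U \<subseteq> V \<Longrightarrow> Piece U \<subseteq> Piece V"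
  by (auto simp: Piece_def)

lemma compact_Piece: "U \<subseteq> words N n \<Longrightarrow> compact (Piece U)"
  unfolding Piece_def by (rule compact_UN) (auto intro: finite_subset compact_piece)

lemma Piece_nonempty: "U \<noteq> {} \<Longrightarrow> Piece U \<noteq> {}"
  using piece_nonempty by (auto simp: Piece_def)

lemma Piece_separated:
  assumes "sat n U" "sat n V" "U \<inter> V = {}" "x \<in> Piece U" "y \<in> Piece V"
  shows "r ^ n \<le> dist x y"
proof -
  obtain w v where "w \<in> U" "x \<in> piece w" "v \<in> V" "y \<in> piece v" using assms(4,5) by (auto simp: Piece_def)
  then show ?thesis using sat_separated[OF assms(1-3)] less_imp_le by blast
qed

lemma matched_cluster:
  assumes "matched m p"
  shows "\<exists>w\<in>words N (l * m). fst p \<subseteq> Piece (cluster (l * m) w)"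
  using assms
proof (cases rule: matchedE)
  case (bad w z) then show ?thesis by auto
next
  case (good X W)
  then obtain w where w: "w \<in> words N (l * m)" "X \<subseteq> extend N l (cluster (l * m) w)" by (auto simp: group_def)
  have "Piece X \<subseteq> Piece (cluster (l * m) w)" using Piece_mono[OF w(2)] by (simp add: Piece_extend)
  then show ?thesis using w(1) good(3) by auto
qed

lemma matched_compact_fst:
  assumes "matched m p"
  shows "compact (fst p) \<and> fst p \<noteq> {}"
  using assms
proof (cases rule: matchedE)
  case (bad w z)
  have "cluster (l * m) w \<noteq> {}" using cluster_refl by auto
  then show ?thesis using compact_Piece[OF cluster_words[OF bad(1)]] Piece_nonempty bad(4) by simp
next
  case (good X W)
  have "X \<subseteq> words N (l * m + l)" using good(1) group_gsat gsat_words by blast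
  moreover have "X \<noteq> {}" using good(1) g_pos Npow_pos[of l] by (auto simp: group_def)
  ultimately show ?thesis using compact_Piece Piece_nonempty good(3) by simp
qed

lemma dist_in_cluster:
  assumes w: "w \<in> words N n" and x: "x \<in> Piece (cluster n w)" and y: "y \<in> Piece (cluster n w)"
  shows "dist x y \<le> 2 * C * r ^ n"
proof -
  obtain u v where u: "u \<in> cluster n w" "x \<in> piece u" and v: "v \<in> cluster n w" "y \<in> piece v"
    using x y by (auto simp: Piece_def)
  obtain e where e: "e \<in> piece w" using piece_nonempty by auto
  have "dist e x \<le> C * r ^ n" "dist e y \<le> C * r ^ n" using cluster_diam[OF w] u v e by blast+
  then show ?thesis using dist_triangle3[of x y e] by linarith
qed

lemma target_agree:
  assumes "target m W" "x \<in> cyl N W" "y \<in> cyl N W" "i < l * (m - 1)"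
  shows "x i = y i"
proof -
  obtain t z where t: "W \<subseteq> words N (l * t)" "m \<le> t + 1" "\<forall>w\<in>W. take (l * (m - 1)) w = z"
    using assms(1) by (auto simp: target_def)
  have le: "l * (m - 1) \<le> l * t" using t(2) by (intro mult_le_mono2) linarith
  have "pre (l * (m - 1)) x = z" "pre (l * (m - 1)) y = z"
    using assms(2,3) cyl_iff[OF t(1)] t(3) take_pre[OF le] by auto
  then show ?thesis using pre_eq_iff[of "l * (m - 1)" x y] assms(4) by simp
qed

lemma matched_agree:
  assumes "matched m p" "x \<in> snd p" "y \<in> snd p" "i < l * (m - 1)"
  shows "x i = y i"
  using assms(1)
proof (cases rule: matchedE)
  case (bad w z)
  have "{z} \<subseteq> words N (l * m)" using bad by simp
  then have "pre (l * m) x = pre (l * m) y" using assms(2,3) bad(4) cyl_iff[of "{z}"] by simp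
  moreover have "i < l * m" using assms(4) by (metis diff_le_self less_le_trans mult_le_mono2)
  ultimately show ?thesis using pre_eq_iff[of "l * m" x y] by simp
next
  case (good X W)
  then show ?thesis using target_agree assms by simp
qed

lemma target_determined: "target m W \<Longrightarrow> determined N (l * (m + 2)) (cyl N W)"
proof -
  assume "target m W"
  then obtain t where t: "W \<subseteq> words N (l * t)" "t \<le> m + 2" by (auto simp: target_def)
  then show ?thesis by (intro determined_mono[OF cyl_determined[OF t(1)]] mult_le_mono2)
qed

lemma matched_snd:
  assumes "matched m p"
  shows "determined N (l * (m + 2)) (snd p) \<and> snd p \<noteq> {}"
  using assms
proof (cases rule: matchedE)
  case (bad w z)
  have z: "{z} \<subseteq> words N (l * m)" using bad by simp
  have "determined N (l * (m + 2)) (cyl N {z})"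
    by (rule determined_mono[OF cyl_determined[OF z]]) simp
  then show ?thesis using cyl_nonempty[OF _ z] N2 bad(4) by simp
next
  case (good X W)
  obtain t where t: "W \<subseteq> words N (l * t)" "1 \<le> card W" using good(2) by (auto simp: target_def)
  then have "W \<noteq> {}" by auto
  then show ?thesis using cyl_nonempty[OF _ t(1)] N2 good(3) target_determined[OF good(2)] by simp
qed

text \<open>The splitting hypothesis of \<open>bilipschitz_of_matching_tree\<close> with ratio
  \<open>r ^ l\<close> and separation constant \<open>r ^ (4 * l)\<close>.\<close>

definition splits :: "nat \<Rightarrow> 'a set \<times> (nat \<Rightarrow> nat) set \<Rightarrow> bool" where
  "splits m p \<longleftrightarrow> (\<exists>P. (\<forall>q\<in>P. matched (Suc m) q) \<and> fst p = \<Union>(fst ` P) \<and> snd p = \<Union>(snd ` P) \<and>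
     (\<forall>q\<in>P. \<forall>q'\<in>P. q \<noteq> q' \<longrightarrow> (\<forall>x\<in>fst q. \<forall>y\<in>fst q'. r ^ (4 * l) * (r ^ l) ^ m \<le> dist x y) \<and>
                               (\<forall>x\<in>snd q. \<forall>y\<in>snd q'. r ^ (4 * l) * (r ^ l) ^ m \<le> seq_dist r x y)))"

text \<open>Disjointness on the level of words and sequences is enough. Disjoint saturated sets of
  level \<open>l * (m + 2)\<close> lie \<open>r ^ (l * (m + 2))\<close> apart, and the partners at
  step m + 1 are determined by \<open>l * (m + 3)\<close> coordinates;
  \<open>r ^ (l * (m + 4))\<close> is below both separations.\<close>

lemma splitsI:
  fixes Q :: "(nat list set \<times> (nat \<Rightarrow> nat) set) set"
  assumes sat: "\<And>q. q \<in> Q \<Longrightarrow> sat (l * (m + 2)) (fst q)"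
    and mat: "\<And>q. q \<in> Q \<Longrightarrow> matched (Suc m) (Piece (fst q), snd q)"
    and dis: "\<And>q q'. q \<in> Q \<Longrightarrow> q' \<in> Q \<Longrightarrow> q \<noteq> q' \<Longrightarrow> fst q \<inter> fst q' = {} \<and> snd q \<inter> snd q' = {}"
    and A: "A = Piece (\<Union>q\<in>Q. fst q)" and B: "B = (\<Union>q\<in>Q. snd q)"
  shows "splits m (A, B)"
  unfolding splits_def
proof (intro exI[of _ "(\<lambda>q. (Piece (fst q), snd q)) ` Q"] conjI ballI impI)
  show "fst (A, B) = \<Union>(fst ` (\<lambda>q. (Piece (fst q), snd q)) ` Q)" by (auto simp: A Piece_def)
  show "snd (A, B) = \<Union>(snd ` (\<lambda>q. (Piece (fst q), snd q)) ` Q)" by (auto simp: B)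
  fix p assume p: "p \<in> (\<lambda>q. (Piece (fst q), snd q)) ` Q"
  then obtain q where q: "q \<in> Q" "p = (Piece (fst q), snd q)" by (rule imageE)
  show "matched (Suc m) p" unfolding q(2) using q(1) by (rule mat)
  fix p' assume p': "p' \<in> (\<lambda>q. (Piece (fst q), snd q)) ` Q" and ne: "p \<noteq> p'"
  then obtain q' where q': "q' \<in> Q" "p' = (Piece (fst q'), snd q')" by (elim imageE)
  have d: "fst q \<inter> fst q' = {}" "snd q \<inter> snd q' = {}" using dis[OF q(1) q'(1)] ne q(2) q'(2) by auto
  have eq: "r ^ (4 * l) * (r ^ l) ^ m = r ^ (l * (m + 4))"
    by (simp add: power_mult[symmetric] power_add[symmetric] algebra_simps)
  show "r ^ (4 * l) * (r ^ l) ^ m \<le> dist x y" if "x \<in> fst p" "y \<in> fst p'" for x y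
  proof -
    have "r ^ (l * (m + 4)) \<le> r ^ (l * (m + 2))"
      using r0 r1 by (intro power_decreasing mult_le_mono2) auto
    also have "\<dots> \<le> dist x y"
      using that q(2) q'(2) by (intro Piece_separated[OF sat[OF q(1)] sat[OF q'(1)] d(1)]) auto
    finally show ?thesis unfolding eq .
  qed
  show "r ^ (4 * l) * (r ^ l) ^ m \<le> seq_dist r x y" if "x \<in> snd p" "y \<in> snd p'" for x y
  proof -
    have "determined N (l * (m + 4)) (snd q)" if "q \<in> Q" for q
      using matched_snd[OF mat[OF that], THEN conjunct1, unfolded snd_conv]
      by (rule determined_mono) (intro mult_le_mono2, simp)
    then have "determined N (l * (m + 4)) (snd q)" "determined N (l * (m + 4)) (snd q')" using q(1) q'(1) by auto
    then show ?thesis unfolding eq using that q(2) q'(2) by (intro determined_separated[OF r0 r1 _ _ d(2)]) auto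
  qed
qed

text \<open>Less than \<open>N ^ l\<close> of the subclusters are bad; each of them receives one of the \<open>N ^ l\<close>
  subcylinders. The groups formed by the good words absorb all the remaining ones, whatever their number.\<close>

lemma splits_bad:
  assumes w: "w \<in> words N (l * m)" and wb: "w \<notin> good (l * m)" and z: "z \<in> words N (l * m)"
  shows "splits m (Piece (cluster (l * m) w), cyl N {z})"
proof -
  define n where "n = l * m"
  define U where "U = cluster n w"
  have Uw: "U \<subseteq> words N n" using cluster_words w by (simp add: U_def n_def)
  have nl: "n + l = l * Suc m" "n + l + l = l * (m + 2)" by (simp_all add: n_def algebra_simps)
  define D where "D = extend N l U"
  have satD: "sat (n + l) D" unfolding D_def U_def using sat_cluster w n_def by (intro sat_extend) simp
  define Dg where "Dg = D \<inter> good (n + l)"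
  define Db where "Db = D - good (n + l)"
  have gDg: "gsat (n + l) Dg" unfolding gsat_def Dg_def using sat_Int[OF satD good_sat] by simp
  have satDb: "sat (n + l) Db" unfolding Db_def using satD good_sat by (rule sat_Diff)
  have cDb: "card Db < N ^ l" unfolding Db_def D_def U_def using bad w n_def by simp
  have fD: "finite D" using satD by (rule sat_finite)
  have cD: "card D = card U * N ^ l" unfolding D_def using Uw by (rule card_extend)
  have cU: "1 \<le> card U" "card U \<le> M"
  proof -
    have "finite U" using Uw by (rule finite_subset) simp
    then show "1 \<le> card U" using cluster_refl[of w n] by (auto simp: U_def Suc_le_eq card_gt_0_iff)
    show "card U \<le> M" using card_cluster_le w by (simp add: U_def n_def)
  qed
  obtain P where P: "\<Union>P = extend N l Dg" "disjoint P" "\<forall>X\<in>P. group l (n + l) X"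
    using split[OF gDg] by (elim exE conjE)
  have satX: "sat (n + l + l) X" if "X \<in> P" for X
    using P(3) that group_gsat gsat_sat by blast
  have fP: "finite P"
  proof (rule finite_UnionD)
    show "finite (\<Union>P)" unfolding P(1) using gsat_finite[OF gsat_extend[OF gDg]] .
  qed
  have cP: "card P * (g * N ^ l) = card Dg * N ^ l"
  proof -
    have "card (\<Union>P) = (\<Sum>X\<in>P. card X)"
      using P(2) satX sat_finite by (intro card_Union_disjoint) blast+
    also have "\<dots> = (\<Sum>X\<in>P. g * N ^ l)" by (rule sum.cong[OF refl]) (use P(3) in \<open>simp add: group_def\<close>)
    finally have "card (\<Union>P) = card P * (g * N ^ l)" by simp
    then show ?thesis unfolding P(1) card_extend[OF gsat_words[OF gDg]] by (rule sym)
  qed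
  \<comment> \<open>There are at least \<open>N ^ l\<close> descendants and fewer bad ones. So some
    group exists that can take the leftover cylinders.\<close>
  have "Dg \<noteq> {}"
  proof
    assume "Dg = {}"
    then have "Db = D" by (auto simp: Db_def Dg_def)
    moreover have "N ^ l \<le> card D" unfolding cD using cU(1) by simp
    ultimately show False using cDb by simp
  qed
  then have "0 < card Dg" using gsat_finite[OF gDg] by (simp add: card_gt_0_iff)
  then have P1: "1 \<le> card P" using cP Npow_pos[of l] by (cases "card P") auto
  have "(card P * g) * N ^ l = card Dg * N ^ l" using cP by (simp only: mult.assoc)
  then have "card P * g = card Dg" using Npow_pos[of l] by (metis mult_right_cancel not_gr_zero)
  then have "card P \<le> card Dg" using g_pos by (metis One_nat_def Suc_leI mult.right_neutral mult_le_mono2)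
  also have "card Dg \<le> card D" unfolding Dg_def using fD by (intro card_mono) auto
  also have "card D \<le> N ^ l * N ^ l" unfolding cD using cU(2) M_le by (intro mult_le_mono1) linarith
  finally have PN: "card P \<le> N ^ l * N ^ l" .
  define \<C> where "\<C> = cluster (n + l) ` Db"
  have fDb: "finite Db" using satDb by (rule sat_finite)
  have f\<C>: "finite \<C>" unfolding \<C>_def using fDb by simp
  have "card \<C> \<le> card Db" unfolding \<C>_def using fDb by (rule card_image_le)
  then have c\<C>: "card \<C> < N ^ l" using cDb by linarith
  have \<C>w: "c \<subseteq> words N (n + l)" and \<C>s: "sat (n + l) c" and \<C>b: "c \<subseteq> Db" if cC: "c \<in> \<C>" for c
  proof -
    obtain v where v: "v \<in> Db" "c = cluster (n + l) v" using cC by (auto simp: \<C>_def)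
    then have "v \<in> words N (n + l)" using sat_words[OF satDb] by auto
    then show "c \<subseteq> words N (n + l)" "sat (n + l) c" using cluster_words sat_cluster v by auto
    show "c \<subseteq> Db" unfolding v(2) using satDb v(1) by (rule cluster_subset)
  qed
  have U\<C>: "\<Union>\<C> = Db"
  proof
    show "\<Union>\<C> \<subseteq> Db" using \<C>b by auto
    show "Db \<subseteq> \<Union>\<C>" using cluster_refl by (auto simp: \<C>_def)
  qed
  have \<C>d: "c \<inter> c' = {}" if "c \<in> \<C>" "c' \<in> \<C>" "c \<noteq> c'" for c c'
    using that cluster_disjoint by (auto simp: \<C>_def)
  have zw: "{z} \<subseteq> words N n" using z by (simp add: n_def)
  define Ws where "Ws = extend N l {z}"
  have cWs: "card Ws = N ^ l" unfolding Ws_def using card_extend[OF zw] by simp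
  have Wsw: "Ws \<subseteq> words N (n + l)" unfolding Ws_def using zw by (rule extend_words)
  have "card \<C> \<le> card Ws" using c\<C> cWs by simp
  then obtain Wb where Wb: "Wb \<subseteq> Ws" "card Wb = card \<C>" by (metis obtain_subset_with_card_n)
  have fWs: "finite Ws" using Wsw by (rule finite_subset) simp
  then have fWb: "finite Wb" using Wb(1) by (rule finite_subset[rotated])
  obtain \<phi> where \<phi>: "bij_betw \<phi> \<C> Wb" using finite_same_card_bij[OF f\<C> fWb] Wb(2) by auto
  have \<phi>w: "\<phi> c \<in> Wb" if "c \<in> \<C>" for c using \<phi> that by (auto simp: bij_betw_def)
  define Wr where "Wr = Ws - Wb"
  have Wrw: "Wr \<subseteq> words N (n + l)" using Wsw by (auto simp: Wr_def)
  have cWr: "card Wr = N ^ l - card \<C>" unfolding Wr_def using Wb fWb cWs by (simp add: card_Diff_subset)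
  have Wr1: "1 \<le> card Wr" "card Wr \<le> N ^ l" using cWr c\<C> by auto
  \<comment> \<open>After s further subdivisions there are enough leftover cylinders for all groups.
    Since \<open>card P\<close> is at most \<open>N ^ (2 * l)\<close>, s = 2 always works; this is
    the origin of the shift by 2 in \<open>target\<close>.\<close>
  define good_s where "good_s s \<longleftrightarrow> card P \<le> card Wr * N ^ (l * s)" for s
  have good2: "good_s 2"
  proof -
    have "N ^ (l * 2) = N ^ l * N ^ l" by (simp add: mult_2_right power_add)
    then have "card P \<le> 1 * N ^ (l * 2)" using PN by simp
    also have "\<dots> \<le> card Wr * N ^ (l * 2)" using Wr1(1) by (rule mult_le_mono1)
    finally show ?thesis by (simp add: good_s_def)
  qed
  define s where "s = (LEAST s. good_s s)"
  have s1: "good_s s" unfolding s_def using good2 by (rule LeastI)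
  have s2: "s \<le> 2" unfolding s_def using good2 by (rule Least_le)
  \<comment> \<open>By minimality of s there was a shortage one subdivision earlier, so now there
    are at most \<open>N ^ l\<close> cylinders per group. For s = 0 the bound
    \<open>card Wr \<le> N ^ l\<close> does the same.\<close>
  have s3: "card Wr * N ^ (l * s) \<le> card P * N ^ l"
  proof (cases s)
    case 0
    have "1 * N ^ l \<le> card P * N ^ l" using P1 by (rule mult_le_mono1)
    then have "card Wr \<le> card P * N ^ l" using Wr1(2) by linarith
    then show ?thesis using 0 by simp
  next
    case (Suc s')
    then have "\<not> good_s s'" using not_less_Least[of s' good_s] by (simp add: s_def)
    then have "card Wr * N ^ (l * s') \<le> card P" by (simp add: good_s_def)
    then have "card Wr * N ^ (l * s') * N ^ l \<le> card P * N ^ l" by (rule mult_le_mono1)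
    then show ?thesis unfolding Suc by (simp add: power_add algebra_simps)
  qed
  define Wx where "Wx = extend N (l * s) Wr"
  have Wxw: "Wx \<subseteq> words N (n + l + l * s)" unfolding Wx_def using Wrw by (rule extend_words)
  have cWx: "card Wx = card Wr * N ^ (l * s)" unfolding Wx_def using Wrw by (rule card_extend)
  have fWx: "finite Wx" using Wxw by (rule finite_subset) simp
  have "\<exists>f. (\<Union>X\<in>P. f X) = Wx \<and> disjoint_family_on f P \<and> (\<forall>X\<in>P. 1 \<le> card (f X) \<and> card (f X) \<le> N ^ l)"
  proof (rule distribute[OF fP fWx])
    show "card P \<le> card Wx" using s1 unfolding cWx good_s_def .
    show "card Wx \<le> card P * N ^ l" using s3 unfolding cWx .
    show "1 \<le> N ^ l" using Npow_pos[of l] by linarith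
  qed
  then obtain f where f: "(\<Union>X\<in>P. f X) = Wx" "disjoint_family_on f P"
      "\<forall>X\<in>P. 1 \<le> card (f X) \<and> card (f X) \<le> N ^ l"
    by (elim exE conjE)
  have fX: "f X \<subseteq> Wx" if "X \<in> P" for X using f(1) that by auto
  have lev: "n + l + l * s = l * (Suc m + s)" by (simp add: n_def algebra_simps)
  have Xext: "X \<subseteq> extend N l Dg" if "X \<in> P" for X using that P(1) by (metis Union_upper)
  have Dgw: "Dg \<subseteq> words N (n + l)" using gDg by (rule gsat_words)
  have cyl\<phi>: "cyl N {\<phi> c} \<subseteq> cyl N Wb" if "c \<in> \<C>" for c using \<phi>w[OF that] by (intro cyl_mono) simp
  have cylf: "cyl N (f X) \<subseteq> cyl N Wr" if "X \<in> P" for X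
    using cyl_mono[OF fX[OF that], of N] cyl_extend[OF Wrw] by (simp add: Wx_def)
  have bs: "cyl N Wb \<inter> cyl N Wr = {}"
  proof (rule cyl_disjoint)
    show "Wb \<subseteq> words N (n + l)" using Wb(1) Wsw by auto
  qed (use Wrw in \<open>auto simp: Wr_def\<close>)
  define Q1 where "Q1 = (\<lambda>c. (extend N l c, cyl N {\<phi> c})) ` \<C>"
  define Q2 where "Q2 = (\<lambda>X. (X, cyl N (f X))) ` P"
  have dis11: "fst q \<inter> fst q' = {} \<and> snd q \<inter> snd q' = {}" if qq: "q \<in> Q1" "q' \<in> Q1" "q \<noteq> q'" for q q'
  proof -
    obtain c c' where c: "c \<in> \<C>" "q = (extend N l c, cyl N {\<phi> c})" "c' \<in> \<C>" "q' = (extend N l c', cyl N {\<phi> c'})"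
      using qq(1,2) unfolding Q1_def by (elim imageE)
    then have ne: "c \<noteq> c'" using qq(3) by auto
    have "extend N l c \<inter> extend N l c' = {}"
      using \<C>d[OF c(1,3) ne] by (rule extend_disjoint[OF \<C>w[OF c(1)] \<C>w[OF c(3)]])
    moreover have "\<phi> c \<noteq> \<phi> c'" using \<phi> c(1,3) ne by (auto simp: bij_betw_def inj_on_def)
    moreover have "{\<phi> c} \<subseteq> words N (n + l)" "{\<phi> c'} \<subseteq> words N (n + l)"
      using \<phi>w[OF c(1)] \<phi>w[OF c(3)] Wb(1) Wsw by auto
    ultimately show ?thesis unfolding c(2,4) using cyl_disjoint[of "{\<phi> c}" N "n + l" "{\<phi> c'}"] by simp
  qed
  have dis22: "fst q \<inter> fst q' = {} \<and> snd q \<inter> snd q' = {}" if qq: "q \<in> Q2" "q' \<in> Q2" "q \<noteq> q'" for q q'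
  proof -
    obtain X Y where c: "X \<in> P" "q = (X, cyl N (f X))" "Y \<in> P" "q' = (Y, cyl N (f Y))"
      using qq(1,2) unfolding Q2_def by (elim imageE)
    then have ne: "X \<noteq> Y" using qq(3) by auto
    have "X \<inter> Y = {}" using P(2) c(1,3) ne by (auto simp: pairwise_def disjnt_def)
    moreover have "f X \<inter> f Y = {}" using f(2) c(1,3) ne by (auto simp: disjoint_family_on_def)
    moreover have "f X \<subseteq> words N (n + l + l * s)" "f Y \<subseteq> words N (n + l + l * s)"
      using fX c(1,3) Wxw by blast+
    ultimately show ?thesis unfolding c(2,4) using cyl_disjoint[of "f X" N _ "f Y"] by simp
  qed
  have dis12: "fst q \<inter> fst q' = {} \<and> snd q \<inter> snd q' = {}" if qq: "q \<in> Q1" "q' \<in> Q2" for q q'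
  proof -
    obtain c where c: "c \<in> \<C>" "q = (extend N l c, cyl N {\<phi> c})" using qq(1) unfolding Q1_def by (elim imageE)
    obtain X where X: "X \<in> P" "q' = (X, cyl N (f X))" using qq(2) unfolding Q2_def by (elim imageE)
    have "c \<inter> Dg = {}" using \<C>b[OF c(1)] by (auto simp: Db_def Dg_def)
    then have "extend N l c \<inter> extend N l Dg = {}" by (rule extend_disjoint[OF \<C>w[OF c(1)] Dgw])
    then have "extend N l c \<inter> X = {}" using Xext[OF X(1)] by auto
    moreover have "cyl N {\<phi> c} \<inter> cyl N (f X) = {}" using cyl\<phi>[OF c(1)] cylf[OF X(1)] bs by auto
    ultimately show ?thesis unfolding c(2) X(2) by simp
  qed
  have "splits m (Piece U, cyl N {z})"
  proof (rule splitsI[of "Q1 \<union> Q2"])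
    show "sat (l * (m + 2)) (fst q)" if "q \<in> Q1 \<union> Q2" for q
    proof -
      have "sat (n + l + l) (fst q)" using that satX \<C>s sat_extend by (auto simp: Q1_def Q2_def)
      then show ?thesis unfolding nl(2) .
    qed
    show "matched (Suc m) (Piece (fst q), snd q)" if "q \<in> Q1 \<union> Q2" for q
      using that
    proof
      assume "q \<in> Q1"
      then obtain c where c: "c \<in> \<C>" "q = (extend N l c, cyl N {\<phi> c})" unfolding Q1_def by (elim imageE)
      obtain v where v: "v \<in> Db" "c = cluster (n + l) v" using c(1) by (auto simp: \<C>_def)
      have "v \<in> words N (n + l)" "v \<notin> good (n + l)" using v(1) sat_words[OF satDb] by (auto simp: Db_def)
      moreover have "\<phi> c \<in> words N (n + l)" using \<phi>w[OF c(1)] Wb(1) Wsw by auto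
      ultimately have "matched (Suc m) (Piece c, cyl N {\<phi> c})" unfolding v(2) nl(1) by (intro matched_bad)
      then show ?thesis by (simp add: c(2) Piece_extend)
    next
      assume "q \<in> Q2"
      then obtain X where X: "X \<in> P" "q = (X, cyl N (f X))" unfolding Q2_def by (elim imageE)
      have "group l (l * Suc m) X" using P(3) X(1) nl(1) by simp
      moreover have "target (Suc m) (f X)" unfolding target_def
      proof (intro exI[of _ "Suc m + s"] conjI)
        show "f X \<subseteq> words N (l * (Suc m + s))" using fX[OF X(1)] Wxw lev by auto
        show "1 \<le> card (f X)" "card (f X) \<le> N ^ l" using f(3) X(1) by auto
        show "Suc m + s \<le> Suc m + 2" using s2 by simp
        \<comment> \<open>All cylinders used lie below z, whose length \<open>l * m\<close> is that
          of the common prefix demanded at step m + 1.\<close>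
        have "take n v = z" if "v \<in> f X" for v
        proof -
          have "v \<in> Wx" using that fX[OF X(1)] by auto
          then have "take (n + l) v \<in> Wr" using extend_iff[OF Wrw] by (simp add: Wx_def)
          then have "take (n + l) v \<in> Ws" by (simp add: Wr_def)
          then have "take n (take (n + l) v) \<in> {z}" using extend_iff[OF zw] unfolding Ws_def by blast
          then show ?thesis by simp
        qed
        then show "\<exists>z. \<forall>w\<in>f X. take (l * (Suc m - 1)) w = z" unfolding n_def by auto
      qed auto
      ultimately show ?thesis by (simp add: X(2) matched_good)
    qed
    show "fst q \<inter> fst q' = {} \<and> snd q \<inter> snd q' = {}" if "q \<in> Q1 \<union> Q2" "q' \<in> Q1 \<union> Q2" "q \<noteq> q'" for q q'
      using that dis11[of q q'] dis22[of q q'] dis12[of q q'] dis12[of q' q] by (auto simp: Int_commute)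
    have "(\<Union>q\<in>Q1 \<union> Q2. fst q) = extend N l (\<Union>\<C>) \<union> \<Union>P"
      by (auto simp: Q1_def Q2_def extend_Union)
    also have "\<dots> = extend N l (Db \<union> Dg)" unfolding U\<C> P(1) extend_Un ..
    also have "Db \<union> Dg = D" by (auto simp: Db_def Dg_def)
    finally show "Piece U = Piece (\<Union>q\<in>Q1 \<union> Q2. fst q)" by (simp add: D_def Piece_extend)
    have "(\<Union>q\<in>Q1 \<union> Q2. snd q) = (\<Union>c\<in>\<C>. cyl N {\<phi> c}) \<union> (\<Union>X\<in>P. cyl N (f X))"
      by (auto simp: Q1_def Q2_def)
    also have "(\<Union>X\<in>P. cyl N (f X)) = cyl N Wr"
      unfolding cyl_UN[symmetric] f(1) Wx_def using Wrw by (rule cyl_extend)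
    also have "(\<Union>c\<in>\<C>. cyl N {\<phi> c}) = cyl N (\<phi> ` \<C>)" unfolding cyl_UN[symmetric] UNION_singleton_eq_range ..
    also have "\<phi> ` \<C> = Wb" using \<phi> by (simp add: bij_betw_def)
    also have "cyl N Wb \<union> cyl N Wr = cyl N Ws" unfolding cyl_Un[symmetric] Wr_def using Wb(1) by (simp add: Un_absorb1)
    also have "\<dots> = cyl N {z}" unfolding Ws_def using zw by (rule cyl_extend)
    finally show "cyl N {z} = (\<Union>q\<in>Q1 \<union> Q2. snd q)" ..
  qed
  then show ?thesis by (simp add: U_def n_def)
qed

text \<open>The last cylinder \<open>w\<close> of the family is divided into \<open>N ^ l\<close> subcylinders, \<open>card W\<close> of which go to one
  subgroup; then the numbers of remaining subgroups and cylinders agree.\<close>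

lemma splits_good:
  assumes X: "group l (l * m) X" and W: "target m W"
  shows "splits m (Piece X, cyl N W)"
proof -
  obtain t where t: "W \<subseteq> words N (l * t)" "1 \<le> card W" "card W \<le> N ^ l" "card W = 1 \<or> m \<le> t" "m \<le> t + 1" "t \<le> m + 2"
    using W unfolding target_def by blast
  have gX: "gsat (l * m + l) X" using X by (rule group_gsat)
  have cX: "card X = g * N ^ l" using X by (simp add: group_def)
  obtain P where P: "\<Union>P = extend N l X" "disjoint P" "\<forall>Y\<in>P. group l (l * m + l) Y"
    using split[OF gX] by (elim exE conjE)
  have nl: "l * m + l = l * Suc m" "l * m + l + l = l * (m + 2)" by (simp_all add: algebra_simps)
  have satY: "sat (l * (m + 2)) Y" if "Y \<in> P" for Y
    using P(3) that group_gsat gsat_sat nl(2) by metis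
  have fP: "finite P"
  proof (rule finite_UnionD)
    show "finite (\<Union>P)" unfolding P(1) using gsat_finite[OF gsat_extend[OF gX]] .
  qed
  have "card (\<Union>P) = (\<Sum>Y\<in>P. card Y)"
    using P(2) satY sat_finite by (intro card_Union_disjoint) blast+
  also have "\<dots> = (\<Sum>Y\<in>P. g * N ^ l)" by (rule sum.cong[OF refl]) (use P(3) in \<open>simp add: group_def\<close>)
  finally have "card (\<Union>P) = card P * (g * N ^ l)" by simp
  then have "card P * (g * N ^ l) = N ^ l * (g * N ^ l)"
    unfolding P(1) card_extend[OF gsat_words[OF gX]] cX by (simp only: mult.commute)
  moreover have "g * N ^ l \<noteq> 0" using g_pos Npow_pos[of l] by simp
  \<comment> \<open>A group is as large as each of its subgroups, and l further letters multiply the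
    number of words by \<open>N ^ l\<close>.\<close>
  ultimately have cP: "card P = N ^ l" by (metis mult_right_cancel)
  have fW: "finite W" using t(1) by (rule finite_subset) simp
  obtain w where w: "w \<in> W" using t(2) by fastforce
  have ww: "{w} \<subseteq> words N (l * t)" using w t(1) by auto
  define Sub where "Sub = extend N l {w}"
  have Subw: "Sub \<subseteq> words N (l * t + l)" unfolding Sub_def using ww by (rule extend_words)
  have fSub: "finite Sub" using Subw by (rule finite_subset) simp
  have cSub: "card Sub = N ^ l" unfolding Sub_def using card_extend[OF ww] by simp
  have "card W \<le> card Sub" using t(3) cSub by simp
  then obtain Subs where Subs: "Subs \<subseteq> Sub" "card Subs = card W" by (metis obtain_subset_with_card_n)
  define W' where "W' = W - {w}"
  define Sub' where "Sub' = Sub - Subs"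
  have takeSub: "take (l * t) v = w" if "v \<in> Sub" for v
    using that extend_iff[OF ww] by (auto simp: Sub_def)
  have fSubs: "finite Subs" using Subs(1) fSub by (rule finite_subset)
  have Subsne: "Subs \<noteq> {}" using Subs(2) t(2) by auto
  \<comment> \<open>One family of \<open>card W\<close> cylinders and single ones otherwise:
    \<open>1 + (card W - 1) + (N ^ l - card W)\<close> parts, as many as subgroups.\<close>
  define T where "T = insert Subs ((\<lambda>v. {v}) ` W' \<union> (\<lambda>v. {v}) ` Sub')"
  have len: "length v = l * t" if "v \<in> W" for v using that t(1) length_words by auto
  have lenS: "length v = l * t + l" if "v \<in> Sub" for v using that Subw length_words by auto
  have WS: "W \<inter> Sub = {}" using len lenS l_pos by fastforce
  have cT: "card T = N ^ l"
  proof -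
    have "card ((\<lambda>v. {v}) ` W' \<union> (\<lambda>v. {v}) ` Sub') = card W' + card Sub'"
    proof -
      have "(\<lambda>v. {v}) ` W' \<inter> (\<lambda>v. {v}) ` Sub' = {}" using WS by (auto simp: W'_def Sub'_def)
      then show ?thesis using fW fSub by (simp add: card_Un_disjoint card_image inj_on_def W'_def Sub'_def)
    qed
    moreover have "Subs \<notin> (\<lambda>v. {v}) ` W' \<union> (\<lambda>v. {v}) ` Sub'"
      using Subs(1) WS by (auto simp: W'_def Sub'_def)
    ultimately have "card T = Suc (card W' + card Sub')"
      unfolding T_def using fW fSub by (subst card_insert_disjoint) (simp_all add: W'_def Sub'_def)
    moreover have "card W' = card W - 1" using w by (simp add: W'_def)
    moreover have "card Sub' = N ^ l - card W"
      unfolding Sub'_def using Subs fSubs cSub by (simp add: card_Diff_subset)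
    ultimately show ?thesis using t(2,3) by linarith
  qed
  have fT: "finite T" unfolding T_def W'_def Sub'_def using fW fSub by simp
  obtain \<beta> where \<beta>: "bij_betw \<beta> P T" using finite_same_card_bij[OF fP fT] cP cT by auto
  have \<beta>T: "\<beta> Y \<in> T" if "Y \<in> P" for Y using \<beta> that by (auto simp: bij_betw_def)
  \<comment> \<open>The part in \<open>T\<close> to which a sequence of \<open>cyl N W\<close>
    belongs, read off from its prefixes. It shows at once that the parts are disjoint and that they
    cover \<open>cyl N W\<close>.\<close>
  define \<kappa> where "\<kappa> x = (if pre (l * t) x \<noteq> w then {pre (l * t) x}
      else if pre (l * t + l) x \<in> Subs then Subs else {pre (l * t + l) x})" for x
  have inT: "x \<in> cyl N V \<longleftrightarrow> x \<in> cyl N W \<and> \<kappa> x = V" if V: "V \<in> T" for x V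
  proof -
    have pw: "pre (l * t + l) x \<in> Sub \<longleftrightarrow> pre (l * t) x = w" if "x \<in> seqs N"
      using extend_iff[OF ww, of "pre (l * t + l) x" l] pre_words[OF that, of "l * t + l"] take_pre[of "l * t" "l * t + l" x]
      by (simp add: Sub_def)
    consider "V = Subs" | v where "v \<in> W'" "V = {v}" | v where "v \<in> Sub'" "V = {v}"
      using V unfolding T_def by blast
    then show ?thesis
    proof cases
      case 1
      have "V \<subseteq> words N (l * t + l)" using 1 Subs(1) Subw by auto
      then show ?thesis unfolding cyl_iff[OF \<open>V \<subseteq> words N (l * t + l)\<close>] cyl_iff[OF t(1)] \<kappa>_def
        using 1 pw Subs(1) w WS by (auto split: if_splits)
    next
      case 2
      have V': "V \<subseteq> words N (l * t)" using 2 t(1) by (auto simp: W'_def)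
      show ?thesis unfolding cyl_iff[OF V'] cyl_iff[OF t(1)] \<kappa>_def
        using 2 pw Subs(1) w WS by (auto simp: W'_def split: if_splits)
    next
      case 3
      have V': "V \<subseteq> words N (l * t + l)" using 3 Subw by (auto simp: Sub'_def)
      show ?thesis unfolding cyl_iff[OF V'] cyl_iff[OF t(1)] \<kappa>_def
        using 3 pw Subs(1) w WS by (auto simp: Sub'_def split: if_splits)
    qed
  qed
  have \<kappa>T: "\<kappa> x \<in> T" if x: "x \<in> cyl N W" for x
  proof -
    have "x \<in> seqs N" "pre (l * t) x \<in> W" using x cyl_iff[OF t(1)] by auto
    moreover have "pre (l * t + l) x \<in> Sub" if "pre (l * t) x = w"
      using extend_iff[OF ww, of "pre (l * t + l) x" l] pre_words[OF \<open>x \<in> seqs N\<close>, of "l * t + l"] take_pre[of "l * t" "l * t + l" x] that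
      by (simp add: Sub_def)
    ultimately show ?thesis by (auto simp: \<kappa>_def T_def W'_def Sub'_def)
  qed
  \<comment> \<open>Parts cut out of w move to level t + 1 together with the step. The cylinders of
    \<open>W'\<close> stay at level t and thus fall back by one step; they exist only if
    \<open>W\<close> has at least two elements, and then \<open>m \<le> t\<close> makes this lag
    admissible.\<close>
  have tgt: "target (Suc m) V" if V: "V \<in> T" for V
  proof -
    have pref: "\<exists>z. \<forall>v\<in>V'. take (l * (Suc m - 1)) v = z" if "m \<le> t" "V' \<subseteq> Sub" for V'
    proof -
      have "take (l * m) v = take (l * m) w" if "v \<in> V'" for v
      proof -
        have le: "l * m \<le> l * t" using \<open>m \<le> t\<close> by (rule mult_le_mono2)
        have "take (l * m) v = take (l * m) (take (l * t) v)" using le by (simp add: min_absorb1)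
        also have "take (l * t) v = w" using that \<open>V' \<subseteq> Sub\<close> by (intro takeSub) auto
        finally show ?thesis .
      qed
      then show ?thesis by auto
    qed
    consider "V = Subs" | v where "v \<in> W'" "V = {v}" | v where "v \<in> Sub'" "V = {v}"
      using V unfolding T_def by blast
    then show ?thesis
    proof cases
      case 1
      show ?thesis unfolding target_def 1
      proof (intro exI[of _ "Suc t"] conjI)
        show "Subs \<subseteq> words N (l * Suc t)" using Subs(1) Subw by (auto simp: add.commute)
        show "\<exists>z. \<forall>v\<in>Subs. take (l * (Suc m - 1)) v = z"
        proof (cases "card W = 1")
          case True
          then obtain v where "Subs = {v}" using Subs(2) by (metis card_1_singletonE)
          then show ?thesis by simp
        next
          case False
          then show ?thesis using t(4) pref Subs(1) by blast
        qed
      qed (use t Subs(2) in auto)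
    next
      case 2
      have "2 \<le> card W"
      proof -
        have "card {w, v} \<le> card W" using w 2 fW by (intro card_mono) (auto simp: W'_def)
        then show ?thesis using 2 by (auto simp: W'_def)
      qed
      then have "m \<le> t" using t(4) by auto
      then show ?thesis unfolding target_def 2 using t(1,6) 2(1) Npow_pos[of l]
        by (intro exI[of _ t]) (auto simp: W'_def Suc_le_eq)
    next
      case 3
      have "{v} \<subseteq> words N (l * Suc t)" using 3(1) Subw by (auto simp: Sub'_def add.commute)
      then show ?thesis unfolding target_def 3 using t(5,6) Npow_pos[of l]
        by (intro exI[of _ "Suc t"]) (auto simp: Suc_le_eq)
    qed
  qed
  define Q where "Q = (\<lambda>Y. (Y, cyl N (\<beta> Y))) ` P"
  show ?thesis
  proof (rule splitsI[of Q])
    show "sat (l * (m + 2)) (fst q)" if "q \<in> Q" for q using that satY by (auto simp: Q_def)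
    show "matched (Suc m) (Piece (fst q), snd q)" if qQ: "q \<in> Q" for q
    proof -
      obtain Y where Y: "Y \<in> P" "q = (Y, cyl N (\<beta> Y))" using qQ unfolding Q_def by (elim imageE)
      have "group l (l * Suc m) Y" using P(3) Y(1) nl(1) by simp
      then show ?thesis using tgt[OF \<beta>T[OF Y(1)]] by (simp add: Y(2) matched_good)
    qed
    show "fst q \<inter> fst q' = {} \<and> snd q \<inter> snd q' = {}" if qq: "q \<in> Q" "q' \<in> Q" "q \<noteq> q'" for q q'
    proof -
      obtain Y Z where Y: "Y \<in> P" "q = (Y, cyl N (\<beta> Y))" "Z \<in> P" "q' = (Z, cyl N (\<beta> Z))"
        using qq(1,2) unfolding Q_def by (elim imageE)
      have ne: "Y \<noteq> Z" using qq(3) Y by auto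
      then have "\<beta> Y \<noteq> \<beta> Z" using \<beta> Y(1,3) by (auto simp: bij_betw_def inj_on_def)
      then have "cyl N (\<beta> Y) \<inter> cyl N (\<beta> Z) = {}"
        using inT[OF \<beta>T[OF Y(1)]] inT[OF \<beta>T[OF Y(3)]] by auto
      moreover have "Y \<inter> Z = {}" using P(2) Y(1,3) ne by (auto simp: pairwise_def disjnt_def)
      ultimately show ?thesis unfolding Y(2,4) by simp
    qed
    have "(\<Union>q\<in>Q. fst q) = \<Union>P" by (auto simp: Q_def)
    then show "Piece X = Piece (\<Union>q\<in>Q. fst q)" by (simp add: P(1) Piece_extend)
    have "(\<Union>q\<in>Q. snd q) = (\<Union>V\<in>\<beta> ` P. cyl N V)" by (auto simp: Q_def)
    also have "\<beta> ` P = T" using \<beta> by (simp add: bij_betw_def)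
    also have "(\<Union>V\<in>T. cyl N V) = cyl N W"
    proof (intro set_eqI iffI)
      fix x assume "x \<in> (\<Union>V\<in>T. cyl N V)"
      then obtain V where V: "V \<in> T" "x \<in> cyl N V" by (elim UN_E)
      then show "x \<in> cyl N W" using inT[OF V(1), of x] by blast
    next
      fix x assume x: "x \<in> cyl N W"
      have "x \<in> cyl N (\<kappa> x)" using inT[OF \<kappa>T[OF x], of x] x by blast
      then show "x \<in> (\<Union>V\<in>T. cyl N V)" using \<kappa>T[OF x] by (rule UN_I[rotated])
    qed
    finally show "cyl N W = (\<Union>q\<in>Q. snd q)" ..
  qed
qed

text \<open>In the diameter constant, \<open>2 * C\<close> comes from the clusters in
  \<open>E\<close>. The term \<open>1 / r ^ l\<close> pays for the lag of one step: partners at step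
  m share only their first \<open>l * (m - 1)\<close> coordinates.\<close>

lemma bilipschitz_seqs:
  "\<exists>f L. bij_betw f E (seqs N) \<and> L \<ge> 1 \<and>
     (\<forall>x\<in>E. \<forall>y\<in>E. inverse L * dist x y \<le> seq_dist r (f x) (f y) \<and> seq_dist r (f x) (f y) \<le> L * dist x y)"
proof (rule bilipschitz_of_matching_tree[where R = matched and \<rho> = "r ^ l" and c = "r ^ (4 * l)"
      and C = "max (2 * C) (1 / r ^ l)"])
  show "0 < r ^ l" "0 < r ^ (4 * l)" by simp_all
  show "r ^ l < 1" using r0 r1 l_pos by (simp add: power_less_one_iff)
  show "dist x y = 0 \<longleftrightarrow> x = y" for x y :: 'a by simp
  show "seq_dist r x y = 0 \<longleftrightarrow> x = y" for x y using r0 by (rule seq_dist_eq_0)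
  show "matched 0 (E, seqs N)"
  proof -
    have nil: "cluster (l * 0) [] = {[]}" using cluster_words[of "[]" 0] cluster_refl[of "[]" 0] by auto
    have "[] \<notin> good (l * 0)" using C0_words n0 by (auto simp: good_def words_def)
    then have "matched 0 (Piece (cluster (l * 0) []), cyl N {[]})" by (intro matched_bad) auto
    moreover have "Piece {[]} = E" by (simp add: Piece_def piece_def)
    moreover have "cyl N {[]} = seqs N" using cyl_iff[of "{[]}" N 0] by (auto simp: pre_def)
    ultimately show ?thesis unfolding nil by simp
  qed
  show "0 \<le> dist x y \<and> dist x y \<le> max (2 * C) (1 / r ^ l) * (r ^ l) ^ m"
    if p: "matched m p" "x \<in> fst p" "y \<in> fst p" for m p x y
  proof -
    obtain w where w: "w \<in> words N (l * m)" "fst p \<subseteq> Piece (cluster (l * m) w)" using matched_cluster[OF p(1)] by auto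
    have "dist x y \<le> 2 * C * r ^ (l * m)" using dist_in_cluster[OF w(1)] w(2) p(2,3) by blast
    also have "\<dots> \<le> max (2 * C) (1 / r ^ l) * r ^ (l * m)" by (intro mult_right_mono) auto
    finally show ?thesis by (simp add: power_mult)
  qed
  show "0 \<le> seq_dist r x y \<and> seq_dist r x y \<le> max (2 * C) (1 / r ^ l) * (r ^ l) ^ m"
    if p: "matched m p" "x \<in> snd p" "y \<in> snd p" for m p x y
  proof -
    have "seq_dist r x y \<le> r ^ (l * (m - 1))" using matched_agree[OF p] by (intro seq_dist_le r0 r1)
    also have "\<dots> \<le> 1 / r ^ l * r ^ (l * m)"
    proof (cases m)
      case 0
      \<comment> \<open>Here \<open>m - 1\<close> is truncated to 0, and the bound to be met is
        1.\<close>
      have "r ^ l \<le> 1" using r0 r1 by (intro power_le_one) auto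
      then show ?thesis using 0 r0 by simp
    next
      case (Suc k) then show ?thesis using r0 by (simp add: power_add)
    qed
    also have "\<dots> \<le> max (2 * C) (1 / r ^ l) * r ^ (l * m)" by (intro mult_right_mono) auto
    finally show ?thesis using seq_dist_nonneg[OF r0] by (simp add: power_mult)
  qed
  show "\<exists>P. (\<forall>q\<in>P. matched (Suc m) q) \<and> fst p = \<Union>(fst ` P) \<and> snd p = \<Union>(snd ` P) \<and>
     (\<forall>q\<in>P. \<forall>q'\<in>P. q \<noteq> q' \<longrightarrow> (\<forall>x\<in>fst q. \<forall>y\<in>fst q'. r ^ (4 * l) * (r ^ l) ^ m \<le> dist x y) \<and>
                               (\<forall>x\<in>snd q. \<forall>y\<in>snd q'. r ^ (4 * l) * (r ^ l) ^ m \<le> seq_dist r x y))"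
    if "matched m p" for m p
    unfolding splits_def[symmetric] using that
    by (cases rule: matchedE) (simp_all add: splits_bad splits_good)
  show "(\<Inter>n. fst (p n)) \<noteq> {}"
    if "\<And>n. matched n (p n)" "\<And>n. fst (p (Suc n)) \<subseteq> fst (p n)" for p
    using matched_compact_fst[OF that(1)] lift_Suc_antimono_le[of "\<lambda>n. fst (p n)", OF that(2)]
    by (intro compact_nest) auto
  show "(\<Inter>n. snd (p n)) \<noteq> {}"
    if p: "\<And>n. matched n (p n)" "\<And>n. snd (p (Suc n)) \<subseteq> snd (p n)" for p
  proof (rule nested_determined[where L = "\<lambda>m. l * (m + 2)" and N = N])
    show "determined N (l * (m + 2)) (snd (p m))" "snd (p m) \<noteq> {}" for m using matched_snd[OF p(1)] by auto
    show "snd (p (Suc m)) \<subseteq> snd (p m)" for m by (rule p(2))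
    show "x i = y i" if "x \<in> snd (p m)" "y \<in> snd (p m)" "i + 1 < m" for m x y i
    proof (rule matched_agree[OF p(1) that(1,2)])
      have "1 * (m - 1) \<le> l * (m - 1)" using l_pos by (rule mult_le_mono1)
      then show "i < l * (m - 1)" using that(3) by linarith
    qed
  qed
qed

end

section \<open>Existence of a largest cluster, and the conclusion\<close>

context osc_system
begin

text \<open>Sizes of clusters are bounded, so a largest one occurs. The maximum is taken over
  positive levels to ensure \<open>1 \<le> n0\<close>; the single cluster of level 0 has one word
  and cannot exceed it.\<close>

lemma maximal_cluster_exists:
  obtains n0 w0 C where "osc_maximal N r S E n0 w0 C"
proof -
  obtain M C where M: "\<And>n w. w \<in> words N n \<Longrightarrow> card (cluster n w) \<le> M"
    and C: "\<And>n w v x y. w \<in> words N n \<Longrightarrow> v \<in> cluster n w \<Longrightarrow> x \<in> piece w \<Longrightarrow> y \<in> piece v \<Longrightarrow> dist x y \<le> C * r ^ n"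
    using cluster_bounds by metis
  define Z where "Z = {card (cluster n w) |n w. 1 \<le> n \<and> w \<in> words N n}"
  have fZ: "finite Z" by (rule finite_subset[of _ "{..M}"]) (use M in \<open>auto simp: Z_def\<close>)
  have one: "[0] \<in> words N 1" using N2 by (simp add: words_def)
  then have "card (cluster 1 [0]) \<in> Z" unfolding Z_def by blast
  then have "Max Z \<in> Z" using fZ by (intro Max_in) auto
  then obtain n0 w0 where n0: "Max Z = card (cluster n0 w0)" "1 \<le> n0" "w0 \<in> words N n0" unfolding Z_def by blast
  have le: "card (cluster n w) \<le> card (cluster n0 w0)" if w: "w \<in> words N n" for n w
  proof (cases "1 \<le> n")
    case True
    then have "card (cluster n w) \<in> Z" using w unfolding Z_def by blast
    then show ?thesis unfolding n0(1)[symmetric] using fZ by (intro Max_ge)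
  next
    case False
    then have "n = 0" by simp
    then have "cluster n w \<subseteq> {[]}" using cluster_words[OF w] by simp
    then have "card (cluster n w) \<le> 1" using card_mono[of "{[]}" "cluster n w"] by simp
    also have "1 \<le> card (cluster n0 w0)"
    proof -
      have "finite (cluster n0 w0)" using cluster_words[OF n0(3)] by (rule finite_subset) simp
      then show ?thesis using cluster_refl[of w0 n0] by (auto simp: Suc_le_eq card_gt_0_iff)
    qed
    finally show ?thesis .
  qed
  have "osc_maximal N r S E n0 w0 C"
    by unfold_locales (use n0 le C in blast)+
  then show thesis by (rule that)
qed

lemma lipschitz_seqs:
  "\<exists>f L. bij_betw f E (seqs N) \<and> L \<ge> 1 \<and>
     (\<forall>x\<in>E. \<forall>y\<in>E. inverse L * dist x y \<le> seq_dist r (f x) (f y) \<and> seq_dist r (f x) (f y) \<le> L * dist x y)"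
proof -
  obtain n0 w0 C where max: "osc_maximal N r S E n0 w0 C" by (rule maximal_cluster_exists)
  interpret osc_maximal N r S E n0 w0 C by (rule max)
  show ?thesis
  proof (rule good_step_exists)
    fix l assume l: "1 \<le> l" "M \<le> N ^ l"
      "\<And>n V. gsat n V \<Longrightarrow> \<exists>P. \<Union>P = extend N l V \<and> disjoint P \<and> (\<forall>X\<in>P. group l n X)"
      "\<And>n w. w \<in> words N n \<Longrightarrow> card (extend N l (cluster n w) - good (n + l)) < N ^ l"
    interpret osc_step N r S E n0 w0 C l by unfold_locales (fact l)+
    show ?thesis by (rule bilipschitz_seqs)
  qed
qed

end

theorem theorem1p5:
  fixes N :: nat and r :: real
    and S :: "nat \<Rightarrow> real ^ 'd \<Rightarrow> real ^ 'd" and E :: "(real ^ 'd) set"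
    and S' :: "nat \<Rightarrow> real ^ 'e \<Rightarrow> real ^ 'e" and E' :: "(real ^ 'e) set"
  assumes "N \<ge> 2" and "0 < r" and "r < 1"
    and "\<And>i. i < N \<Longrightarrow> contracting_similarity r (S i)"
    and "self_similar_set_of N S E"
    and "open_set_condition N S"
    and "totally_disconnected E"
    and "\<And>i. i < N \<Longrightarrow> contracting_similarity r (S' i)"
    and "self_similar_set_of N S' E'"
    and "open_set_condition N S'"
    and "totally_disconnected E'"
  shows "lipschitz_equivalent E E'"
proof -
  interpret E1: osc_system N r S E by unfold_locales (use assms in auto)
  interpret E2: osc_system N r S' E' by unfold_locales (use assms in auto)
  obtain f K where f: "bij_betw f E (seqs N)" "K \<ge> 1"
    and fd: "\<forall>x\<in>E. \<forall>y\<in>E. inverse K * dist x y \<le> seq_dist r (f x) (f y) \<and> seq_dist r (f x) (f y) \<le> K * dist x y"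
    using E1.lipschitz_seqs by (elim exE conjE)
  obtain h L where h: "bij_betw h E' (seqs N)" "L \<ge> 1"
    and hd: "\<forall>x\<in>E'. \<forall>y\<in>E'. inverse L * dist x y \<le> seq_dist r (h x) (h y) \<and> seq_dist r (h x) (h y) \<le> L * dist x y"
    using E2.lipschitz_seqs by (elim exE conjE)
  \<comment> \<open>The two codings end in the same space, since \<open>seqs N\<close> and
    \<open>seq_dist r\<close> depend on N and r alone.\<close>
  define k where "k x = inv_into E' h (f x)" for x
  have bij: "bij_betw k E E'"
    using bij_betw_trans[OF f(1) bij_betw_inv_into[OF h(1)]] by (simp add: k_def[abs_def] comp_def)
  have hk: "h (k x) = f x" if "x \<in> E" for x
    using that f(1) h(1) unfolding k_def bij_betw_def by (auto intro!: f_inv_into_f)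
  have "inverse (K * L) * dist x y \<le> dist (k x) (k y) \<and> dist (k x) (k y) \<le> K * L * dist x y"
    if xy: "x \<in> E" "y \<in> E" for x y
  proof -
    have kk: "k x \<in> E'" "k y \<in> E'" using bij xy by (auto simp: bij_betw_def)
    define s where "s = seq_dist r (f x) (f y)"
    have 1: "inverse K * dist x y \<le> s" "s \<le> K * dist x y" using fd xy by (auto simp: s_def)
    have 2: "inverse L * dist (k x) (k y) \<le> s" "s \<le> L * dist (k x) (k y)"
      using hd[rule_format, OF kk] unfolding hk[OF xy(1)] hk[OF xy(2)] s_def by auto
    have "dist x y \<le> K * s" using 1(1) f(2) by (simp add: field_simps)
    also have "\<dots> \<le> K * (L * dist (k x) (k y))" using 2(2) f(2) by (intro mult_left_mono) auto
    finally have "inverse (K * L) * dist x y \<le> dist (k x) (k y)" using f(2) h(2) by (simp add: field_simps)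
    moreover have "dist (k x) (k y) \<le> L * s" using 2(1) h(2) by (simp add: field_simps)
    moreover have "L * s \<le> L * (K * dist x y)" using 1(2) h(2) by (intro mult_left_mono) auto
    ultimately show ?thesis by (simp add: algebra_simps)
  qed
  moreover have "K * L \<ge> 1" using mult_mono[of 1 K 1 L] f(2) h(2) by simp
  ultimately show ?thesis unfolding lipschitz_equivalent_def using bij by blast
qed

end
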